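(* Let $G=\mathbb{Z}_{p^2}\times\mathbb{Z}_2\times\mathbb{Z}_2$ for an odd prime $p$, let $S$ be a proper subset of $G\setminus\{0\}$ that generates $G$, and let $S_0=S\cup\{0\}$. Let $0\in C\subseteq G$. Put $\mathbf{e}_1=(1,0,0)$. Then $C$ is a perfect code in $\mathrm{Cay}(G,S)$ if and only if there exist two elements $\mathbf{e}_2,\mathbf{e}_3$ generating $\{0\}\times\mathbb{Z}_2\times\mathbb{Z}_2$ and integer parameters such that $(S_0,C)$ is one of the following pairs: (1) $S_0=\{(i+\alpha_ip)\mathbf{e}_1+\alpha_i\mathbf{e}_2+\beta_i\mathbf{e}_3\mid i\in[p]\}$, $C=\{ip\mathbf{e}_1+j\mathbf{e}_2+k\mathbf{e}_3\mid i\in[p],j,k\in[2]\}$; (2) $S_0=\{(i+jp)\mathbf{e}_1+\alpha_i\mathbf{e}_2+\beta_i\mathbf{e}_3\mid i,j\in[p]\}$, $C=\{\lambda_{ij}p\mathbf{e}_1+i\mathbf{e}_2+j\mathbf{e}_3\mid i,j\in[2]\}$; (3) $S_0=\{(i+jp)\mathbf{e}_1+\alpha_{ij}\mathbf{e}_2+\alpha_i\mathbf{e}_3\mid i,j\in[p]\}$, $C=\{\lambda_ip\mathbf{e}_1+j\mathbf{e}_2+i\mathbf{e}_3\mid i,j\in[2]\}$; (4) $S_0=\{i\mathbf{e}_1+\alpha_i\mathbf{e}_2+\beta_i\mathbf{e}_3\mid i\in[p^2]\}$, $C=\{i\mathbf{e}_2+j\mathbf{e}_3\mid i,j\in[2]\}$;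 (5) $S_0=\{(i+\alpha_ip)\mathbf{e}_1+j\mathbf{e}_2+\alpha_i\mathbf{e}_3\mid i\in[p],j\in[2]\}$, $C=\{ip\mathbf{e}_1+\lambda_{ij}\mathbf{e}_2+j\mathbf{e}_3\mid i\in[p],j\in[2]\}$; (6) $S_0=\{(i+\alpha_{ij}p)\mathbf{e}_1+j\mathbf{e}_2+\alpha_i\mathbf{e}_3\mid i\in[p],j\in[2]\}$, $C=\{jp\mathbf{e}_1+\lambda_i\mathbf{e}_2+i\mathbf{e}_3\mid i\in[2],j\in[p]\}$; (7) $S_0=\{(i+\alpha_ip)\mathbf{e}_1+\alpha_{ij}\mathbf{e}_2+j\mathbf{e}_3\mid i\in[p],j\in[2]\}$, $C=\{ip\mathbf{e}_1+j\mathbf{e}_2+\lambda_i\mathbf{e}_3\mid i\in[p],j\in[2]\}$; (8) $S_0=\{(\alpha_i+jp)\mathbf{e}_1+\alpha_{ij}\mathbf{e}_2+i\mathbf{e}_3\mid i\in[2],j\in[p]\}$, $C=\{(i+\lambda_ip)\mathbf{e}_1+j\mathbf{e}_2\mid i\in[p],j\in[2]\}$; (9) $S_0=\{(i+\alpha_{ij}p)\mathbf{e}_1+\alpha_{ij}\mathbf{e}_2+j\mathbf{e}_3\mid i\in[p],j\in[2]\}$, $C=\{ip\mathbf{e}_1+j\mathbf{e}_2\mid i\in[p],j\in[2]\}$; (10) $S_0=\{\alpha_i\mathbf{e}_1+j\mathbf{e}_2+i\mathbf{e}_3\mid i,j\in[2]\}$, $C=\{i\mathbf{e}_1+\lambda_i\mathbf{e}_2\mid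 i\in[p^2]\}$; (11) $S_0=\{(\alpha_i+\alpha_{ij}p)\mathbf{e}_1+j\mathbf{e}_2+i\mathbf{e}_3\mid i,j\in[2]\}$, $C=\{(i+jp)\mathbf{e}_1+\lambda_i\mathbf{e}_2\mid i,j\in[p]\}$; (12) $S_0=\{\alpha_{ij}\mathbf{e}_1+i\mathbf{e}_2+j\mathbf{e}_3\mid i,j\in[2]\}$, $C=\{i\mathbf{e}_1\mid i\in[p^2]\}$; (13) $S_0=\{i\mathbf{e}_1+j\mathbf{e}_2+\alpha_i\mathbf{e}_3\mid i\in[p^2],j\in[2]\}$, $C=\{\lambda_i\mathbf{e}_2+i\mathbf{e}_3\mid i\in[2]\}$; (14) $S_0=\{(i+kp)\mathbf{e}_1+\alpha_{ij}\mathbf{e}_2+j\mathbf{e}_3\mid i,k\in[p],j\in[2]\}$, $C=\{\lambda_ip\mathbf{e}_1+i\mathbf{e}_2\mid i\in[2]\}$; (15) $S_0=\{(i+jp)\mathbf{e}_1+k\mathbf{e}_2+\alpha_i\mathbf{e}_3\mid i,j\in[p],k\in[2]\}$, $C=\{\lambda_ip\mathbf{e}_1+\lambda_i\mathbf{e}_2+i\mathbf{e}_3\mid i\in[2]\}$; (16) $S_0=\{i\mathbf{e}_1+\alpha_{ij}\mathbf{e}_2+j\mathbf{e}_3\mid i\in[p^2],j\in[2]\}$, $C=\{i\mathbf{e}_2\mid i\in[2]\}$; (17) $S_0=\{(i+\alpha_{ij}p)\mathbf{e}_1+k\mathbf{e}_2+j\mathbf{e}_3\mid i\in[p],j,k\in[2]\}$,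 $C=\{ip\mathbf{e}_1+\lambda_i\mathbf{e}_2\mid i\in[p]\}$; (18) $S_0=\{(\alpha_{ij}+kp)\mathbf{e}_1+i\mathbf{e}_2+j\mathbf{e}_3\mid i,j\in[2],k\in[p]\}$, $C=\{(i+\lambda_ip)\mathbf{e}_1\mid i\in[p]\}$; (19) $S_0=\{(\alpha_i+jp)\mathbf{e}_1+k\mathbf{e}_2+i\mathbf{e}_3\mid i,k\in[2],j\in[p]\}$, $C=\{(i+\lambda_ip)\mathbf{e}_1+\lambda_i\mathbf{e}_2\mid i\in[p]\}$; (20) $S_0=\{(i+\alpha_ip)\mathbf{e}_1+j\mathbf{e}_2+k\mathbf{e}_3\mid i\in[p],j,k\in[2]\}$, $C=\{ip\mathbf{e}_1+\lambda_i\mathbf{e}_2+\mu_i\mathbf{e}_3\mid i\in[p]\}$; (21) $S_0=\{(i+\alpha_{ijk}p)\mathbf{e}_1+j\mathbf{e}_2+k\mathbf{e}_3\mid i\in[p],j,k\in[2]\}$, $C=\{ip\mathbf{e}_1\mid i\in[p]\}$.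
   Context: Groups are finite abelian, written additively; $\mathbb{Z}_n$ is the group of integers modulo $n$ and $[n]=\{0,1,\dots,n-1\}$. For $S\subseteq G\setminus\{0\}$, $\mathrm{Cay}(G,S)$ is the directed graph with vertex set $G$ and an arc from $x$ to $y$ if and only if $y-x\in S$ ($S$ is not assumed to be inverse-closed). A subset $C\subseteq G$ is a perfect code in $\mathrm{Cay}(G,S)$ if the sets $\{c\}\cup\{v:\text{there is an arc from } c \text{ to } v\}$, $c\in C$, form a partition of $G$. Greek letters with subscripts denote arbitrary integers, one for each value of the displayed indices, subject only to being $0$ when all subscripts are $0$; different letters (or index patterns) denote independent families, and an integer occurring several times in one element is the same integer each time. *)

theory Defs
  imports
    "HOL-Algebra.Elementary_Groups"
    "HOL-Algebra.Generated_Groups"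
    "Graph_Theory.Pair_Digraph"
    "HOL-Library.Disjoint_Sets"
    "HOL-Computational_Algebra.Primes"
begin

text \<open>
  The groups of \<open>HOL-Algebra\<close> are written multiplicatively: the additive expressions \<open>y - x\<close>,
  \<open>n x\<close> (for an integer \<open>n\<close>) and \<open>0\<close> appear as \<open>y \<otimes> inv x\<close>, \<open>x [^] n\<close> and \<open>\<one>\<close>.
\<close>

definition cayley_digraph :: "('a, 'b) monoid_scheme \<Rightarrow> 'a set \<Rightarrow> 'a pair_pre_digraph" where
  "cayley_digraph G S =
     \<lparr> pverts = carrier G,
       parcs = {(x, y). x \<in> carrier G \<and> y \<in> carrier G \<and> y \<otimes>\<^bsub>G\<^esub> inv\<^bsub>G\<^esub> x \<in> S} \<rparr>"

definition closed_out_nbhd :: "('a, 'b) pre_digraph \<Rightarrow> 'a \<Rightarrow> 'a set" where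
  "closed_out_nbhd D c = {c} \<union> {v. c \<rightarrow>\<^bsub>D\<^esub> v}"

text \<open>
  The closed neighbourhoods are taken as a family indexed by \<open>C\<close>: distinct elements of \<open>C\<close> with
  the same neighbourhood are not allowed, so every vertex is dominated by exactly one code word.
\<close>
definition perfect_code :: "('a, 'b) pre_digraph \<Rightarrow> 'a set \<Rightarrow> bool" where
  "perfect_code D C \<longleftrightarrow>
     C \<subseteq> verts D \<and>
     disjoint_family_on (closed_out_nbhd D) C \<and>
     (\<Union>c\<in>C. closed_out_nbhd D c) = verts D"

text \<open>The integer combination \<open>a e1 + b e2 + c e3\<close>.\<close>
definition int_comb ::
  "('a, 'b) monoid_scheme \<Rightarrow> 'a \<Rightarrow> 'a \<Rightarrow> 'a \<Rightarrow> int \<Rightarrow> int \<Rightarrow> int \<Rightarrow> 'a" where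
  "int_comb G e1 e2 e3 a b c = e1 [^]\<^bsub>G\<^esub> a \<otimes>\<^bsub>G\<^esub> e2 [^]\<^bsub>G\<^esub> b \<otimes>\<^bsub>G\<^esub> e3 [^]\<^bsub>G\<^esub> c"

end

theory Submission
  imports Defs "HOL-Number_Theory.Cong"
begin

text \<open>
  A perfect code \<open>C\<close> of the Cayley digraph of \<open>S\<close> is the same thing as a tiling: every group element is
  \<open>s + c\<close> for exactly one pair of \<open>s\<close> in \<open>S\<^sub>0 = S \<union> {0}\<close> and \<open>c\<close> in \<open>C\<close>. So all tilings
  \<open>G = S\<^sub>0 \<oplus> C\<close> with a generating factor \<open>S\<^sub>0\<close> have to be determined.

  The engine is a multiplier principle (\<open>tiling_multiplier\<close>): if \<open>k\<close> is coprime to the size of \<open>A\<close>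
  and \<open>A \<oplus> B\<close> is a tiling, then so is \<open>k A \<oplus> B\<close>. Hence \<open>k (a - a')\<close> is never a nonzero
  difference of \<open>B\<close>. For the group at hand this is almost everything. Write an element as
  \<open>(i + j p, u)\<close> with \<open>i, j < p\<close> and \<open>u\<close> in the Klein four-group. Multipliers \<open>k\<close> act on the cyclic part
  as arbitrary units, so what matters of a difference is only its component in the Klein group and
  how far it goes in the cyclic group: whether it is a unit (the points are "far"), a nonzero
  multiple of \<open>p\<close> ("near") or zero ("vertical"). The two factors share no such type. Factors of odd order
  admit even multipliers too, which erase the Klein component, and factors of order 2 or 4 admit
  multiples of \<open>p\<close>; this gives more forbidden types (\<open>repels\<close>, \<open>repels_coord\<close>).

  From here on the argument is combinatorial, in the locale \<open>code_pair\<close>. An absent type makes some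
  projection of a factor injective, and since the sizes multiply to \<open>4 p\<^sup>2\<close>, counting turns it into a
  bijection onto a set of keys: the factor is the graph of a function, and further absent types say on which
  of the keys this function depends. One factor has order 2, 4 or \<open>p\<close> or both have order \<open>2 p\<close>;
  in each case this yields a pair of the list (\<open>pair_is_listed\<close>). That \<open>S\<^sub>0\<close> generates enters only
  through two consequences: \<open>S\<^sub>0\<close> has an element that is a unit in the cyclic part, and its Klein
  components are not confined to a subgroup of order 2.

  Conversely, in every listed pair the components of \<open>s\<close> and \<open>c\<close> can be computed
  one after the other from \<open>s + c\<close> (\<open>listed_pair_covers\<close>), and the sizes are such that covering the group
  is enough.
\<close>

section \<open>Tilings of finite abelian groups\<close>

text \<open>
  Rotation acts on the lists of prime length \<open>q\<close>, and a list that it moves has \<open>q\<close> different rotations.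
  So the lists that are moved come in blocks of size \<open>q\<close>.
\<close>
lemma card_rotation_fixed:
  fixes X :: "'a list set"
  assumes fin: "finite X" and len: "\<And>xs. xs \<in> X \<Longrightarrow> length xs = q"
    and closed: "\<And>xs. xs \<in> X \<Longrightarrow> rotate1 xs \<in> X" and q: "prime q"
  shows "[card X = card {xs \<in> X. rotate1 xs = xs}] (mod q)"
proof -
  define Y where "Y = {xs \<in> X. rotate1 xs \<noteq> xs}"
  define orb where "orb xs = (\<lambda>n. rotate n xs) ` {..<q}" for xs :: "'a list"
  have q0: "0 < q" using q prime_gt_0_nat by simp
  have per: "rotate n xs = rotate (n mod q) xs" if "length xs = q" for n and xs :: "'a list"
    using that rotate_conv_mod by blast
  have clX: "rotate n xs \<in> X" if "xs \<in> X" for n xs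
    using that by (induction n) (auto intro: closed)
  have rigid: "rotate1 xs = xs" if xs: "length xs = q" and d: "rotate d xs = xs" and "0 < d" "d < q" for d and xs :: "'a list"
  proof -
    have "coprime d q"
      using that q by (metis coprime_commute dvd_imp_le leD prime_imp_coprime_nat)
    then obtain k where k: "[d * k = 1] (mod q)" using cong_solve_coprime_nat by auto
    have "rotate (d * m) xs = xs" for m
      by (induction m) (simp_all add: d flip: rotate_rotate)
    then have "xs = rotate (d * k) xs" by simp
    also have "\<dots> = rotate (1 mod q) xs" using per[OF xs] k by (metis cong_def)
    finally show ?thesis using per[OF xs, of 1] by simp
  qed
  have undo: "xs = rotate (q - n) (rotate n xs)" if "length xs = q" "n < q" for n and xs :: "'a list"
    using that per[of xs q] by (simp add: rotate_rotate)
  have fix_back: "rotate1 xs = xs" if "length xs = q" "n < q" "rotate1 (rotate n xs) = rotate n xs" for n and xs :: "'a list"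
  proof -
    have "rotate m (rotate n xs) = rotate n xs" for m
      by (induction m) (simp_all add: that(3))
    then have "rotate n xs = xs" using undo[OF that(1,2)] by metis
    then show ?thesis using that(3) by simp
  qed
  have inj: "inj_on (\<lambda>n. rotate n xs) {..<q}" if "xs \<in> Y" for xs
  proof (rule linorder_inj_onI')
    fix m n assume mn: "m \<in> {..<q}" "n \<in> {..<q}" "m < n"
    show "rotate m xs \<noteq> rotate n xs"
    proof
      assume eq: "rotate m xs = rotate n xs"
      have xs: "length xs = q" "rotate1 xs \<noteq> xs" using that len by (auto simp: Y_def)
      have "rotate (n - m) (rotate m xs) = rotate m xs"
        using eq mn by (metis rotate_rotate le_add_diff_inverse2 less_imp_le)
      then have "rotate1 (rotate m xs) = rotate m xs"
        using rigid[of "rotate m xs" "n - m"] xs mn by simp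
      then show False using fix_back[of xs m] xs mn by simp
    qed
  qed
  have orbY: "orb xs \<subseteq> Y" if "xs \<in> Y" for xs
  proof
    fix ys assume "ys \<in> orb xs"
    then obtain n where n: "n < q" "ys = rotate n xs" by (auto simp: orb_def)
    have "xs \<in> X" "length xs = q" "rotate1 xs \<noteq> xs" using that len by (auto simp: Y_def)
    then show "ys \<in> Y" using n fix_back[of xs n] clX[of xs n] by (auto simp: Y_def)
  qed
  have "\<Union> (orb ` Y) = Y"
  proof
    show "Y \<subseteq> \<Union> (orb ` Y)"
      using q0 by (force simp: orb_def)
  qed (use orbY in blast)
  have orb_eq: "orb ys = orb xs" if xsY: "xs \<in> Y" and ys: "ys \<in> orb xs" for xs ys
  proof -
    have sub: "orb ys \<subseteq> orb xs" if xs: "length xs = q" and ys: "ys \<in> orb xs" for xs ys :: "'a list"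
    proof
      fix zs assume "zs \<in> orb ys"
      then obtain m where "zs = rotate m ys" by (auto simp: orb_def)
      moreover obtain n where "ys = rotate n xs" using ys by (auto simp: orb_def)
      ultimately have "zs = rotate ((m + n) mod q) xs" using per[OF xs, of "m + n"] by (simp add: rotate_rotate)
      then show "zs \<in> orb xs" using q0 by (auto simp: orb_def)
    qed
    have xs: "length xs = q" using xsY len by (auto simp: Y_def)
    obtain n where n: "n < q" "ys = rotate n xs" using ys by (auto simp: orb_def)
    have "xs = rotate ((q - n) mod q) ys" using undo[OF xs n(1)] n per[of ys "q - n"] xs by simp
    then have "xs \<in> orb ys" using q0 by (auto simp: orb_def)
    then show ?thesis using sub[of xs ys] sub[of ys xs] ys xs n by auto
  qed
  have "q dvd card (\<Union> (orb ` Y))"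
  proof (rule dvd_partition)
    show "finite (\<Union> (orb ` Y))" using \<open>\<Union> (orb ` Y) = Y\<close> fin by (simp add: Y_def)
    show "\<forall>c \<in> orb ` Y. q dvd card c"
      using inj by (auto simp: orb_def card_image)
    show "\<forall>c1 \<in> orb ` Y. \<forall>c2 \<in> orb ` Y. c1 \<noteq> c2 \<longrightarrow> c1 \<inter> c2 = {}"
      using orb_eq by blast
  qed
  then have "q dvd card Y" using \<open>\<Union> (orb ` Y) = Y\<close> by simp
  moreover have "card X = card Y + card {xs \<in> X. rotate1 xs = xs}"
    using fin by (subst card_Un_disjoint[symmetric]) (auto simp: Y_def intro: arg_cong[where f = card])
  ultimately show ?thesis by (auto simp: cong_def elim!: dvdE)
qed

text \<open>
  This is a factorization of \<open>G\<close> into the subsets \<open>A\<close> and \<open>B\<close>; written additively, \<open>G = A \<oplus> B\<close>.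
\<close>
definition tiling :: "('a, 'b) monoid_scheme \<Rightarrow> 'a set \<Rightarrow> 'a set \<Rightarrow> bool" where
  "tiling G A B \<longleftrightarrow> A \<subseteq> carrier G \<and> B \<subseteq> carrier G \<and>
     bij_betw (\<lambda>(a, b). a \<otimes>\<^bsub>G\<^esub> b) (A \<times> B) (carrier G)"

context comm_group
begin

lemma tiling_commute: "tiling G A B \<longleftrightarrow> tiling G B A"
proof -
  have *: "tiling G B A" if t: "tiling G A B" for A B
  proof -
    have "bij_betw (\<lambda>(b, a). b \<otimes> a) (B \<times> A) (carrier G) \<longleftrightarrow>
        bij_betw ((\<lambda>(a, b). a \<otimes> b) \<circ> prod.swap) (B \<times> A) (carrier G)"
      using t by (intro bij_betw_cong) (auto simp: tiling_def intro!: m_comm)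
    moreover have "bij_betw prod.swap (B \<times> A) (A \<times> B)"
      by (auto simp: bij_betw_def inj_on_def)
    ultimately show ?thesis using t by (auto simp: tiling_def intro: bij_betw_trans)
  qed
  show ?thesis using * by blast
qed

lemma card_tiling: "tiling G A B \<Longrightarrow> card A * card B = order G"
  by (auto simp: tiling_def order_def dest: bij_betw_same_card simp flip: card_cartesian_product)

lemma mult_div_cancel: "x \<in> carrier G \<Longrightarrow> g \<in> carrier G \<Longrightarrow> x \<otimes> (g \<otimes> inv x) = g"
  by (simp add: m_lcomm[of x g "inv x"])

lemma tiling_unique:
  assumes t: "tiling G A B" and "g \<in> carrier G"
  shows "\<exists>!a. a \<in> A \<and> g \<otimes> inv a \<in> B"
proof -
  have sub: "A \<subseteq> carrier G" "B \<subseteq> carrier G" using t by (auto simp: tiling_def)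
  obtain a b where ab: "a \<in> A" "b \<in> B" "g = a \<otimes> b"
    using t assms(2) by (fastforce simp: tiling_def bij_betw_def)
  have "g \<otimes> inv a = b" using ab sub by (metis inv_solve_right m_comm m_closed subsetD)
  moreover have "a' = a" if a': "a' \<in> A" "g \<otimes> inv a' \<in> B" for a'
  proof -
    have "a' \<in> carrier G" using a' sub by auto
    then have "a' \<otimes> (g \<otimes> inv a') = a \<otimes> b"
      using ab(3) assms(2) mult_div_cancel by blast
    then show ?thesis using t ab a' by (auto simp: tiling_def bij_betw_def inj_on_def)
  qed
  ultimately show ?thesis using ab(1,2) by metis
qed

lemma tilingI_card:
  assumes "finite A" "finite B" "A \<subseteq> carrier G" "B \<subseteq> carrier G" "card A * card B \<le> order G"
    and cover: "\<And>g. g \<in> carrier G \<Longrightarrow> \<exists>a \<in> A. \<exists>b \<in> B. g = a \<otimes> b"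
  shows "tiling G A B"
proof -
  have im: "(\<lambda>(a, b). a \<otimes> b) ` (A \<times> B) = carrier G"
  proof
    show "(\<lambda>(a, b). a \<otimes> b) ` (A \<times> B) \<subseteq> carrier G" using assms(3,4) by auto
    show "carrier G \<subseteq> (\<lambda>(a, b). a \<otimes> b) ` (A \<times> B)"
    proof
      fix g assume "g \<in> carrier G"
      then obtain a b where "a \<in> A" "b \<in> B" "g = a \<otimes> b" using cover by blast
      then show "g \<in> (\<lambda>(a, b). a \<otimes> b) ` (A \<times> B)" by (intro image_eqI[of _ _ "(a, b)"]) auto
    qed
  qed
  have "order G \<le> card (A \<times> B)"
    using card_image_le[of "A \<times> B" "\<lambda>(a, b). a \<otimes> b"] assms(1,2) im by (simp add: order_def)
  then have "card ((\<lambda>(a, b). a \<otimes> b) ` (A \<times> B)) = card (A \<times> B)"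
    using assms(5) im by (simp add: order_def card_cartesian_product)
  then have "inj_on (\<lambda>(a, b). a \<otimes> b) (A \<times> B)"
    by (rule eq_card_imp_inj_on[OF finite_cartesian_product[OF assms(1,2)]])
  then show ?thesis
    using assms(3,4) im by (simp add: tiling_def bij_betw_def)
qed

definition list_prod :: "'a list \<Rightarrow> 'a" where
  "list_prod xs = foldr (\<otimes>) xs \<one>"

lemma list_prod_closed: "set xs \<subseteq> carrier G \<Longrightarrow> list_prod xs \<in> carrier G"
  by (induction xs) (auto simp: list_prod_def)

lemma list_prod_rotate1:
  assumes "set xs \<subseteq> carrier G"
  shows "list_prod (rotate1 xs) = list_prod xs"
proof (cases xs)
  case (Cons x ys)
  have snoc: "list_prod (ys @ [x]) = list_prod ys \<otimes> x" if "set ys \<subseteq> carrier G" "x \<in> carrier G" for ys x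
    using that by (induction ys) (simp_all add: list_prod_def m_assoc list_prod_closed[unfolded list_prod_def])
  have "set ys \<subseteq> carrier G" "x \<in> carrier G" using Cons assms by auto
  then have "list_prod (rotate1 xs) = x \<otimes> list_prod ys"
    using Cons snoc list_prod_closed m_comm by simp
  then show ?thesis using Cons by (simp add: list_prod_def)
qed simp

lemma list_prod_replicate: "a \<in> carrier G \<Longrightarrow> list_prod (replicate n a) = a [^] n"
  by (induction n) (auto simp: list_prod_def m_comm)

text \<open>
  Fix \<open>g\<close> and count the lists \<open>a\<^sub>1, \<dots>, a\<^sub>q\<close> over \<open>A\<close> for which \<open>g\<close> divided by their product lies in \<open>B\<close>.
  Given all entries but the first, the first is determined by the tiling, so there are
  \<open>card A ^ (q - 1)\<close> of them, a number prime to \<open>q\<close>. The condition is invariant under rotation, hence some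
  such list is constant, and \<open>g = a\<^sup>q b\<close>. So the \<open>q\<close>-th powers of \<open>A\<close> still cover \<open>G\<close> together
  with \<open>B\<close>, and there are not enough of them to cover anything twice.
\<close>
lemma tiling_prime_power:
  assumes t: "tiling G A B" and fin: "finite (carrier G)" and q: "prime q" "\<not> q dvd card A"
  shows "tiling G ((\<lambda>a. a [^] q) ` A) B" "card ((\<lambda>a. a [^] q) ` A) = card A"
proof -
  have sub: "A \<subseteq> carrier G" "B \<subseteq> carrier G" using t by (auto simp: tiling_def)
  have finA: "finite A" "finite B" using sub fin finite_subset by auto
  have cover: "\<exists>a \<in> A. g \<otimes> inv (a [^] q) \<in> B" if g: "g \<in> carrier G" for g
  proof -
    define X where "X = {xs. set xs \<subseteq> A \<and> length xs = q \<and> g \<otimes> inv (list_prod xs) \<in> B}"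
    define L where "L = {xs. set xs \<subseteq> A \<and> length xs = q - 1}"
    have q0: "0 < q" using q prime_gt_0_nat by simp
    have uniq: "\<exists>!a. a \<in> A \<and> g \<otimes> inv (list_prod (a # ys)) \<in> B" if "ys \<in> L" for ys
    proof -
      have ys: "list_prod ys \<in> carrier G" using that sub by (intro list_prod_closed) (auto simp: L_def)
      have "g \<otimes> inv (list_prod (a # ys)) = (g \<otimes> inv (list_prod ys)) \<otimes> inv a" if "a \<in> A" for a
      proof -
        have "a \<in> carrier G" using that sub by auto
        moreover have "list_prod (a # ys) = a \<otimes> list_prod ys" by (simp add: list_prod_def)
        ultimately show ?thesis using ys g by (simp add: inv_mult m_ac)
      qed
      then have "(a \<in> A \<and> g \<otimes> inv (list_prod (a # ys)) \<in> B) =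
          (a \<in> A \<and> (g \<otimes> inv (list_prod ys)) \<otimes> inv a \<in> B)" for a by auto
      moreover have "g \<otimes> inv (list_prod ys) \<in> carrier G" using g ys by simp
      ultimately show ?thesis using tiling_unique[OF t, of "g \<otimes> inv (list_prod ys)"] by simp
    qed
    have "bij_betw tl X L"
    proof (intro bij_betw_imageI)
      show "inj_on tl X"
      proof (rule inj_onI)
        fix xs ys assume xy: "xs \<in> X" "ys \<in> X" "tl xs = tl ys"
        then obtain x y zs where [simp]: "xs = x # zs" "ys = y # zs"
          using q0 by (cases xs; cases ys) (auto simp: X_def)
        have "zs \<in> L" using xy by (auto simp: X_def L_def)
        from uniq[OF this] show "xs = ys" using xy by (auto simp: X_def)
      qed
      show "tl ` X = L"
      proof
        show "tl ` X \<subseteq> L"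
        proof
          fix ys assume "ys \<in> tl ` X"
          then obtain xs where "xs \<in> X" "ys = tl xs" by blast
          then show "ys \<in> L" using q0 by (cases xs) (auto simp: X_def L_def)
        qed
        show "L \<subseteq> tl ` X"
        proof
          fix ys assume ys: "ys \<in> L"
          with uniq obtain a where "a \<in> A" "g \<otimes> inv (list_prod (a # ys)) \<in> B" by blast
          then have "a # ys \<in> X" using ys q0 by (auto simp: X_def L_def)
          then show "ys \<in> tl ` X" by force
        qed
      qed
    qed
    then have "card X = card A ^ (q - 1)"
      using card_lists_length_eq[OF finA(1), of "q - 1"] by (simp add: L_def bij_betw_same_card)
    then have ndvd: "\<not> q dvd card X" using q prime_dvd_power by metis
    have "finite X"
      by (rule finite_subset[OF _ finite_lists_length_eq[OF finA(1), of q]]) (auto simp: X_def)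
    moreover have "rotate1 xs \<in> X" if "xs \<in> X" for xs
      using that sub list_prod_rotate1[of xs] by (auto simp: X_def)
    ultimately have "[card X = card {xs \<in> X. rotate1 xs = xs}] (mod q)"
      by (intro card_rotation_fixed q(1)) (auto simp: X_def)
    then have "card {xs \<in> X. rotate1 xs = xs} \<noteq> 0"
      using ndvd by (metis cong_0_iff)
    then obtain xs where xs: "xs \<in> X" "rotate1 xs = xs" by (auto simp: card_eq_0_iff)
    have "xs \<noteq> []" using xs q0 by (auto simp: X_def)
    then have "card (set xs) = 1" using rotate1_fixpoint_card[OF xs(2)] by simp
    then obtain a where a: "set xs = {a}" by (auto simp: card_1_singleton_iff)
    then have "xs = replicate q a" using xs by (intro replicate_eqI) (auto simp: X_def)
    moreover have "a \<in> A" "g \<otimes> inv (list_prod xs) \<in> B" using xs a by (auto simp: X_def)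
    ultimately show ?thesis using sub list_prod_replicate[of a q] by (metis subsetD)
  qed
  let ?A = "(\<lambda>a. a [^] q) ` A"
  have le: "card ?A \<le> card A" using finA card_image_le by blast
  show t': "tiling G ?A B"
  proof (rule tilingI_card)
    show "card ?A * card B \<le> order G"
      using le card_tiling[OF t] by (metis mult_le_mono1)
    show "\<exists>a \<in> ?A. \<exists>b \<in> B. g = a \<otimes> b" if g: "g \<in> carrier G" for g
    proof -
      obtain a where a: "a \<in> A" "g \<otimes> inv (a [^] q) \<in> B" using cover[OF g] by blast
      moreover have "g = a [^] q \<otimes> (g \<otimes> inv (a [^] q))"
        using a(1) sub g by (simp add: mult_div_cancel subset_iff)
      ultimately show ?thesis using a by blast
    qed
  qed (use finA sub in auto)
  have "0 < card B" using card_tiling[OF t] fin order_gt_0_iff_finite by (metis mult_0_right neq0_conv)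
  then show "card ?A = card A"
    using card_tiling[OF t] card_tiling[OF t'] by (metis mult_right_cancel neq0_conv)
qed

lemma tiling_coprime_power:
  assumes "tiling G A B" and fin: "finite (carrier G)" and "0 < k" "coprime k (card A)"
  shows "tiling G ((\<lambda>a. a [^] k) ` A) B \<and> card ((\<lambda>a. a [^] k) ` A) = card A"
  using assms(1,3,4)
proof (induction k arbitrary: A rule: less_induct)
  case (less k)
  have sub: "A \<subseteq> carrier G" using less.prems by (auto simp: tiling_def)
  show ?case
  proof (cases "k = 1")
    case True
    then have "(\<lambda>a. a [^] k) ` A = A" using sub by (auto simp: image_def subset_iff)
    then show ?thesis using less.prems by simp
  next
    case False
    then obtain q where q: "prime q" "q dvd k" using prime_factor_nat by blast
    then obtain m where m: "k = q * m" by blast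
    have "\<not> q dvd card A" using q less.prems by (meson coprime_common_divisor not_prime_unit)
    note A' = tiling_prime_power[OF less.prems(1) fin q(1) this]
    have "m < k" "0 < m" using m less.prems(2) q(1) prime_gt_1_nat by (auto intro: ccontr)
    moreover have "coprime m (card ((\<lambda>a. a [^] q) ` A))" using less.prems(3) m A'(2) by simp
    moreover have "(\<lambda>a. a [^] m) ` (\<lambda>a. a [^] q) ` A = (\<lambda>a. a [^] k) ` A"
      using sub m by (auto simp: image_image nat_pow_pow subset_iff intro!: image_cong)
    ultimately show ?thesis using less.IH[of m "(\<lambda>a. a [^] q) ` A"] A' by simp
  qed
qed

text \<open>
  The form in which the principle is used: two differences, one of which is a multiple of the other,
  cannot occur in the two factors.
\<close>
lemma tiling_multiplier:
  assumes t: "tiling G A B" and fin: "finite (carrier G)" and k: "0 < k" "coprime k (card A)"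
    and ab: "a \<in> A" "a' \<in> A" "b \<in> B" "b' \<in> B" "a [^] k \<otimes> b = a' [^] k \<otimes> b'"
  shows "a = a'" "b = b'"
proof -
  note t' = tiling_coprime_power[OF t fin k]
  have "finite A" using t fin by (auto simp: tiling_def intro: finite_subset)
  with t' have inj: "inj_on (\<lambda>a. a [^] k) A" by (simp add: eq_card_imp_inj_on)
  have "a [^] k = a' [^] k \<and> b = b'"
    using conjunct1[OF t'] ab by (auto simp: tiling_def bij_betw_def inj_on_def)
  then show "a = a'" "b = b'" using inj ab by (auto dest: inj_onD)
qed

end

section \<open>The list of pairs\<close>

text \<open>
  The list is stated for an arbitrary function \<open>E\<close> in place of the integer combinations of
  three generators, because it is needed both for the group itself and for the coordinates
  introduced below.
\<close>
inductive listed_pair ::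
  "nat \<Rightarrow> (int \<Rightarrow> int \<Rightarrow> int \<Rightarrow> 'g) \<Rightarrow> 'g set \<Rightarrow> 'g set \<Rightarrow> bool"
  for p E S C where
  pair1: "\<alpha> 0 = 0 \<Longrightarrow> \<beta> 0 = 0 \<Longrightarrow>
    S = {E (int i + \<alpha> i * int p) (\<alpha> i) (\<beta> i) | i. i < p} \<Longrightarrow>
    C = {E (int i * int p) (int j) (int k) | i j k. i < p \<and> j < 2 \<and> k < 2} \<Longrightarrow>
    listed_pair p E S C"
| pair2: "\<alpha> 0 = 0 \<Longrightarrow> \<beta> 0 = 0 \<Longrightarrow> l' 0 0 = 0 \<Longrightarrow>
    S = {E (int i + int j * int p) (\<alpha> i) (\<beta> i) | i j. i < p \<and> j < p} \<Longrightarrow>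
    C = {E (l' i j * int p) (int i) (int j) | i j. i < 2 \<and> j < 2} \<Longrightarrow>
    listed_pair p E S C"
| pair3: "\<alpha> 0 = 0 \<Longrightarrow> \<alpha>' 0 0 = 0 \<Longrightarrow> l 0 = 0 \<Longrightarrow>
    S = {E (int i + int j * int p) (\<alpha>' i j) (\<alpha> i) | i j. i < p \<and> j < p} \<Longrightarrow>
    C = {E (l i * int p) (int j) (int i) | i j. i < 2 \<and> j < 2} \<Longrightarrow>
    listed_pair p E S C"
| pair4: "\<alpha> 0 = 0 \<Longrightarrow> \<beta> 0 = 0 \<Longrightarrow>
    S = {E (int i) (\<alpha> i) (\<beta> i) | i. i < p ^ 2} \<Longrightarrow>
    C = {E 0 (int i) (int j) | i j. i < 2 \<and> j < 2} \<Longrightarrow>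
    listed_pair p E S C"
| pair5: "\<alpha> 0 = 0 \<Longrightarrow> l' 0 0 = 0 \<Longrightarrow>
    S = {E (int i + \<alpha> i * int p) (int j) (\<alpha> i) | i j. i < p \<and> j < 2} \<Longrightarrow>
    C = {E (int i * int p) (l' i j) (int j) | i j. i < p \<and> j < 2} \<Longrightarrow>
    listed_pair p E S C"
| pair6: "\<alpha> 0 = 0 \<Longrightarrow> \<alpha>' 0 0 = 0 \<Longrightarrow> l 0 = 0 \<Longrightarrow>
    S = {E (int i + \<alpha>' i j * int p) (int j) (\<alpha> i) | i j. i < p \<and> j < 2} \<Longrightarrow>
    C = {E (int j * int p) (l i) (int i) | i j. i < 2 \<and> j < p} \<Longrightarrow>
    listed_pair p E S C"
| pair7: "\<alpha> 0 = 0 \<Longrightarrow> \<alpha>' 0 0 = 0 \<Longrightarrow> l 0 = 0 \<Longrightarrow>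
    S = {E (int i + \<alpha> i * int p) (\<alpha>' i j) (int j) | i j. i < p \<and> j < 2} \<Longrightarrow>
    C = {E (int i * int p) (int j) (l i) | i j. i < p \<and> j < 2} \<Longrightarrow>
    listed_pair p E S C"
| pair8: "\<alpha> 0 = 0 \<Longrightarrow> \<alpha>' 0 0 = 0 \<Longrightarrow> l 0 = 0 \<Longrightarrow>
    S = {E (\<alpha> i + int j * int p) (\<alpha>' i j) (int i) | i j. i < 2 \<and> j < p} \<Longrightarrow>
    C = {E (int i + l i * int p) (int j) 0 | i j. i < p \<and> j < 2} \<Longrightarrow>
    listed_pair p E S C"
| pair9: "\<alpha>' 0 0 = 0 \<Longrightarrow>
    S = {E (int i + \<alpha>' i j * int p) (\<alpha>' i j) (int j) | i j. i < p \<and> j < 2} \<Longrightarrow>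
    C = {E (int i * int p) (int j) 0 | i j. i < p \<and> j < 2} \<Longrightarrow>
    listed_pair p E S C"
| pair10: "\<alpha> 0 = 0 \<Longrightarrow> l 0 = 0 \<Longrightarrow>
    S = {E (\<alpha> i) (int j) (int i) | i j. i < 2 \<and> j < 2} \<Longrightarrow>
    C = {E (int i) (l i) 0 | i. i < p ^ 2} \<Longrightarrow>
    listed_pair p E S C"
| pair11: "\<alpha> 0 = 0 \<Longrightarrow> \<alpha>' 0 0 = 0 \<Longrightarrow> l 0 = 0 \<Longrightarrow>
    S = {E (\<alpha> i + \<alpha>' i j * int p) (int j) (int i) | i j. i < 2 \<and> j < 2} \<Longrightarrow>
    C = {E (int i + int j * int p) (l i) 0 | i j. i < p \<and> j < p} \<Longrightarrow>
    listed_pair p E S C"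
| pair12: "\<alpha>' 0 0 = 0 \<Longrightarrow>
    S = {E (\<alpha>' i j) (int i) (int j) | i j. i < 2 \<and> j < 2} \<Longrightarrow>
    C = {E (int i) 0 0 | i. i < p ^ 2} \<Longrightarrow>
    listed_pair p E S C"
| pair13: "\<alpha> 0 = 0 \<Longrightarrow> l 0 = 0 \<Longrightarrow>
    S = {E (int i) (int j) (\<alpha> i) | i j. i < p ^ 2 \<and> j < 2} \<Longrightarrow>
    C = {E 0 (l i) (int i) | i. i < 2} \<Longrightarrow>
    listed_pair p E S C"
| pair14: "\<alpha>' 0 0 = 0 \<Longrightarrow> l 0 = 0 \<Longrightarrow>
    S = {E (int i + int k * int p) (\<alpha>' i j) (int j) | i j k. i < p \<and> j < 2 \<and> k < p} \<Longrightarrow>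
    C = {E (l i * int p) (int i) 0 | i. i < 2} \<Longrightarrow>
    listed_pair p E S C"
| pair15: "\<alpha> 0 = 0 \<Longrightarrow> l 0 = 0 \<Longrightarrow>
    S = {E (int i + int j * int p) (int k) (\<alpha> i) | i j k. i < p \<and> j < p \<and> k < 2} \<Longrightarrow>
    C = {E (l i * int p) (l i) (int i) | i. i < 2} \<Longrightarrow>
    listed_pair p E S C"
| pair16: "\<alpha>' 0 0 = 0 \<Longrightarrow>
    S = {E (int i) (\<alpha>' i j) (int j) | i j. i < p ^ 2 \<and> j < 2} \<Longrightarrow>
    C = {E 0 (int i) 0 | i. i < 2} \<Longrightarrow>
    listed_pair p E S C"
| pair17: "\<alpha>' 0 0 = 0 \<Longrightarrow> l 0 = 0 \<Longrightarrow>
    S = {E (int i + \<alpha>' i j * int p) (int k) (int j) | i j k. i < p \<and> j < 2 \<and> k < 2} \<Longrightarrow>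
    C = {E (int i * int p) (l i) 0 | i. i < p} \<Longrightarrow>
    listed_pair p E S C"
| pair18: "\<alpha>' 0 0 = 0 \<Longrightarrow> l 0 = 0 \<Longrightarrow>
    S = {E (\<alpha>' i j + int k * int p) (int i) (int j) | i j k. i < 2 \<and> j < 2 \<and> k < p} \<Longrightarrow>
    C = {E (int i + l i * int p) 0 0 | i. i < p} \<Longrightarrow>
    listed_pair p E S C"
| pair19: "\<alpha> 0 = 0 \<Longrightarrow> l 0 = 0 \<Longrightarrow>
    S = {E (\<alpha> i + int j * int p) (int k) (int i) | i j k. i < 2 \<and> j < p \<and> k < 2} \<Longrightarrow>
    C = {E (int i + l i * int p) (l i) 0 | i. i < p} \<Longrightarrow>
    listed_pair p E S C"
| pair20: "\<alpha> 0 = 0 \<Longrightarrow> l 0 = 0 \<Longrightarrow> \<mu> 0 = 0 \<Longrightarrow>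
    S = {E (int i + \<alpha> i * int p) (int j) (int k) | i j k. i < p \<and> j < 2 \<and> k < 2} \<Longrightarrow>
    C = {E (int i * int p) (l i) (\<mu> i) | i. i < p} \<Longrightarrow>
    listed_pair p E S C"
| pair21: "\<alpha>'' 0 0 0 = 0 \<Longrightarrow>
    S = {E (int i + \<alpha>'' i j k * int p) (int j) (int k) | i j k. i < p \<and> j < 2 \<and> k < 2} \<Longrightarrow>
    C = {E (int i * int p) 0 0 | i. i < p} \<Longrightarrow>
    listed_pair p E S C"

lemma card_families_le:
  fixes f1 :: "nat \<Rightarrow> 'a" and f2 :: "nat \<Rightarrow> nat \<Rightarrow> 'a" and f3 :: "nat \<Rightarrow> nat \<Rightarrow> nat \<Rightarrow> 'a"
  shows "finite {f1 i | i. i < m} \<and> card {f1 i | i. i < m} \<le> m"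
    and "finite {f2 i j | i j. i < m \<and> j < n} \<and> card {f2 i j | i j. i < m \<and> j < n} \<le> m * n"
    and "finite {f3 i j k | i j k. i < m \<and> j < n \<and> k < r} \<and>
         card {f3 i j k | i j k. i < m \<and> j < n \<and> k < r} \<le> m * n * r"
proof -
  have *: "finite (h ` A) \<and> card (h ` A) \<le> card A" if "finite A" for h :: "'b \<Rightarrow> 'a" and A
    using that by (simp add: card_image_le)
  have "{f1 i | i. i < m} = f1 ` {..<m}" by auto
  then show "finite {f1 i | i. i < m} \<and> card {f1 i | i. i < m} \<le> m"
    using *[of "{..<m}" f1] by simp
  have "{f2 i j | i j. i < m \<and> j < n} = (\<lambda>(i, j). f2 i j) ` ({..<m} \<times> {..<n})" by auto
  then show "finite {f2 i j | i j. i < m \<and> j < n} \<and> card {f2 i j | i j. i < m \<and> j < n} \<le> m * n"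
    using *[of "{..<m} \<times> {..<n}" "\<lambda>(i, j). f2 i j"] by simp
  have "{f3 i j k | i j k. i < m \<and> j < n \<and> k < r} =
      (\<lambda>(i, j, k). f3 i j k) ` ({..<m} \<times> {..<n} \<times> {..<r})" by force
  then show "finite {f3 i j k | i j k. i < m \<and> j < n \<and> k < r} \<and>
         card {f3 i j k | i j k. i < m \<and> j < n \<and> k < r} \<le> m * n * r"
    using *[of "{..<m} \<times> {..<n} \<times> {..<r}" "\<lambda>(i, j, k). f3 i j k"] by (simp add: mult.assoc)
qed

lemma listed_pair_card:
  assumes "listed_pair p E S C"
  shows "finite S" "finite C" "card S * card C \<le> 4 * p\<^sup>2"
proof -
  have bound: "finite S \<and> finite C \<and> card S * card C \<le> 4 * p\<^sup>2"
    if "S = X" "C = Y" "finite X \<and> card X \<le> m" "finite Y \<and> card Y \<le> n" "m * n = 4 * p\<^sup>2"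
    for X Y m n
    using that mult_le_mono[of "card S" m "card C" n] by simp
  have "finite S \<and> finite C \<and> card S * card C \<le> 4 * p\<^sup>2"
    using assms
    by (elim listed_pair.cases) (rule bound, assumption, assumption, rule card_families_le,
        rule card_families_le, simp add: power2_eq_square)+
  then show "finite S" "finite C" "card S * card C \<le> 4 * p\<^sup>2" by auto
qed

text \<open>
  Every pair is triangular: the components of \<open>(x, y, z)\<close> and the residue of \<open>x\<close> modulo \<open>p\<close> can be treated in
  an order in which the correction terms at each step depend only on indices found already.
  The definitions of the indices in each case record this order.
\<close>
lemma listed_pair_covers:
  assumes "listed_pair p E S C" and p: "0 < p"
  shows "\<exists>a b c a' b' c'. E a b c \<in> S \<and> E a' b' c' \<in> C \<and>
    [a + a' = x] (mod int (p\<^sup>2)) \<and> [b + b' = y] (mod 2) \<and> [c + c' = z] (mod 2)"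
proof -
  define q where "q = x div int p"
  define P where "P t = nat (t mod int p)" for t
  define Q where "Q t = nat (t mod int (p\<^sup>2))" for t
  define B where "B t = nat (t mod 2)" for t
  have P: "P t < p" for t
    using p by (simp add: P_def nat_less_iff)
  have Q: "Q t < p\<^sup>2" for t
    using p unfolding Q_def by (subst nat_less_iff) auto
  have B: "B t < 2" for t by (simp add: B_def nat_less_iff)
  have intP: "int (P t) = t mod int p" for t using p by (simp add: P_def)
  have intQ: "int (Q t) = t mod int (p\<^sup>2)" for t using p by (simp add: Q_def)
  have intB: "int (B t) = t mod 2" for t by (simp add: B_def)
  \<comment> \<open>a multiple of \<open>p\<close> matters modulo \<open>p\<^sup>2\<close> only through its quotient
    modulo \<open>p\<close>\<close>
  have c0: "[u + (t mod int p) * int p = u + t * int p] (mod int (p\<^sup>2))" for u t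
    by (rule cong_add[OF cong_refl]) (simp add: cong_def power2_eq_square mod_mult_mult2)
  \<comment> \<open>used when the residue modulo \<open>p\<close> is that of \<open>x - t\<close>, and
    \<open>c1\<close> when it is that of \<open>x\<close>\<close>
  have c2: "[a = x] (mod int (p\<^sup>2))"
    if "a = t + (x - t) mod int p + ((x - t) div int p - s) mod int p * int p + s * int p" for a s t
  proof -
    have "[a = (t + (x - t) mod int p + s * int p) + ((x - t) div int p - s) * int p] (mod int (p\<^sup>2))"
      using c0[of "t + (x - t) mod int p + s * int p" "(x - t) div int p - s"] that
      by (simp add: algebra_simps)
    moreover have "(t + (x - t) mod int p + s * int p) + ((x - t) div int p - s) * int p = x"
      using div_mult_mod_eq[of "x - t" "int p"] by (simp add: algebra_simps)
    ultimately show ?thesis by simp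
  qed
  have c1: "[a = x] (mod int (p\<^sup>2))"
    if "a = x mod int p + (x div int p - t) mod int p * int p + t * int p" for a t
    using c2[of a 0 t] that by simp
  have c3: "[a = x] (mod int (p\<^sup>2))"
    if "a = t + (x - t) mod int (p\<^sup>2)" for a t
    using that by (simp add: cong_def mod_simps)
  have d: "[t = y] (mod 2)" if "t = u + (y - u) mod 2" for t u y :: int
    using that by (simp add: cong_def mod_simps)
  have e: "[t = y] (mod 2)" if "t = y mod 2" for t y :: int
    using that by (simp add: cong_def mod_simps)
  note w = P Q B intP intQ intB
  have goalI: "\<exists>a b c a' b' c'. E a b c \<in> S \<and> E a' b' c' \<in> C \<and>
    [a + a' = x] (mod int (p\<^sup>2)) \<and> [b + b' = y] (mod 2) \<and> [c + c' = z] (mod 2)"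
    if "E a b c \<in> S" "E a' b' c' \<in> C"
    "[a + a' = x] (mod int (p\<^sup>2))" "[b + b' = y] (mod 2)" "[c + c' = z] (mod 2)" for a b c a' b' c'
    using that by blast
  from assms show ?thesis
  proof cases
    case (pair1 \<alpha> \<beta>)
    define i m j k where "i = P x"
      and "m = P (q - \<alpha> i)"
      and "j = B (y - \<alpha> i)"
      and "k = B (z - \<beta> i)"
    note v = i_def m_def j_def k_def w
    have "E (int i + \<alpha> i * int p) (\<alpha> i) (\<beta> i) \<in> S" "E (int m * int p) (int j) (int k) \<in> C"
      unfolding pair1 by (rule CollectI, intro exI conjI, rule refl, (simp add: v; fail)+)+
    then show ?thesis
      by (rule goalI) (rule c1[of _ "\<alpha> i"], simp add: v q_def, rule d[of _ "\<alpha> i"], simp add: v, rule d[of _ "\<beta> i"], simp add: v)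
  next
    case (pair2 \<alpha> \<beta> l')
    define i m n j where "i = P x"
      and "m = B (y - \<alpha> i)"
      and "n = B (z - \<beta> i)"
      and "j = P (q - l' m n)"
    note v = i_def m_def n_def j_def w
    have "E (int i + int j * int p) (\<alpha> i) (\<beta> i) \<in> S" "E (l' m n * int p) (int m) (int n) \<in> C"
      unfolding pair2 by (rule CollectI, intro exI conjI, rule refl, (simp add: v; fail)+)+
    then show ?thesis
      by (rule goalI) (rule c1[of _ "l' m n"], simp add: v q_def, rule d[of _ "\<alpha> i"], simp add: v, rule d[of _ "\<beta> i"], simp add: v)
  next
    case (pair3 \<alpha> \<alpha>' l)
    define i m j n where "i = P x"
      and "m = B (z - \<alpha> i)"
      and "j = P (q - l m)"
      and "n = B (y - \<alpha>' i j)"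
    note v = i_def m_def j_def n_def w
    have "E (int i + int j * int p) (\<alpha>' i j) (\<alpha> i) \<in> S" "E (l m * int p) (int n) (int m) \<in> C"
      unfolding pair3 by (rule CollectI, intro exI conjI, rule refl, (simp add: v; fail)+)+
    then show ?thesis
      by (rule goalI) (rule c1[of _ "l m"], simp add: v q_def, rule d[of _ "\<alpha>' i j"], simp add: v, rule d[of _ "\<alpha> i"], simp add: v)
  next
    case (pair4 \<alpha> \<beta>)
    define i m n where "i = Q x"
      and "m = B (y - \<alpha> i)"
      and "n = B (z - \<beta> i)"
    note v = i_def m_def n_def w
    have "E (int i) (\<alpha> i) (\<beta> i) \<in> S" "E 0 (int m) (int n) \<in> C"
      unfolding pair4 by (rule CollectI, intro exI conjI, rule refl, (simp add: v; fail)+)+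
    then show ?thesis
      by (rule goalI) (rule c3[of _ 0], simp add: v q_def, rule d[of _ "\<alpha> i"], simp add: v, rule d[of _ "\<beta> i"], simp add: v)
  next
    case (pair5 \<alpha> l')
    define i n m j where "i = P x"
      and "n = B (z - \<alpha> i)"
      and "m = P (q - \<alpha> i)"
      and "j = B (y - l' m n)"
    note v = i_def n_def m_def j_def w
    have "E (int i + \<alpha> i * int p) (int j) (\<alpha> i) \<in> S" "E (int m * int p) (l' m n) (int n) \<in> C"
      unfolding pair5 by (rule CollectI, intro exI conjI, rule refl, (simp add: v; fail)+)+
    then show ?thesis
      by (rule goalI) (rule c1[of _ "\<alpha> i"], simp add: v q_def, rule d[of _ "l' m n"], simp add: v, rule d[of _ "\<alpha> i"], simp add: v)
  next
    case (pair6 \<alpha> \<alpha>' l)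
    define i m j n where "i = P x"
      and "m = B (z - \<alpha> i)"
      and "j = B (y - l m)"
      and "n = P (q - \<alpha>' i j)"
    note v = i_def m_def j_def n_def w
    have "E (int i + \<alpha>' i j * int p) (int j) (\<alpha> i) \<in> S" "E (int n * int p) (l m) (int m) \<in> C"
      unfolding pair6 by (rule CollectI, intro exI conjI, rule refl, (simp add: v; fail)+)+
    then show ?thesis
      by (rule goalI) (rule c1[of _ "\<alpha>' i j"], simp add: v q_def, rule d[of _ "l m"], simp add: v, rule d[of _ "\<alpha> i"], simp add: v)
  next
    case (pair7 \<alpha> \<alpha>' l)
    define i m j n where "i = P x"
      and "m = P (q - \<alpha> i)"
      and "j = B (z - l m)"
      and "n = B (y - \<alpha>' i j)"
    note v = i_def m_def j_def n_def w
    have "E (int i + \<alpha> i * int p) (\<alpha>' i j) (int j) \<in> S" "E (int m * int p) (int n) (l m) \<in> C"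
      unfolding pair7 by (rule CollectI, intro exI conjI, rule refl, (simp add: v; fail)+)+
    then show ?thesis
      by (rule goalI) (rule c1[of _ "\<alpha> i"], simp add: v q_def, rule d[of _ "\<alpha>' i j"], simp add: v, rule d[of _ "l m"], simp add: v)
  next
    case (pair8 \<alpha> \<alpha>' l)
    define i m j n where "i = B z"
      and "m = P (x - \<alpha> i)"
      and "j = P ((x - \<alpha> i) div int p - l m)"
      and "n = B (y - \<alpha>' i j)"
    note v = i_def m_def j_def n_def w
    have "E (\<alpha> i + int j * int p) (\<alpha>' i j) (int i) \<in> S" "E (int m + l m * int p) (int n) 0 \<in> C"
      unfolding pair8 by (rule CollectI, intro exI conjI, rule refl, (simp add: v; fail)+)+
    then show ?thesis
      by (rule goalI) (rule c2[of _ "\<alpha> i" "l m"], simp add: v q_def, rule d[of _ "\<alpha>' i j"], simp add: v, rule e, simp add: v)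
  next
    case (pair9 \<alpha>')
    define i j m n where "i = P x"
      and "j = B z"
      and "m = P (q - \<alpha>' i j)"
      and "n = B (y - \<alpha>' i j)"
    note v = i_def j_def m_def n_def w
    have "E (int i + \<alpha>' i j * int p) (\<alpha>' i j) (int j) \<in> S" "E (int m * int p) (int n) 0 \<in> C"
      unfolding pair9 by (rule CollectI, intro exI conjI, rule refl, (simp add: v; fail)+)+
    then show ?thesis
      by (rule goalI) (rule c1[of _ "\<alpha>' i j"], simp add: v q_def, rule d[of _ "\<alpha>' i j"], simp add: v, rule e, simp add: v)
  next
    case (pair10 \<alpha> l)
    define i m j where "i = B z"
      and "m = Q (x - \<alpha> i)"
      and "j = B (y - l m)"
    note v = i_def m_def j_def w
    have "E (\<alpha> i) (int j) (int i) \<in> S" "E (int m) (l m) 0 \<in> C"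
      unfolding pair10 by (rule CollectI, intro exI conjI, rule refl, (simp add: v; fail)+)+
    then show ?thesis
      by (rule goalI) (rule c3[of _ "\<alpha> i"], simp add: v q_def, rule d[of _ "l m"], simp add: v, rule e, simp add: v)
  next
    case (pair11 \<alpha> \<alpha>' l)
    define i m j n where "i = B z"
      and "m = P (x - \<alpha> i)"
      and "j = B (y - l m)"
      and "n = P ((x - \<alpha> i) div int p - \<alpha>' i j)"
    note v = i_def m_def j_def n_def w
    have "E (\<alpha> i + \<alpha>' i j * int p) (int j) (int i) \<in> S" "E (int m + int n * int p) (l m) 0 \<in> C"
      unfolding pair11 by (rule CollectI, intro exI conjI, rule refl, (simp add: v; fail)+)+
    then show ?thesis
      by (rule goalI) (rule c2[of _ "\<alpha> i" "\<alpha>' i j"], simp add: v q_def, rule d[of _ "l m"], simp add: v, rule e, simp add: v)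
  next
    case (pair12 \<alpha>')
    define i j m where "i = B y"
      and "j = B z"
      and "m = Q (x - \<alpha>' i j)"
    note v = i_def j_def m_def w
    have "E (\<alpha>' i j) (int i) (int j) \<in> S" "E (int m) 0 0 \<in> C"
      unfolding pair12 by (rule CollectI, intro exI conjI, rule refl, (simp add: v; fail)+)+
    then show ?thesis
      by (rule goalI) (rule c3[of _ "\<alpha>' i j"], simp add: v q_def, rule e, simp add: v, rule e, simp add: v)
  next
    case (pair13 \<alpha> l)
    define i m j where "i = Q x"
      and "m = B (z - \<alpha> i)"
      and "j = B (y - l m)"
    note v = i_def m_def j_def w
    have "E (int i) (int j) (\<alpha> i) \<in> S" "E 0 (l m) (int m) \<in> C"
      unfolding pair13 by (rule CollectI, intro exI conjI, rule refl, (simp add: v; fail)+)+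
    then show ?thesis
      by (rule goalI) (rule c3[of _ 0], simp add: v q_def, rule d[of _ "l m"], simp add: v, rule d[of _ "\<alpha> i"], simp add: v)
  next
    case (pair14 \<alpha>' l)
    define i j m k where "i = P x"
      and "j = B z"
      and "m = B (y - \<alpha>' i j)"
      and "k = P (q - l m)"
    note v = i_def j_def m_def k_def w
    have "E (int i + int k * int p) (\<alpha>' i j) (int j) \<in> S" "E (l m * int p) (int m) 0 \<in> C"
      unfolding pair14 by (rule CollectI, intro exI conjI, rule refl, (simp add: v; fail)+)+
    then show ?thesis
      by (rule goalI) (rule c1[of _ "l m"], simp add: v q_def, rule d[of _ "\<alpha>' i j"], simp add: v, rule e, simp add: v)
  next
    case (pair15 \<alpha> l)
    define i m j k where "i = P x"
      and "m = B (z - \<alpha> i)"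
      and "j = P (q - l m)"
      and "k = B (y - l m)"
    note v = i_def m_def j_def k_def w
    have "E (int i + int j * int p) (int k) (\<alpha> i) \<in> S" "E (l m * int p) (l m) (int m) \<in> C"
      unfolding pair15 by (rule CollectI, intro exI conjI, rule refl, (simp add: v; fail)+)+
    then show ?thesis
      by (rule goalI) (rule c1[of _ "l m"], simp add: v q_def, rule d[of _ "l m"], simp add: v, rule d[of _ "\<alpha> i"], simp add: v)
  next
    case (pair16 \<alpha>')
    define i j m where "i = Q x"
      and "j = B z"
      and "m = B (y - \<alpha>' i j)"
    note v = i_def j_def m_def w
    have "E (int i) (\<alpha>' i j) (int j) \<in> S" "E 0 (int m) 0 \<in> C"
      unfolding pair16 by (rule CollectI, intro exI conjI, rule refl, (simp add: v; fail)+)+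
    then show ?thesis
      by (rule goalI) (rule c3[of _ 0], simp add: v q_def, rule d[of _ "\<alpha>' i j"], simp add: v, rule e, simp add: v)
  next
    case (pair17 \<alpha>' l)
    define i j m k where "i = P x"
      and "j = B z"
      and "m = P (q - \<alpha>' i j)"
      and "k = B (y - l m)"
    note v = i_def j_def m_def k_def w
    have "E (int i + \<alpha>' i j * int p) (int k) (int j) \<in> S" "E (int m * int p) (l m) 0 \<in> C"
      unfolding pair17 by (rule CollectI, intro exI conjI, rule refl, (simp add: v; fail)+)+
    then show ?thesis
      by (rule goalI) (rule c1[of _ "\<alpha>' i j"], simp add: v q_def, rule d[of _ "l m"], simp add: v, rule e, simp add: v)
  next
    case (pair18 \<alpha>' l)
    define i j m k where "i = B y"
      and "j = B z"
      and "m = P (x - \<alpha>' i j)"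
      and "k = P ((x - \<alpha>' i j) div int p - l m)"
    note v = i_def j_def m_def k_def w
    have "E (\<alpha>' i j + int k * int p) (int i) (int j) \<in> S" "E (int m + l m * int p) 0 0 \<in> C"
      unfolding pair18 by (rule CollectI, intro exI conjI, rule refl, (simp add: v; fail)+)+
    then show ?thesis
      by (rule goalI) (rule c2[of _ "\<alpha>' i j" "l m"], simp add: v q_def, rule e, simp add: v, rule e, simp add: v)
  next
    case (pair19 \<alpha> l)
    define i m j k where "i = B z"
      and "m = P (x - \<alpha> i)"
      and "j = P ((x - \<alpha> i) div int p - l m)"
      and "k = B (y - l m)"
    note v = i_def m_def j_def k_def w
    have "E (\<alpha> i + int j * int p) (int k) (int i) \<in> S" "E (int m + l m * int p) (l m) 0 \<in> C"
      unfolding pair19 by (rule CollectI, intro exI conjI, rule refl, (simp add: v; fail)+)+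
    then show ?thesis
      by (rule goalI) (rule c2[of _ "\<alpha> i" "l m"], simp add: v q_def, rule d[of _ "l m"], simp add: v, rule e, simp add: v)
  next
    case (pair20 \<alpha> l \<mu>)
    define i m j k where "i = P x"
      and "m = P (q - \<alpha> i)"
      and "j = B (y - l m)"
      and "k = B (z - \<mu> m)"
    note v = i_def m_def j_def k_def w
    have "E (int i + \<alpha> i * int p) (int j) (int k) \<in> S" "E (int m * int p) (l m) (\<mu> m) \<in> C"
      unfolding pair20 by (rule CollectI, intro exI conjI, rule refl, (simp add: v; fail)+)+
    then show ?thesis
      by (rule goalI) (rule c1[of _ "\<alpha> i"], simp add: v q_def, rule d[of _ "l m"], simp add: v, rule d[of _ "\<mu> m"], simp add: v)
  next
    case (pair21 \<alpha>'')
    define i j k m where "i = P x"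
      and "j = B y"
      and "k = B z"
      and "m = P (q - \<alpha>'' i j k)"
    note v = i_def j_def k_def m_def w
    have "E (int i + \<alpha>'' i j k * int p) (int j) (int k) \<in> S" "E (int m * int p) 0 0 \<in> C"
      unfolding pair21 by (rule CollectI, intro exI conjI, rule refl, (simp add: v; fail)+)+
    then show ?thesis
      by (rule goalI) (rule c1[of _ "\<alpha>'' i j k"], simp add: v q_def, rule e, simp add: v, rule e, simp add: v)
  qed
qed

section \<open>The Klein four-group and coordinates\<close>

text \<open>
  A type of its own for the part of exponent 2: here sums need no reduction modulo 2, and there
  are no membership conditions.
\<close>
datatype klein = Kl bool bool

instantiation klein :: ab_group_add
begin

definition zero_klein where "0 = Kl False False"
fun plus_klein where "Kl a b + Kl c d = Kl (a \<noteq> c) (b \<noteq> d)"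
definition uminus_klein where "- u = (u :: klein)"
definition minus_klein where "u - v = u + (v :: klein)"

instance
proof
  fix u v w :: klein
  show "u + v + w = u + (v + w)" by (cases u; cases v; cases w) auto
  show "u + v = v + u" by (cases u; cases v) auto
  show "0 + u = u" "- u + u = 0" by (cases u; simp add: zero_klein_def uminus_klein_def)+
  show "u - v = u + - v" by (simp add: minus_klein_def uminus_klein_def)
qed

end

text \<open>
  The triple \<open>(i, j, u)\<close> with \<open>i, j < p\<close> stands for the group element with cyclic component \<open>i + j p\<close>
  and Klein component \<open>u\<close>. In these coordinates no carries are needed, since only equality of \<open>i\<close> and of
  \<open>j\<close> will matter.
\<close>
type_synonym point = "nat \<times> nat \<times> klein"

definition scl :: "int \<Rightarrow> klein \<Rightarrow> klein" where
  "scl n e = (if even n then 0 else e)"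

text \<open>
  The index of the coset of \<open>{0, e}\<close> in which \<open>u\<close> lies. For every basis that contains \<open>e\<close> it is the
  coordinate of \<open>u\<close> at the other basis element.
\<close>
definition outside :: "klein \<Rightarrow> klein \<Rightarrow> nat" where
  "outside e u = (if u = 0 \<or> u = e then 0 else 1)"

text \<open>
  The integer combinations of the list, in coordinates.
\<close>
definition comb :: "nat \<Rightarrow> klein \<Rightarrow> klein \<Rightarrow> int \<Rightarrow> int \<Rightarrow> int \<Rightarrow> point" where
  "comb p e2 e3 a b c =
     (nat (a mod int p), nat (a div int p mod int p), scl b e2 + scl c e3)"

definition basis :: "klein \<Rightarrow> klein \<Rightarrow> bool" where
  "basis e2 e3 \<longleftrightarrow> e2 \<noteq> 0 \<and> e3 \<noteq> 0 \<and> e2 \<noteq> e3"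

lemma all_klein: "(\<forall>u. P u) \<longleftrightarrow> (\<forall>a b. P (Kl a b))"
  by (metis klein.exhaust)

lemma klein_add_self [simp]: "u + u = (0 :: klein)"
  by (cases u) (simp add: zero_klein_def)

lemma klein_add_self_left [simp]: "u + (u + v) = (v :: klein)"
  by (simp flip: add.assoc)

lemma klein_add_eq_0_iff [simp]: "u + v = (0 :: klein) \<longleftrightarrow> u = v"
  by (metis add.right_neutral klein_add_self_left klein_add_self)

lemma klein_add_eq_iff: "u + v = (w :: klein) \<longleftrightarrow> v = u + w"
  by (metis klein_add_self_left)

lemma klein_cases:
  assumes "basis e2 e3"
  obtains "u = 0" | "u = e2" | "u = e3" | "u = e2 + e3"
proof -
  have "\<forall>e2 e3 u :: klein. e2 \<noteq> 0 \<longrightarrow> e3 \<noteq> 0 \<longrightarrow> e2 \<noteq> e3 \<longrightarrow>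
      u = 0 \<or> u = e2 \<or> u = e3 \<or> u = e2 + e3"
    by (simp add: all_klein zero_klein_def all_bool_eq)
  then show ?thesis using assms that unfolding basis_def by blast
qed

lemma basis_swap: "basis e2 e3 \<longleftrightarrow> basis e3 e2"
  by (auto simp: basis_def)

lemma basis_add: "basis e2 e3 \<Longrightarrow> basis (e2 + e3) e3" "basis e2 e3 \<Longrightarrow> basis e2 (e2 + e3)"
  by (auto simp: basis_def klein_add_eq_iff)

lemma basis_extend: "e2 \<noteq> 0 \<Longrightarrow> \<exists>e3. basis e2 e3"
proof -
  have "\<forall>e2 :: klein. e2 \<noteq> 0 \<longrightarrow> (\<exists>e3. basis e2 e3)"
    unfolding basis_def zero_klein_def by (metis klein.inject)
  then show "e2 \<noteq> 0 \<Longrightarrow> \<exists>e3. basis e2 e3" by blast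
qed

lemma outside_less: "outside e u < 2" by (simp add: outside_def)

lemma outside_0 [simp]: "outside e 0 = 0" by (simp add: outside_def)

lemma outside_self [simp]: "outside e e = 0" by (simp add: outside_def)

lemma outside_eq_iff: "e \<noteq> 0 \<Longrightarrow> outside e u = outside e v \<longleftrightarrow> u = v \<or> u + v = e"
proof -
  have "\<forall>e u v :: klein. e \<noteq> 0 \<longrightarrow>
      ((u = 0 \<or> u = e) = (v = 0 \<or> v = e)) = (u = v \<or> u + v = e)"
    by (simp add: all_klein zero_klein_def all_bool_eq)
  then show "e \<noteq> 0 \<Longrightarrow> outside e u = outside e v \<longleftrightarrow> u = v \<or> u + v = e"
    unfolding outside_def by (smt (verit) zero_neq_one)
qed

lemma klein_coordinates:
  assumes "basis e2 e3"
  shows "scl (int (outside e3 u)) e2 + scl (int (outside e2 u)) e3 = u"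
  by (rule klein_cases[OF assms, of u]) (use assms in \<open>auto simp: scl_def outside_def basis_def\<close>)

lemma scl_simps [simp]: "scl 0 e = 0" "scl 1 e = e" "scl n 0 = 0"
  by (simp_all add: scl_def)

lemma card_klein [simp]: "card (UNIV :: klein set) = 4"
proof -
  have "bij_betw (\<lambda>(a, b). Kl a b) UNIV UNIV"
    by (auto simp: bij_betw_def inj_on_def) (metis UNIV_I case_prod_conv klein.exhaust range_eqI)
  then have "card (UNIV :: klein set) = card (UNIV :: (bool \<times> bool) set)"
    by (simp add: bij_betw_same_card)
  then show ?thesis by (simp add: card_UNIV_unit flip: UNIV_Times_UNIV)
qed

lemma finite_klein [simp]: "finite (A :: klein set)"
  by (rule finite_subset[of _ UNIV]) (simp_all add: card_ge_0_finite)

lemma klein_family: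
  assumes "basis e2 e3"
  shows "{f u | u. u \<in> UNIV} = {f (scl (int j) e2 + scl (int i) e3) | i j. i < 2 \<and> j < 2}"
    and "{f u | u. u \<in> UNIV} = {f (scl (int i) e2 + scl (int j) e3) | i j. i < 2 \<and> j < 2}"
proof -
  have "f u = f (scl (int (outside e3 u)) e2 + scl (int (outside e2 u)) e3)" for u
    by (simp add: klein_coordinates[OF assms])
  then show "{f u | u. u \<in> UNIV} = {f (scl (int j) e2 + scl (int i) e3) | i j. i < 2 \<and> j < 2}"
    "{f u | u. u \<in> UNIV} = {f (scl (int i) e2 + scl (int j) e3) | i j. i < 2 \<and> j < 2}"
    using outside_less by blast+
qed

lemma klein_family_times:
  fixes f :: "nat \<Rightarrow> klein \<Rightarrow> 'a"
  assumes "basis e2 e3"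
  shows "{f i u | i u. i < m} = {f i (scl (int j) e2 + scl (int k) e3) | i j k. i < m \<and> j < 2 \<and> k < 2}"
    and "{f i u | i u. i < m} = {f k (scl (int i) e2 + scl (int j) e3) | i j k. i < 2 \<and> j < 2 \<and> k < m}"
proof -
  have "f i u = f i (scl (int (outside e3 u)) e2 + scl (int (outside e2 u)) e3)" for i u
    by (simp add: klein_coordinates[OF assms])
  then show "{f i u | i u. i < m} = {f i (scl (int j) e2 + scl (int k) e3) | i j k. i < m \<and> j < 2 \<and> k < 2}"
    "{f i u | i u. i < m} = {f k (scl (int i) e2 + scl (int j) e3) | i j k. i < 2 \<and> j < 2 \<and> k < m}"
    using outside_less by blast+
qed

text \<open>
  Several families use one integer both as a multiple of \<open>p\<close> and as a coefficient of an element of order 2.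
  Only its residue modulo \<open>p\<close> and its parity matter, and since \<open>p\<close> is odd, these are independent:
  for \<open>r < p\<close> the integer below has residue \<open>r\<close> and the parity of \<open>b\<close>. For \<open>r = b = 0\<close> it is 0, as
  the normalisation of the families demands.
\<close>
definition crt :: "nat \<Rightarrow> nat \<Rightarrow> nat \<Rightarrow> int" where
  "crt p r b = (if even r = even b then int r else int r + int p)"

lemma crt_simps:
  "crt p 0 0 = 0"
  "r < p \<Longrightarrow> nat (crt p r b mod int p) = r"
  "odd p \<Longrightarrow> scl (crt p r b) e = scl (int b) e"
  by (auto simp: crt_def scl_def)

lemma comb_eq:
  assumes "i < p"
  shows "comb p e2 e3 (int i + a * int p) b c = (i, nat (a mod int p), scl b e2 + scl c e3)"
    and "comb p e2 e3 (a * int p) b c = (0, nat (a mod int p), scl b e2 + scl c e3)"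
    and "comb p e2 e3 0 b c = (0, 0, scl b e2 + scl c e3)"
  using assms by (auto simp: comb_def)

lemma comb_eq_div_mod:
  "n < p\<^sup>2 \<Longrightarrow> comb p e2 e3 (int n) b c = (n mod p, n div p, scl b e2 + scl c e3)"
  using div_less_iff_less_mult[of p n p]
  by (cases "p = 0") (simp_all add: comb_def power2_eq_square flip: zdiv_int zmod_int)

lemma family_cong:
  fixes f1 g1 :: "nat \<Rightarrow> 'a" and f2 g2 :: "nat \<Rightarrow> nat \<Rightarrow> 'a" and f3 g3 :: "nat \<Rightarrow> nat \<Rightarrow> nat \<Rightarrow> 'a"
  shows "(\<And>i. i < m \<Longrightarrow> f1 i = g1 i) \<Longrightarrow> {f1 i | i. i < m} = {g1 i | i. i < m}"
    and "(\<And>i j. i < m \<Longrightarrow> j < n \<Longrightarrow> f2 i j = g2 i j) \<Longrightarrow>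
      {f2 i j | i j. i < m \<and> j < n} = {g2 i j | i j. i < m \<and> j < n}"
    and "(\<And>i j k. i < m \<Longrightarrow> j < n \<Longrightarrow> k < r \<Longrightarrow> f3 i j k = g3 i j k) \<Longrightarrow>
      {f3 i j k | i j k. i < m \<and> j < n \<and> k < r} = {g3 i j k | i j k. i < m \<and> j < n \<and> k < r}"
  by metis+

lemma family_cong_klein:
  fixes f g :: "klein \<Rightarrow> 'a" and f' g' :: "nat \<Rightarrow> klein \<Rightarrow> 'a"
  shows "(\<And>u. f u = g u) \<Longrightarrow> {f u | u. u \<in> UNIV} = {g u | u. u \<in> UNIV}"
    and "(\<And>i u. i < m \<Longrightarrow> f' i u = g' i u) \<Longrightarrow> {f' i u | i u. i < m} = {g' i u | i u. i < m}"
  by metis+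

lemma family_div_mod:
  fixes p :: nat
  assumes "0 < p"
  shows "{f i j | i j. i < p \<and> j < p} = {f (n mod p) (n div p) | n. n < p\<^sup>2}"
proof -
  have "\<exists>n < p\<^sup>2. n mod p = i \<and> n div p = j" if "i < p" "j < p" for i j
  proof (intro exI conjI)
    have "i + j * p < p + j * p" using that by simp
    also have "\<dots> \<le> p\<^sup>2" using that mult_le_mono1[of "Suc j" p p] by (simp add: power2_eq_square)
    finally show "i + j * p < p\<^sup>2" .
  qed (use that in simp_all)
  moreover have "n mod p < p" "n div p < p" if "n < p\<^sup>2" for n
    using that assms by (simp_all add: div_less_iff_less_mult power2_eq_square)
  ultimately show ?thesis by blast
qed

lemma family_less_2: "{f i | i :: nat. i < 2} = {f 0, f 1}"
  by (auto simp: less_2_cases_iff)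

lemma family_div_mod_times:
  fixes p :: nat
  assumes "0 < p"
  shows "{f i j k | i j k. i < p \<and> j < p \<and> k < m} = {f (n mod p) (n div p) k | n k. n < p\<^sup>2 \<and> k < m}"
proof -
  have "{f i j k | i j k. i < p \<and> j < p \<and> k < m} = (\<Union>k \<in> {k. k < m}. {f i j k | i j. i < p \<and> j < p})"
    by blast
  also have "\<dots> = {f (n mod p) (n div p) k | n k. n < p\<^sup>2 \<and> k < m}"
    unfolding family_div_mod[OF assms] by blast
  finally show ?thesis .
qed

section \<open>Types of differences\<close>

text \<open>
  The type of a difference of two points consists of its Klein component \<open>w\<close> and of the subgroup
  of the cyclic group of order \<open>p\<^sup>2\<close> that its cyclic component generates. A set contains \<open>w\<close> as a
  type far, near or vert, according to whether this is the whole cyclic group, its subgroup of order \<open>p\<close>,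
  or trivial.
\<close>
definition far :: "point set \<Rightarrow> klein \<Rightarrow> bool" where
  "far X w \<longleftrightarrow> (\<exists>i j u i' j' u'. (i, j, u) \<in> X \<and> (i', j', u') \<in> X \<and> i \<noteq> i' \<and> u + u' = w)"

definition near :: "point set \<Rightarrow> klein \<Rightarrow> bool" where
  "near X w \<longleftrightarrow> (\<exists>i j u j' u'. (i, j, u) \<in> X \<and> (i, j', u') \<in> X \<and> j \<noteq> j' \<and> u + u' = w)"

definition vert :: "point set \<Rightarrow> klein \<Rightarrow> bool" where
  "vert X w \<longleftrightarrow> (\<exists>i j u u'. (i, j, u) \<in> X \<and> (i, j, u') \<in> X \<and> u + u' = w)"

lemma farI: "(i, j, u) \<in> X \<Longrightarrow> (i', j', u') \<in> X \<Longrightarrow> i \<noteq> i' \<Longrightarrow> far X (u + u')"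
  unfolding far_def by blast

lemma nearI: "(i, j, u) \<in> X \<Longrightarrow> (i, j', u') \<in> X \<Longrightarrow> j \<noteq> j' \<Longrightarrow> near X (u + u')"
  unfolding near_def by blast

lemma vertI: "(i, j, u) \<in> X \<Longrightarrow> (i, j, u') \<in> X \<Longrightarrow> vert X (u + u')"
  unfolding vert_def by blast

text \<open>
  Equality of \<open>i\<close> is transitive. So if two points with Klein components \<open>u\<close> and \<open>u + w\<close> are far, then
  any third point is far from one of them, which gives a second direction.
\<close>
lemma far_second:
  assumes "far X w" "w \<noteq> 0" "\<And>u. \<exists>i j. (i, j, u) \<in> X"
  shows "\<exists>w'. basis w w' \<and> far X w'"
proof -
  obtain i j u i' j' where w: "(i, j, u) \<in> X" "(i', j', u + w) \<in> X" "i \<noteq> i'"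
    using assms(1) unfolding far_def klein_add_eq_iff by blast
  obtain v where v: "basis w v" using basis_extend[OF assms(2)] by blast
  obtain i'' j'' where x: "(i'', j'', u + v) \<in> X" using assms(3) by blast
  show ?thesis
  proof (cases "i'' = i")
    case True
    then have "far X ((u + w) + (u + v))" using w(2,3) x True farI[of i' j' "u + w" X i'' j''] by auto
    then show ?thesis using basis_add(2)[OF v] by (auto simp: add_ac intro: exI[of _ "w + v"])
  next
    case False
    then have "far X v" using farI[OF w(1) x] by simp
    then show ?thesis using v by auto
  qed
qed

lemma near_second:
  assumes "near X w" "w \<noteq> 0" "\<And>u. \<exists>j. (0, j, u) \<in> X" "\<And>i j u. (i, j, u) \<in> X \<Longrightarrow> i = 0"
  shows "\<exists>w'. basis w w' \<and> near X w'"
proof -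
  obtain j u j' where w: "(0, j, u) \<in> X" "(0, j', u + w) \<in> X" "j \<noteq> j'"
    using assms(1,4) unfolding near_def klein_add_eq_iff by blast
  obtain v where v: "basis w v" using basis_extend[OF assms(2)] by blast
  obtain j'' where x: "(0, j'', u + v) \<in> X" using assms(3) by blast
  show ?thesis
  proof (cases "j'' = j")
    case True
    then have "near X ((u + w) + (u + v))" using w(2,3) x True nearI[of 0 j' "u + w" X j''] by auto
    then show ?thesis using basis_add(2)[OF v] by (auto simp: add_ac intro: exI[of _ "w + v"])
  next
    case False
    then have "near X v" using nearI[OF w(1) x] by simp
    then show ?thesis using v by auto
  qed
qed

text \<open>
  The source of all explicit families: an injective key with as many values as there are points makes a
  set a family indexed by the keys.
\<close>
lemma exists_parametrization:
  assumes "inj_on key X" "key ` X \<subseteq> K" "finite K" "card X = card K"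
  shows "\<exists>e. X = {e k | k. k \<in> K} \<and> (\<forall>k \<in> K. key (e k) = k)"
proof -
  have K: "key ` X = K"
    using assms by (intro card_subset_eq) (simp_all add: card_image)
  have "X = inv_into X key ` K"
    using assms(1) by (auto simp flip: K)
  moreover have "\<forall>k \<in> K. key (inv_into X key k) = k"
    using K by (auto intro: f_inv_into_f)
  ultimately show ?thesis by (intro exI[of _ "inv_into X key"]) auto
qed

abbreviation box :: "nat \<Rightarrow> point set" where
  "box p \<equiv> {..<p} \<times> {..<p} \<times> UNIV"

text \<open>
  In each of the following lemmas the absent types make one choice of coordinates an injective key.
\<close>
lemma param_i:
  assumes "X \<subseteq> box p" "card X = p" "\<And>w. \<not> near X w" "\<And>w. vert X w \<Longrightarrow> w = 0"
  shows "\<exists>s g. X = {(i, s i, g i) | i. i < p} \<and> (\<forall>i < p. s i < p)"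
proof -
  have "inj_on fst X"
  proof (rule inj_onI)
    fix x y assume xy: "x \<in> X" "y \<in> X" "fst x = fst y"
    obtain i j u j' u' where [simp]: "x = (i, j, u)" "y = (i, j', u')"
      using xy(3) by (metis prod.collapse)
    have "j = j'" using xy assms(3) nearI[of i j u X j' u'] by auto
    moreover from this have "u + u' = 0" using xy assms(4)[OF vertI[of i j u X u']] by auto
    ultimately show "x = y" by simp
  qed
  then obtain e where e: "X = {e k | k. k \<in> {..<p}}" "\<forall>k \<in> {..<p}. fst (e k) = k"
    using exists_parametrization[of fst X "{..<p}"] assms(1,2) by force
  have "{e k | k. k < p} = {(i, fst (snd (e i)), snd (snd (e i))) | i. i < p}"
    using e(2) by (intro family_cong) (simp add: prod_eq_iff)
  moreover have "\<forall>k<p. fst (snd (e k)) < p" using e(1) assms(1) by force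
  ultimately show ?thesis using e(1)
    by (intro exI[of _ "\<lambda>i. fst (snd (e i))"] exI[of _ "\<lambda>i. snd (snd (e i))"]) simp
qed

lemma param_j:
  assumes "X \<subseteq> box p" "card X = p" "\<And>i j u. (i, j, u) \<in> X \<Longrightarrow> i = 0" "\<And>w. vert X w \<Longrightarrow> w = 0"
  shows "\<exists>g. X = {(0, j, g j) | j. j < p}"
proof -
  have "inj_on (\<lambda>(i, j, u). j) X"
  proof (rule inj_onI)
    fix x y assume xy: "x \<in> X" "y \<in> X" "(\<lambda>(i, j, u). j) x = (\<lambda>(i, j, u). j) y"
    obtain i j u i' u' where [simp]: "x = (i, j, u)" "y = (i', j, u')"
      using xy(3) by (auto simp: case_prod_unfold) (metis prod.collapse)
    have "i = i'" using xy assms(3)[of i j u] assms(3)[of i' j u'] by simp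
    moreover from this have "u + u' = 0" using xy assms(4)[OF vertI[of i j u X u']] by auto
    ultimately show "x = y" by simp
  qed
  then obtain e where e: "X = {e k | k. k \<in> {..<p}}" "\<forall>k \<in> {..<p}. (\<lambda>(i, j, u). j) (e k) = k"
    using exists_parametrization[of "\<lambda>(i, j, u). j" X "{..<p}"] assms(1,2) by force
  have "e k \<in> X" if "k < p" for k using e(1) that by auto
  then have "fst (e k) = 0" if "k < p" for k using that assms(3) by (metis prod.collapse)
  then have "{e k | k. k < p} = {(0, j, snd (snd (e j))) | j. j < p}"
    using e(2) by (intro family_cong) (auto simp: prod_eq_iff case_prod_unfold)
  then show ?thesis using e(1) by (intro exI[of _ "\<lambda>i. snd (snd (e i))"]) simp
qed

lemma param_u:
  assumes "X \<subseteq> box p" "card X = 4" "\<not> near X 0" "\<not> far X 0"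
  shows "\<exists>I J. X = {(I u, J u, u) | u. u \<in> UNIV} \<and> (\<forall>u. I u < p \<and> J u < p)"
proof -
  have "inj_on (\<lambda>(i, j, u). u) X"
  proof (rule inj_onI)
    fix x y assume xy: "x \<in> X" "y \<in> X" "(\<lambda>(i, j, u). u) x = (\<lambda>(i, j, u). u) y"
    obtain i j u i' j' u' where [simp]: "x = (i, j, u)" "y = (i', j', u')"
      by (metis prod.collapse)
    have "i = i'" using xy assms(4) farI[of i j u X i' j' u'] by auto
    moreover from this have "j = j'" using xy assms(3) nearI[of i j u X j' u'] by auto
    ultimately show "x = y" using xy by simp
  qed
  then obtain e where e: "X = {e k | k. k \<in> UNIV}" "\<forall>k \<in> UNIV. (\<lambda>(i, j, u). u) (e k) = k"
    using exists_parametrization[of "\<lambda>(i, j, u). u" X UNIV] assms(1,2) by auto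
  have "e k = (fst (e k), fst (snd (e k)), k)" for k
    using e(2) by (auto simp: prod_eq_iff case_prod_unfold)
  then have "{e u | u. u \<in> UNIV} = {(fst (e u), fst (snd (e u)), u) | u. u \<in> UNIV}"
    by (rule family_cong_klein)
  with e(1) have "X = {(fst (e u), fst (snd (e u)), u) | u. u \<in> UNIV}" by (rule trans)
  moreover from this have "(fst (e u), fst (snd (e u)), u) \<in> box p" for u using assms(1) by blast
  then have "\<forall>u. fst (e u) < p \<and> fst (snd (e u)) < p" by simp
  ultimately show ?thesis
    by (intro exI[of _ "\<lambda>i. fst (e i)"] exI[of _ "\<lambda>i. fst (snd (e i))"]) simp
qed

lemma param_ij:
  assumes "X \<subseteq> box p" "card X = p\<^sup>2" "\<And>w. vert X w \<Longrightarrow> w = 0"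
  shows "\<exists>g. X = {(i, j, g i j) | i j. i < p \<and> j < p}"
proof -
  have "inj_on (\<lambda>(i, j, u). (i, j)) X"
  proof (rule inj_onI)
    fix x y assume xy: "x \<in> X" "y \<in> X" "(\<lambda>(i, j, u). (i, j)) x = (\<lambda>(i, j, u). (i, j)) y"
    obtain i j u i' j' u' where [simp]: "x = (i, j, u)" "y = (i', j', u')"
      by (metis prod.collapse)
    have "u + u' = 0" using xy assms(3)[OF vertI[of i j u X u']] by auto
    then show "x = y" using xy by simp
  qed
  then obtain e where e: "X = {e k | k. k \<in> {..<p} \<times> {..<p}}"
      "\<forall>k \<in> {..<p} \<times> {..<p}. (\<lambda>(i, j, u). (i, j)) (e k) = k"
    using exists_parametrization[of "\<lambda>(i, j, u). (i, j)" X "{..<p} \<times> {..<p}"] assms(1,2)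
    by (force simp: power2_eq_square)
  have "X = {e (i, j) | i j. i < p \<and> j < p}" using e(1) by auto
  moreover have "{e (i, j) | i j. i < p \<and> j < p} = {(i, j, snd (snd (e (i, j)))) | i j. i < p \<and> j < p}"
    using e(2) by (intro family_cong) (auto simp: prod_eq_iff case_prod_unfold)
  ultimately show ?thesis by (intro exI[of _ "\<lambda>i j. snd (snd (e (i, j)))"]) simp
qed

lemma param_iu:
  assumes "X \<subseteq> box p" "card X = 4 * p" "\<not> near X 0"
  shows "\<exists>t. X = {(i, t i u, u) | i u. i < p} \<and> (\<forall>i < p. \<forall>u. t i u < p)"
proof -
  have "inj_on (\<lambda>(i, j, u). (i, u)) X"
  proof (rule inj_onI)
    fix x y assume xy: "x \<in> X" "y \<in> X" "(\<lambda>(i, j, u). (i, u)) x = (\<lambda>(i, j, u). (i, u)) y"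
    obtain i j u i' j' u' where [simp]: "x = (i, j, u)" "y = (i', j', u')"
      by (metis prod.collapse)
    have "j = j'" using xy assms(3) nearI[of i j u X j' u'] by auto
    then show "x = y" using xy by simp
  qed
  then obtain e where e: "X = {e k | k. k \<in> {..<p} \<times> UNIV}"
      "\<forall>k \<in> {..<p} \<times> UNIV. (\<lambda>(i, j, u). (i, u)) (e k) = k"
    using exists_parametrization[of "\<lambda>(i, j, u). (i, u)" X "{..<p} \<times> UNIV"] assms(1,2)
    by (force simp: card_cartesian_product)
  have "e (i, u) = (i, fst (snd (e (i, u))), u)" if "i < p" for i u
    using e(2) that by (auto simp: prod_eq_iff case_prod_unfold)
  then have "{e (i, u) | i u. i < p} = {(i, fst (snd (e (i, u))), u) | i u. i < p}"
    by (rule family_cong_klein)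
  moreover have "X = {e (i, u) | i u. i < p}" using e(1) by auto
  ultimately have "X = {(i, fst (snd (e (i, u))), u) | i u. i < p}" by simp
  moreover from this have "(i, fst (snd (e (i, u))), u) \<in> box p" if "i < p" for i u
    using assms(1) that by blast
  then have "\<forall>i<p. \<forall>u. fst (snd (e (i, u))) < p" by simp
  ultimately show ?thesis by (intro exI[of _ "\<lambda>i u. fst (snd (e (i, u)))"]) simp
qed

lemma param_ju:
  assumes "X \<subseteq> box p" "card X = 4 * p" "\<not> far X 0" and p: "0 < p"
  shows "\<exists>c. X = {(c u, j, u) | j u. j < p} \<and> (\<forall>u. c u < p)"
proof -
  have "inj_on (\<lambda>(i, j, u). (j, u)) X"
  proof (rule inj_onI)
    fix x y assume xy: "x \<in> X" "y \<in> X" "(\<lambda>(i, j, u). (j, u)) x = (\<lambda>(i, j, u). (j, u)) y"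
    obtain i j u i' j' u' where [simp]: "x = (i, j, u)" "y = (i', j', u')"
      by (metis prod.collapse)
    have "i = i'" using xy assms(3) farI[of i j u X i' j' u'] by auto
    then show "x = y" using xy by simp
  qed
  then obtain e where e: "X = {e k | k. k \<in> {..<p} \<times> UNIV}"
      "\<forall>k \<in> {..<p} \<times> UNIV. (\<lambda>(i, j, u). (j, u)) (e k) = k"
    using exists_parametrization[of "\<lambda>(i, j, u). (j, u)" X "{..<p} \<times> UNIV"] assms(1,2)
    by (force simp: card_cartesian_product)
  have eq: "e (j, u) = (fst (e (j, u)), j, u)" if "j < p" for j u
    using e(2) that by (auto simp: prod_eq_iff case_prod_unfold)
  have X: "X = {e (j, u) | j u. j < p}" using e(1) by auto
  have mem: "e (j, u) \<in> X" if "j < p" for j u using X that by blast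
  have "fst (e (j, u)) = fst (e (0, u))" if "j < p" for j u
  proof (rule ccontr)
    assume "fst (e (j, u)) \<noteq> fst (e (0, u))"
    moreover have "(fst (e (j, u)), j, u) \<in> X" "(fst (e (0, u)), 0, u) \<in> X"
      using mem[OF that, of u] mem[OF p, of u] eq[OF that, of u] eq[OF p, of u] by simp_all
    ultimately show False using farI assms(3) klein_add_self by metis
  qed
  then have "e (j, u) = (fst (e (0, u)), j, u)" if "j < p" for j u using eq that by metis
  then have "{e (j, u) | j u. j < p} = {(fst (e (0, u)), j, u) | j u. j < p}"
    by (rule family_cong_klein)
  with X have "X = {(fst (e (0, u)), j, u) | j u. j < p}" by simp
  moreover from this have "(fst (e (0, u)), 0, u) \<in> box p" for u
    using assms(1) p by blast
  then have "\<forall>u. fst (e (0, u)) < p" by simp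
  ultimately show ?thesis by (intro exI[of _ "\<lambda>u. fst (e (0, u))"]) simp
qed

section \<open>Factors of order 2, 4 and p\<close>

text \<open>
  What the multiplier principle says about the types of two factors \<open>X\<close> and \<open>Y\<close> of a tiling. The first three
  clauses come from multipliers prime to \<open>2 p\<close>, which move a difference to any other one of the same type.
  An even multiplier turns a difference of \<open>X\<close> into one with Klein component 0; it is available if
  \<open>X\<close> has odd order. An odd multiple of \<open>p\<close> shrinks the cyclic component; it is available if the order of
  \<open>X\<close> divides 4.
\<close>
definition repels :: "point set \<Rightarrow> point set \<Rightarrow> bool" where
  "repels X Y \<longleftrightarrow>
    (\<forall>w. far X w \<longrightarrow> \<not> far Y w) \<and>
    (\<forall>w. near X w \<longrightarrow> \<not> near Y w) \<and>
    (\<forall>w. vert X w \<longrightarrow> vert Y w \<longrightarrow> w = 0) \<and>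
    (odd (card X) \<longrightarrow>
      (\<forall>w. far X w \<longrightarrow> \<not> far Y 0) \<and> (\<forall>w. near X w \<longrightarrow> \<not> near Y 0) \<and> (\<forall>w. vert X w \<longrightarrow> w = 0)) \<and>
    (card X dvd 4 \<longrightarrow>
      (\<forall>w. far X w \<longrightarrow> w \<noteq> 0 \<and> \<not> near Y w \<and> \<not> vert Y w) \<and>
      (\<forall>w. near X w \<longrightarrow> w \<noteq> 0 \<and> \<not> vert Y w))"

lemma repelsD:
  assumes "repels X Y"
  shows "far X w \<Longrightarrow> \<not> far Y w"
    "near X w \<Longrightarrow> \<not> near Y w"
    "vert X w \<Longrightarrow> vert Y w \<Longrightarrow> w = 0"
    "odd (card X) \<Longrightarrow> far X w \<Longrightarrow> \<not> far Y 0"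
    "odd (card X) \<Longrightarrow> near X w \<Longrightarrow> \<not> near Y 0"
    "odd (card X) \<Longrightarrow> vert X w \<Longrightarrow> w = 0"
    "card X dvd 4 \<Longrightarrow> far X w \<Longrightarrow> w \<noteq> 0"
    "card X dvd 4 \<Longrightarrow> far X w \<Longrightarrow> \<not> near Y w"
    "card X dvd 4 \<Longrightarrow> far X w \<Longrightarrow> \<not> vert Y w"
    "card X dvd 4 \<Longrightarrow> near X w \<Longrightarrow> w \<noteq> 0"
    "card X dvd 4 \<Longrightarrow> near X w \<Longrightarrow> \<not> vert Y w"
  using assms unfolding repels_def by (metis, metis, metis, metis, metis, metis, metis, metis, metis, metis, metis)

text \<open>
  The two assumptions on the spread of \<open>S\<close> are what remains of the hypothesis that it generates the group:
  it is not contained in the subgroup of index \<open>p\<close> or in one of the subgroups of index 2. The assumption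
  on \<open>card C\<close> excludes the code of a complete digraph.
\<close>
locale code_pair =
  fixes p :: nat and S C :: "point set"
  assumes p: "prime p" "odd p"
    and box: "S \<subseteq> box p" "C \<subseteq> box p"
    and zero: "(0, 0, 0) \<in> S" "(0, 0, 0) \<in> C"
    and card_mult: "card S * card C = 4 * p\<^sup>2" and card_C: "card C \<noteq> 1"
    and spread: "\<exists>i j u. (i, j, u) \<in> S \<and> i \<noteq> 0"
    and spread_klein: "\<exists>i j u. (i, j, u) \<in> S \<and> u \<noteq> 0 \<and> u \<noteq> v"
    and SC: "repels S C" and CS: "repels C S"
begin

definition listed where
  "listed \<longleftrightarrow> (\<exists>e2 e3. basis e2 e3 \<and> listed_pair p (comb p e2 e3) S C)"

lemma listedI: "basis e2 e3 \<Longrightarrow> listed_pair p (comb p e2 e3) S C \<Longrightarrow> listed"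
  unfolding listed_def by blast

lemma p3: "2 < p" and p0: "0 < p"
proof -
  show "2 < p" using p prime_gt_1_nat[OF p(1)] by (cases "p = 2") auto
  then show "0 < p" by simp
qed

text \<open>
  Klein components outside \<open>{w, w'}\<close> lie in the subgroup of order 2 generated by \<open>w + w'\<close>.
\<close>
lemma two_directions:
  assumes "(\<And>i j u. (i, j, u) \<in> S \<Longrightarrow> u \<noteq> w \<and> u \<noteq> w')" "basis w w'"
  shows False
proof -
  obtain i j u where "(i, j, u) \<in> S" "u \<noteq> 0" "u \<noteq> w + w'" using spread_klein by blast
  then show False using assms(1) by (cases u rule: klein_cases[OF assms(2)]) auto
qed

text \<open>
  Here \<open>S\<close> has one point over each element of the Klein group and \<open>C\<close> one point over each element of the cyclic
  group. As \<open>S\<close> generates, it has far types in two directions, which \<open>C\<close> therefore does not contain in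
  any way; so the Klein components of \<open>C\<close> lie in \<open>{0, e2}\<close> for the third direction \<open>e2\<close>. How \<open>C\<close> looks
  now depends on whether \<open>S\<close> contains \<open>e2\<close> far, near or not at all except vertically.
\<close>
lemma listed_if_card_S_eq_4:
  assumes S4: "card S = 4"
  shows listed
proof -
  have four: "card S dvd 4" and C4: "card C = p\<^sup>2" using S4 card_mult by auto
  note R = repelsD(1-3)[OF SC] repelsD(7-)[OF SC four]
  obtain I J where S: "S = {(I u, J u, u) | u. u \<in> UNIV}" and lt: "I u < p" "J u < p" for u
    using param_u[OF box(1) S4] R(4,7)[of 0] by blast
  have mem: "(I u, J u, u) \<in> S" for u using S by blast
  have z: "I 0 = 0" "J 0 = 0" using S zero(1) by auto
  \<comment> \<open>\<open>S\<close> has points over \<open>0\<close> and \<open>w\<close>; whatever type their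
    difference has, it excludes a vertical one in \<open>C\<close>\<close>
  have vC: "w = 0" if "vert C w" for w
  proof (rule ccontr)
    assume "w \<noteq> 0"
    have "far S w \<or> near S w \<or> vert S w"
      using farI[OF mem[of 0] mem[of w]] nearI[of "I 0" "J 0" 0 S "J w" w]
        vertI[of "I 0" "J 0" 0 S w] mem[of 0] mem[of w] by (cases "I 0 = I w"; cases "J 0 = J w") auto
    then show False using R that \<open>w \<noteq> 0\<close> by blast
  qed
  obtain g where C: "C = {(i, j, g i j) | i j. i < p \<and> j < p}" using param_ij[OF box(2) C4 vC] by blast
  have memC: "(i, j, g i j) \<in> C" if "i < p" "j < p" for i j using C that by blast
  have gz: "g 0 0 = 0" using C zero(2) by auto
  obtain i j w where "(i, j, w) \<in> S" "i \<noteq> 0" using spread by blast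
  then have "far S w" using farI[OF zero(1)] by fastforce
  moreover from this have "w \<noteq> 0" using R by blast
  ultimately obtain w' where w: "far S w" "far S w'" "basis w w'"
    using far_second[of S w] mem by blast
  define e2 where "e2 = w + w'"
  define e3 where "e3 = w"
  have b: "basis e2 e3" using w(3) basis_add(1)[of w' w] basis_swap by (auto simp: e2_def e3_def add.commute)
  \<comment> \<open>a difference to \<open>(0, 0, 0)\<close> with Klein component \<open>v\<close> would be far or
    near\<close>
  have ban: "g i j \<noteq> v" if "far S v" "i < p" "j < p" for i j v
  proof
    assume v: "g i j = v"
    have "v \<noteq> 0" using that R by blast
    then have "far C v \<or> near C v"
      using farI[OF zero(2) memC[OF that(2,3)]] nearI[OF zero(2), of j "g i j"] memC[OF that(2,3)] v gz
      by (cases "i = 0"; cases "j = 0") auto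
    then show False using R that by blast
  qed
  have g: "scl (int (outside e3 (g i j))) e2 = g i j" if "i < p" "j < p" for i j
    using ban[OF w(1) that] ban[OF w(2) that] b
    by (cases "g i j" rule: klein_cases[OF b]) (auto simp: e2_def e3_def outside_def basis_def)
  define V where "V i j = scl (int i) e2 + scl (int j) e3" for i j :: nat
  have Vz: "V 0 0 = 0" by (simp add: V_def)
  have V: "V k i = V 0 i \<or> V 0 i + V k i = e2" if "k < 2" for i k
    using that by (auto simp: V_def less_2_cases_iff add_ac)
  have S1: "S = {(I (V i j), J (V i j), V i j) | i j. i < 2 \<and> j < 2}"
    using S klein_family(2)[OF b, of "\<lambda>u. (I u, J u, u)"] by (simp add: V_def)
  have S2: "S = {(I (V j i), J (V j i), V j i) | i j. i < 2 \<and> j < 2}"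
    using S klein_family(1)[OF b, of "\<lambda>u. (I u, J u, u)"] by (simp add: V_def)
  define l where "l i j = int (outside e3 (g i j))" for i j
  have lz: "l 0 0 = 0" by (simp add: l_def gz)
  show listed
  proof (cases "far S e2")
    case True
    have "g i j = 0" if "i < p" "j < p" for i j
      using g[OF that] ban[OF True that] by (auto simp: scl_def split: if_splits)
    then have "C = {(i, j, 0) | i j. i < p \<and> j < p}" unfolding C by (intro family_cong) simp
    also have "\<dots> = {comb p e2 e3 (int n) 0 0 | n. n < p\<^sup>2}"
      unfolding family_div_mod[OF p0] by (intro family_cong) (simp add: comb_eq_div_mod)
    finally have C': "C = {comb p e2 e3 (int n) 0 0 | n. n < p\<^sup>2}" .
    show listed
      by (rule listedI[OF b], rule pair12[of "\<lambda>i j. int (I (V i j)) + int (J (V i j)) * int p"],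
          simp add: Vz z, rule trans[OF S1], rule family_cong, simp add: comb_eq lt V_def, rule C')
  next
    case nfar: False
    define I0 where "I0 i = I (V 0 i)" for i
    have I: "I (V k i) = I0 i" if "k < 2" for i k
      using V[OF that, of i] nfar farI[OF mem[of "V 0 i"] mem[of "V k i"]]
      by (cases "I (V 0 i) = I (V k i)") (auto simp: I0_def)
    have I0: "I0 0 = 0" "I0 i < p" for i by (simp_all add: I0_def Vz z lt)
    show listed
    proof (cases "near S e2")
      case True
      have gi: "g i j = g i 0" if "i < p" "j < p" for i j
      proof (rule ccontr)
        assume ne: "g i j \<noteq> g i 0"
        then have "near C (g i 0 + g i j)"
          using nearI[OF memC[OF that(1) p0] memC[OF that]] by (cases "j = 0") auto
        moreover have "g i 0 + g i j = e2"
          using ne g[OF that] g[OF that(1) p0] by (auto simp: scl_def split: if_splits)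
        ultimately show False using R True by blast
      qed
      have gl: "scl (l i 0) e2 = g i j" if "i < p" "j < p" for i j
        using g[OF that] gi[OF that] by (simp add: l_def)
      have C': "C = {comb p e2 e3 (int i + int j * int p) (l i 0) 0 | i j. i < p \<and> j < p}"
        by (rule trans[OF C], rule family_cong) (simp add: comb_eq flip: gl)
      show listed
        by (rule listedI[OF b],
            rule pair11[of "\<lambda>i. int (I0 i)" "\<lambda>i j. int (J (V j i))" "\<lambda>i. l i 0"],
            simp add: I0, simp add: Vz z, simp add: lz, rule trans[OF S2], rule family_cong,
            simp add: I comb_eq I0 lt, simp add: V_def, rule C')
    next
      case nnear: False
      define J0 where "J0 i = J (V 0 i)" for i
      have J: "J (V k i) = J0 i" if "k < 2" for i k
        using V[OF that, of i] nnear nearI[of "I0 i" "J (V 0 i)" "V 0 i" S "J (V k i)" "V k i"]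
          I[OF that, of i] I[of 0 i] mem[of "V 0 i"] mem[of "V k i"]
        by (cases "J (V 0 i) = J (V k i)") (auto simp: J0_def)
      have J0: "J0 0 = 0" "J0 i < p" for i by (simp_all add: J0_def Vz z lt)
      have C': "C = {comb p e2 e3 (int n) (l (n mod p) (n div p)) 0 | n. n < p\<^sup>2}"
        unfolding C family_div_mod[OF p0]
        by (intro family_cong) (simp add: comb_eq_div_mod l_def g p0 div_less_iff_less_mult power2_eq_square)
      show listed
        by (rule listedI[OF b], rule pair10[of "\<lambda>i. int (I0 i) + int (J0 i) * int p"
              "\<lambda>n. l (n mod p) (n div p)"],
            simp add: I0 J0, simp add: lz, rule trans[OF S2], rule family_cong,
            simp add: I J comb_eq I0 J0, simp add: V_def, rule C')
    qed
  qed
qed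

text \<open>
  The same situation with the factors exchanged. If \<open>C\<close> had a far type, it would have two, and
  \<open>S\<close> would be confined to a subgroup of index 2. So \<open>C\<close> lies over \<open>i = 0\<close>. If it has a near type, the same
  argument one level lower leaves one direction \<open>e2\<close> in which the Klein component of \<open>S\<close> may change with \<open>j\<close>.
\<close>
lemma listed_if_card_C_eq_4:
  assumes C4: "card C = 4"
  shows listed
proof -
  have four: "card C dvd 4" and S4: "card S = p\<^sup>2" using C4 card_mult by auto
  note R = repelsD(1-3)[OF CS] repelsD(7-)[OF CS four]
  obtain I J where C: "C = {(I u, J u, u) | u. u \<in> UNIV}" and lt: "I u < p" "J u < p" for u
    using param_u[OF box(2) C4] R(4,7)[of 0] by blast
  have mem: "(I u, J u, u) \<in> C" for u using C by blast
  have z: "I 0 = 0" "J 0 = 0" using C zero(2) by auto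
  \<comment> \<open>\<open>C\<close> has points over \<open>0\<close> and \<open>w\<close>; whatever type their
    difference has, it excludes a vertical one in \<open>S\<close>\<close>
  have vS: "w = 0" if "vert S w" for w
  proof (rule ccontr)
    assume "w \<noteq> 0"
    have "far C w \<or> near C w \<or> vert C w"
      using farI[OF mem[of 0] mem[of w]] nearI[of "I 0" "J 0" 0 C "J w" w]
        vertI[of "I 0" "J 0" 0 C w] mem[of 0] mem[of w] by (cases "I 0 = I w"; cases "J 0 = J w") auto
    then show False using R that \<open>w \<noteq> 0\<close> by blast
  qed
  obtain g where S: "S = {(i, j, g i j) | i j. i < p \<and> j < p}" using param_ij[OF box(1) S4 vS] by blast
  have memS: "(i, j, g i j) \<in> S" if "i < p" "j < p" for i j using S that by blast
  have gz: "g 0 0 = 0" using S zero(1) by auto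
  have nfar: "\<not> far C w" for w
  proof
    assume far: "far C w"
    then have "w \<noteq> 0" using R by blast
    then obtain w' where w: "basis w w'" "far C w'" using far_second[OF far] mem by blast
    have ban: "u \<noteq> v" if "far C v" "(i, j, u) \<in> S" for v u i j
    proof
      assume v: "u = v"
      have "v \<noteq> 0" using that R by blast
      then have "far S v \<or> near S v \<or> vert S v"
        using farI[OF zero(1) that(2)] nearI[OF zero(1), of j u] vertI[OF zero(1), of u] that(2) v
        by (cases "i = 0"; cases "j = 0") auto
      then show False using R that by blast
    qed
    show False by (rule two_directions[OF _ w(1)]) (use ban w far in blast)
  qed
  have I: "I u = 0" for u
    using farI[OF mem[of 0] mem[of u]] nfar z by (cases "I u = 0") auto
  show listed
  proof (cases "\<exists>w. near C w")
    case False
    have J: "J u = 0" for u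
      using nearI[of 0 "J 0" 0 C "J u" u] mem[of 0] mem[of u] False z I by (cases "J u = 0") auto
    obtain e2 e3 where b: "basis e2 e3" using basis_extend[of "Kl True False"] by (auto simp: zero_klein_def)
    define h where "h n = g (n mod p) (n div p)" for n
    have "S = {comb p e2 e3 (int n) (int (outside e3 (h n))) (int (outside e2 (h n))) | n. n < p\<^sup>2}"
      unfolding S family_div_mod[OF p0]
      by (intro family_cong) (simp add: comb_eq_div_mod h_def klein_coordinates[OF b])
    moreover have "C = {comb p e2 e3 0 (int i) (int j) | i j. i < 2 \<and> j < 2}"
      by (rule trans[OF C], rule trans[OF klein_family(2)[OF b]], rule family_cong)
        (simp add: comb_eq(3)[OF p0] I J)
    ultimately have "listed_pair p (comb p e2 e3) S C"
      by (intro pair4[of "\<lambda>n. int (outside e3 (h n))" "\<lambda>n. int (outside e2 (h n))"])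
        (simp_all add: h_def gz)
    then show listed by (rule listedI[OF b])
  next
    case True
    then obtain w where near: "near C w" by blast
    then have "w \<noteq> 0" using R by blast
    moreover have "\<exists>j. (0, j, u) \<in> C" for u using mem[of u] I by auto
    moreover have "i = 0" if "(i, j, u) \<in> C" for i j u using that C I by auto
    ultimately obtain w' where w: "near C w'" "basis w w'"
      using near_second[OF near] by blast
    define e2 where "e2 = w + w'"
    define e3 where "e3 = w"
    have b: "basis e2 e3" using w(2) basis_add(1)[of w' w] basis_swap by (auto simp: e2_def e3_def add.commute)
    have g: "outside e2 (g i j) = outside e2 (g i 0)" if "i < p" "j < p" for i j
    proof (cases "g i j = g i 0 \<or> j = 0")
      case False
      then have "near S (g i 0 + g i j)"
        using nearI[OF memS[OF that(1) p0] memS[OF that]] by blast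
      then have "g i 0 + g i j \<noteq> w" "g i 0 + g i j \<noteq> w'" using near w R by blast+
      moreover have "g i 0 + g i j \<noteq> 0" using False by auto
      ultimately have "g i 0 + g i j = e2"
        using klein_cases[OF w(2), of "g i 0 + g i j"] e2_def by blast
      then show ?thesis using outside_eq_iff[of e2 "g i 0" "g i j"] b by (auto simp: basis_def)
    qed auto
    define V where "V i j = scl (int i) e2 + scl (int j) e3" for i j :: nat
    have Vz: "V 0 0 = 0" by (simp add: V_def)
    define a where "a i j = int (outside e3 (g i j))" for i j
    define c where "c i = int (outside e2 (g i 0))" for i
    have ga: "scl (a i j) e2 + scl (c i) e3 = g i j" if "i < p" "j < p" for i j
      using klein_coordinates[OF b, of "g i j"] g[OF that] by (simp add: a_def c_def)
    have S': "S = {comb p e2 e3 (int i + int j * int p) (a i j) (c i) | i j. i < p \<and> j < p}"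
      by (rule trans[OF S], rule family_cong) (simp add: comb_eq ga)
    have az: "a 0 0 = 0" "c 0 = 0" by (simp_all add: a_def c_def gz)
    show listed
    proof (cases "near C e2")
      case True
      have gi: "g i j = g i 0" if "i < p" "j < p" for i j
      proof (rule ccontr)
        assume ne: "g i j \<noteq> g i 0"
        then have "near S (g i 0 + g i j)"
          using nearI[OF memS[OF that(1) p0] memS[OF that]] by (cases "j = 0") auto
        moreover have "g i 0 + g i j = e2"
          using ne g[OF that] outside_eq_iff[of e2 "g i 0" "g i j"] b by (auto simp: basis_def)
        ultimately show False using R True by blast
      qed
      define a0 where "a0 i = a i 0" for i
      have ai: "a i j = a0 i" if "i < p" "j < p" for i j using gi[OF that] by (simp add: a_def a0_def)
      have S'': "S = {comb p e2 e3 (int i + int j * int p) (a0 i) (c i) | i j. i < p \<and> j < p}"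
        by (rule trans[OF S'], rule family_cong) (simp only: ai)
      have C': "C = {comb p e2 e3 (int (J (V i j)) * int p) (int i) (int j) | i j. i < 2 \<and> j < 2}"
        by (rule trans[OF C], rule trans[OF klein_family(2)[OF b]], rule family_cong)
          (simp add: comb_eq(2)[OF p0] I lt V_def)
      show listed
        by (rule listedI[OF b], rule pair2[of a0 c "\<lambda>i j. int (J (V i j))"],
          simp add: a0_def az, simp add: az, simp add: Vz z, rule S'', rule C')
    next
      case False
      define J0 where "J0 i = J (V 0 i)" for i
      have J0: "J0 0 = 0" "J0 i < p" for i by (simp_all add: J0_def Vz z lt)
      have J: "J (V k i) = J0 i" if "k < 2" for k i
      proof -
        have "V 0 i = V k i \<or> V 0 i + V k i = e2"
          using that by (auto simp: V_def less_2_cases_iff add_ac)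
        then show ?thesis
          using nearI[of 0 "J (V 0 i)" "V 0 i" C "J (V k i)" "V k i"] False mem[of "V 0 i"] mem[of "V k i"] I
          by (cases "J (V 0 i) = J (V k i)") (auto simp: J0_def)
      qed
      have "C = {comb p e2 e3 (int (J0 i) * int p) (int j) (int i) | i j. i < 2 \<and> j < 2}"
        by (rule trans[OF C], rule trans[OF klein_family(1)[OF b]], intro family_cong)
          (simp add: comb_eq(2)[OF p0] I J[unfolded V_def] J0)
      then show listed
        by (intro listedI[OF b] pair3[of c a "\<lambda>i. int (J0 i)"] S') (simp_all only: az J0 of_nat_0)
    qed
  qed
qed

end

context code_pair begin

text \<open>
  A far element of \<open>S\<close> and even multipliers exclude far differences of \<open>C\<close> with Klein component 0. So \<open>C\<close>
  consists of four cosets of the subgroup of order \<open>p\<close>, one for each Klein component \<open>u\<close>, and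
  \<open>c u\<close> tells which. If these cosets were not aligned, \<open>C\<close> would have far types in two directions and
  \<open>S\<close> would be confined to a subgroup of index 2.
\<close>
lemma listed_if_card_S_eq_p:
  assumes Sp: "card S = p"
  shows listed
proof -
  have odd: "odd (card S)" and C4p: "card C = 4 * p" using Sp p p0 card_mult by (auto simp: power2_eq_square)
  note R = repelsD(1-3)[OF SC] repelsD(4-6)[OF SC odd]
  obtain i j u where "(i, j, u) \<in> S" "i \<noteq> 0" using spread by blast
  \<comment> \<open>a unit element of \<open>S\<close>; with even multipliers it excludes the far type 0 in
    \<open>C\<close>\<close>
  then have farS: "far S u" using farI[OF zero(1)] by fastforce
  then have "\<not> far C 0" using R by blast
  then obtain c where C: "C = {(c u, j, u) | j u. j < p}" and cp: "c u < p" for u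
    using param_ju[OF box(2) C4p _ p0] by blast
  have mem: "(c u, j, u) \<in> C" if "j < p" for j u using C that by blast
  have cz: "c 0 = 0" using C zero(2) by auto
  have "near C 0" using nearI[OF mem[of 0 0] mem[of 1 0]] p3 by simp
  then have nn: "\<not> near S w" for w using R by blast
  obtain s g where S: "S = {(i, s i, g i) | i. i < p}" and sp: "\<And>i. i < p \<Longrightarrow> s i < p"
    using param_i[OF box(1) Sp nn R(6)] by blast
  have memS: "(i, s i, g i) \<in> S" if "i < p" for i using S that by blast
  have sz: "s 0 = 0" "g 0 = 0" using S zero(1) by auto
  have c0: "c u = 0" for u
  proof (rule ccontr)
    assume "c u \<noteq> 0"
    then have far: "far C u" using farI[OF mem[OF p0, of 0] mem[OF p0, of u]] cz by simp
    have "u \<noteq> 0" using \<open>c u \<noteq> 0\<close> cz by auto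
    then obtain w' where w: "basis u w'" "far C w'" using far_second[OF far] mem[OF p0] by blast
    have ban: "g i \<noteq> v" if "far C v" "v \<noteq> 0" "i < p" for v i
    proof
      assume v: "g i = v"
      then have "i \<noteq> 0" using that sz by metis
      then have "far S v" using farI[OF memS[OF p0] memS[OF that(3)]] sz v by simp
      then show False using R that by blast
    qed
    show False
      by (rule two_directions[OF _ w(1)]) (use S ban[OF far] ban[OF w(2)] w(1) in \<open>auto simp: basis_def\<close>)
  qed
  obtain e2 e3 where b: "basis e2 e3" using basis_extend[of "Kl True False"] by (auto simp: zero_klein_def)
  define a where "a i = crt p (s i) (outside e3 (g i))" for i
  define d where "d i = int (outside e2 (g i))" for i
  have "scl (a i) e2 + scl (d i) e3 = g i" for i
    using klein_coordinates[OF b, of "g i"] by (simp add: a_def d_def crt_simps p)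
  moreover have "nat (a i mod int p) = s i" if "i < p" for i
    using that by (simp add: a_def crt_simps sp)
  ultimately have "S = {comb p e2 e3 (int i + a i * int p) (a i) (d i) | i. i < p}"
    by (intro trans[OF S] family_cong) (simp add: comb_eq)
  moreover have "C = {comb p e2 e3 (int i * int p) (int j) (int k) | i j k. i < p \<and> j < 2 \<and> k < 2}"
  proof -
    have "C = {(0, i, u) | i u. i < p}" using C c0 by simp
    also have "\<dots> = {(0, i, scl (int j) e2 + scl (int k) e3) | i j k. i < p \<and> j < 2 \<and> k < 2}"
      by (rule klein_family_times(1)[OF b])
    also have "\<dots> = {comb p e2 e3 (int i * int p) (int j) (int k) | i j k. i < p \<and> j < 2 \<and> k < 2}"
      by (rule family_cong) (simp add: comb_eq(2)[OF p0])
    finally show ?thesis .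
  qed
  ultimately show listed
    by (intro listedI[OF b] pair1[of a d]) (simp_all add: a_def d_def sz crt_simps)
qed

text \<open>
  If \<open>C\<close> lies over \<open>i = 0\<close>, then its Klein components \<open>g j\<close> are periods of \<open>S\<close>. The three cases of the list
  correspond to the order of the subgroup that they generate: 1, 2 or 4.
\<close>
lemma listed_if_card_C_eq_p_near:
  assumes Cp: "card C = p" and near: "\<And>w. \<not> far C w"
  shows listed
proof -
  have odd: "odd (card C)" and S4p: "card S = 4 * p" using Cp p p0 card_mult by (auto simp: power2_eq_square)
  note R = repelsD(1-3)[OF CS] repelsD(4-6)[OF CS odd]
  have "i = 0" if "(i, j, u) \<in> C" for i j u
    using farI[OF zero(2) that] near by auto
  then obtain g where C: "C = {(0, j, g j) | j. j < p}"
    using param_j[OF box(2) Cp _ R(6)] by blast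
  have mem: "(0, j, g j) \<in> C" if "j < p" for j using C that by blast
  have gz: "g 0 = 0" using C zero(2) by auto
  have "near C (g 0 + g 1)" using nearI[OF mem[of 0] mem[of 1]] p3 by simp
  then have "\<not> near S 0" using R by blast
  then obtain t where S: "S = {(i, t i u, u) | i u. i < p}" and tp: "\<And>i u. i < p \<Longrightarrow> t i u < p"
    using param_iu[OF box(1) S4p] by blast
  have memS: "(i, t i u, u) \<in> S" if "i < p" for i u using S that by blast
  have tz: "t 0 0 = 0" using S zero(1) by auto
  have t: "t i (u + g j) = t i u" if "i < p" "j < p" for i j u
  proof (rule ccontr)
    assume ne: "t i (u + g j) \<noteq> t i u"
    then have "g j \<noteq> 0" by auto
    then have "j \<noteq> 0" using gz by metis
    then have "near C (g j)" using nearI[OF mem[OF p0] mem[OF that(2)]] gz by simp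
    moreover have "near S (g j)"
      using nearI[OF memS[OF that(1), of u] memS[OF that(1), of "u + g j"]] ne by simp
    ultimately show False using R by blast
  qed
  have S': "S = {comb p e2 e3 (int i + int (t i (scl (int j) e2 + scl (int k) e3)) * int p) (int j) (int k) |
      i j k. i < p \<and> j < 2 \<and> k < 2}" if b: "basis e2 e3" for e2 e3
  proof -
    have "S = {(i, t i (scl (int j) e2 + scl (int k) e3), scl (int j) e2 + scl (int k) e3) |
        i j k. i < p \<and> j < 2 \<and> k < 2}"
      unfolding S by (rule klein_family_times(1)[OF b])
    also have "\<dots> = {comb p e2 e3 (int i + int (t i (scl (int j) e2 + scl (int k) e3)) * int p) (int j) (int k) |
        i j k. i < p \<and> j < 2 \<and> k < 2}"
      by (rule family_cong) (simp add: comb_eq tp)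
    finally show ?thesis .
  qed
  consider "\<And>j. j < p \<Longrightarrow> g j = 0"
    | j where "j < p" "g j \<noteq> 0" "\<And>k. k < p \<Longrightarrow> g k = 0 \<or> g k = g j"
    | j k where "j < p" "k < p" "basis (g j) (g k)"
    unfolding basis_def by blast
  then show listed
  proof cases
    case 1
    obtain e2 e3 where b: "basis e2 e3" using basis_extend[of "Kl True False"] by (auto simp: zero_klein_def)
    have "C = {comb p e2 e3 (int i * int p) 0 0 | i. i < p}"
      by (rule trans[OF C], rule family_cong) (simp add: comb_eq(2)[OF p0] 1)
    then show listed
      by (intro listedI[OF b] pair21[OF _ S'[OF b]]) (simp_all add: tz)
  next
    case (2 j)
    then obtain e3 where b: "basis (g j) e3" using basis_extend by blast
    define t0 where "t0 i k = int (t i (scl (int k) e3))" for i k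
    have "t i (scl (int k) (g j) + u) = t i u" if "i < p" for i k u
      using t[OF that 2(1), of u] by (simp add: scl_def add.commute)
    then have "S = {comb p (g j) e3 (int i + t0 i k * int p) (int j') (int k) |
        i j' k. i < p \<and> j' < 2 \<and> k < 2}"
      unfolding S'[OF b] by (intro family_cong) (simp add: t0_def)
    then have "S = {comb p (g j) e3 (int i + t0 i j' * int p) (int k) (int j') |
        i j' k. i < p \<and> j' < 2 \<and> k < 2}" by auto
    moreover have "scl (int (outside e3 (g i))) (g j) = g i" if "i < p" for i
      using 2(2) 2(3)[OF that] b by (auto simp: outside_def basis_def)
    then have "C = {comb p (g j) e3 (int i * int p) (int (outside e3 (g i))) 0 | i. i < p}"
      by (intro trans[OF C] family_cong) (simp add: comb_eq(2)[OF p0])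
    ultimately show listed
      by (intro listedI[OF b] pair17[of t0 "\<lambda>i. int (outside e3 (g i))"]) (simp_all add: gz t0_def tz)
  next
    case (3 j k)
    define t0 where "t0 i = int (t i 0)" for i
    have "t i (scl (int j') (g j) + scl (int k') (g k)) = t i 0" if "i < p" for i j' k'
      using t[OF that 3(1), of 0] t[OF that 3(2)] by (simp add: scl_def)
    then have "S = {comb p (g j) (g k) (int i + t0 i * int p) (int j') (int k') |
        i j' k'. i < p \<and> j' < 2 \<and> k' < 2}"
      unfolding S'[OF 3(3)] by (intro family_cong) (simp add: t0_def)
    moreover have "C = {comb p (g j) (g k) (int i * int p) (int (outside (g k) (g i))) (int (outside (g j) (g i))) | i. i < p}"
      by (rule trans[OF C], rule family_cong)
        (simp add: comb_eq(2)[OF p0] klein_coordinates[OF 3(3)])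
    ultimately show listed
      by (intro listedI[OF 3(3)] pair20[of t0 "\<lambda>i. int (outside (g k) (g i))" "\<lambda>i. int (outside (g j) (g i))"])
        (simp_all add: gz t0_def tz)
  qed
qed

text \<open>
  Now \<open>S\<close> consists of four cosets of the subgroup of order \<open>p\<close>, at positions \<open>c u\<close>, and again the Klein
  components of \<open>C\<close> are periods of \<open>c\<close>. They do not generate the Klein group, because then \<open>S\<close> would lie
  over \<open>i = 0\<close>.
\<close>
lemma listed_if_card_C_eq_p_far:
  assumes Cp: "card C = p" and far: "far C w"
  shows listed
proof -
  have odd: "odd (card C)" and S4p: "card S = 4 * p" using Cp p p0 card_mult by (auto simp: power2_eq_square)
  note R = repelsD(1-3)[OF CS] repelsD(4-6)[OF CS odd]
  have "\<not> far S 0" using R far by blast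
  then obtain c where S: "S = {(c u, j, u) | j u. j < p}" and cp: "c u < p" for u
    using param_ju[OF box(1) S4p _ p0] by blast
  have memS: "(c u, j, u) \<in> S" if "j < p" for j u using S that by blast
  have cz: "c 0 = 0" using S zero(1) by auto
  have "near S 0" using nearI[OF memS[of 0 0] memS[of 1 0]] p3 by simp
  then have nn: "\<not> near C w" for w using R by blast
  obtain s g where C: "C = {(i, s i, g i) | i. i < p}" and sp: "\<And>i. i < p \<Longrightarrow> s i < p"
    using param_i[OF box(2) Cp nn R(6)] by blast
  have mem: "(i, s i, g i) \<in> C" if "i < p" for i using C that by blast
  have sz: "s 0 = 0" "g 0 = 0" using C zero(2) by auto
  have c: "c (u + g i) = c u" if "i < p" for i u
  proof (rule ccontr)
    assume ne: "c (u + g i) \<noteq> c u"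
    then have "g i \<noteq> 0" by auto
    then have "i \<noteq> 0" using sz by metis
    then have "far C (g i)" using farI[OF mem[OF p0] mem[OF that]] sz by simp
    moreover have "far S (g i)" using farI[OF memS[OF p0, of u] memS[OF p0, of "u + g i"]] ne by simp
    ultimately show False using R by blast
  qed
  have S': "S = {comb p e2 e3 (int (c (scl (int i) e2 + scl (int j) e3)) + int k * int p) (int i) (int j) |
      i j k. i < 2 \<and> j < 2 \<and> k < p}" if b: "basis e2 e3" for e2 e3
  proof -
    have "S = {(c (scl (int i) e2 + scl (int j) e3), k, scl (int i) e2 + scl (int j) e3) |
        i j k. i < 2 \<and> j < 2 \<and> k < p}"
      unfolding S by (rule klein_family_times(2)[OF b])
    also have "\<dots> = {comb p e2 e3 (int (c (scl (int i) e2 + scl (int j) e3)) + int k * int p) (int i) (int j) |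
        i j k. i < 2 \<and> j < 2 \<and> k < p}"
      by (rule family_cong) (simp add: comb_eq cp)
    finally show ?thesis .
  qed
  consider "\<And>j. j < p \<Longrightarrow> g j = 0"
    | j where "j < p" "g j \<noteq> 0" "\<And>k. k < p \<Longrightarrow> g k = 0 \<or> g k = g j"
    | j k where "j < p" "k < p" "basis (g j) (g k)"
    unfolding basis_def by blast
  then show listed
  proof cases
    case 1
    obtain e2 e3 where b: "basis e2 e3" using basis_extend[of "Kl True False"] by (auto simp: zero_klein_def)
    have "C = {comb p e2 e3 (int i + int (s i) * int p) 0 0 | i. i < p}"
      by (rule trans[OF C], rule family_cong) (simp add: comb_eq sp 1)
    then show listed
      by (intro listedI[OF b] pair18[of "\<lambda>i j. int (c (scl (int i) e2 + scl (int j) e3))" "\<lambda>i. int (s i)"] S'[OF b])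
        (simp_all add: cz sz)
  next
    case (2 j)
    then obtain e3 where b: "basis (g j) e3" using basis_extend by blast
    define c0 where "c0 k = int (c (scl (int k) e3))" for k
    have "c (scl (int k) (g j) + u) = c u" for k u
      using c[OF 2(1), of u] by (simp add: scl_def add.commute)
    then have "S = {comb p (g j) e3 (c0 i + int k * int p) (int j') (int i) |
        j' i k. j' < 2 \<and> i < 2 \<and> k < p}"
      unfolding S'[OF b] by (intro family_cong) (simp add: c0_def)
    then have "S = {comb p (g j) e3 (c0 i + int j' * int p) (int k) (int i) |
        i j' k. i < 2 \<and> j' < p \<and> k < 2}" by auto
    moreover define l where "l i = crt p (s i) (outside e3 (g i))" for i
    moreover have "scl (int (outside e3 (g i))) (g j) = g i" if "i < p" for i
      using 2(2) 2(3)[OF that] b by (auto simp: outside_def basis_def)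
    then have "C = {comb p (g j) e3 (int i + l i * int p) (l i) 0 | i. i < p}"
      by (intro trans[OF C] family_cong) (simp add: l_def comb_eq crt_simps sp p)
    ultimately show listed
      by (intro listedI[OF b] pair19[of c0 l]) (simp_all add: sz c0_def cz crt_simps)
  next
    case (3 j k)
    have "c u = 0" for u
    proof -
      have "c (scl (int j') (g j) + scl (int k') (g k)) = c 0" for j' k'
        using c[OF 3(1), of 0] c[OF 3(2)] by (simp add: scl_def)
      then show ?thesis using klein_coordinates[OF 3(3), of u] cz by metis
    qed
    then show ?thesis using spread S by auto
  qed
qed

text \<open>
  The nonzero element \<open>(a, b, w)\<close> of \<open>C\<close> is a difference that \<open>S\<close> avoids together with all its odd
  multiples. If \<open>a\<close> were not 0, no two Klein components of \<open>S\<close> would differ by \<open>w\<close>, but \<open>S\<close> has three of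
  them. So in each coset of \<open>{0, w}\<close> the set \<open>S\<close> has one point over each cyclic component, and for
  \<open>b \<noteq> 0\<close> its Klein component does not depend on \<open>j\<close>.
\<close>
lemma listed_if_card_C_eq_2:
  assumes C2: "card C = 2"
  shows listed
proof -
  have four: "card C dvd 4" and S2: "card S = 2 * p\<^sup>2" using C2 card_mult by auto
  note R = repelsD(1-3)[OF CS] repelsD(7-)[OF CS four]
  obtain x where "C = {(0, 0, 0), x}" "x \<noteq> (0, 0, 0)"
    using C2 zero(2) by (auto simp: card_2_iff)
  then obtain a b w where C: "C = {(0, 0, 0), (a, b, w)}" "(a, b, w) \<noteq> (0, 0, 0)" by (cases x) auto
  have bp: "b < p" using C box(2) by auto
  have mem: "(a, b, w) \<in> C" using C by simp
  have w: "w \<noteq> 0"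
    using R(4,7)[of w] farI[OF zero(2) mem] nearI[OF zero(2), of b w] mem C(2)
    by (cases "a = 0"; cases "b = 0") auto
  have a: "a = 0"
  proof (rule ccontr)
    assume "a \<noteq> 0"
    then have "far C w" using farI[OF zero(2) mem] by simp
    then have no: "\<not> far S w" "\<not> near S w" "\<not> vert S w" using R by blast+
    have diff: "u + u' \<noteq> w" if "(i, j, u) \<in> S" "(i', j', u') \<in> S" for i j u i' j' u'
      using no farI[OF that] nearI[of i j u S j' u'] vertI[of i j u S u'] that
      by (cases "i = i'"; cases "j = j'") auto
    obtain i j u where u: "(i, j, u) \<in> S" "u \<noteq> 0" "u \<noteq> w" using spread_klein by blast
    then have b: "basis w u" using w by (auto simp: basis_def)
    obtain i' j' u' where u': "(i', j', u') \<in> S" "u' \<noteq> 0" "u' \<noteq> u" using spread_klein by blast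
    have "u' = w \<or> u' = w + u" using klein_cases[OF b, of u'] u' by blast
    then show False using diff[OF zero(1) u'(1)] diff[OF u(1) u'(1)] by (auto simp: add_ac)
  qed
  have vert: "v = 0" if "vert S v" "v = w" for v
    using R(3)[of w] R(8)[of w] nearI[OF zero(2), of b w] vertI[OF zero(2), of w] mem a that
    by (cases "b = 0") auto
  obtain e3 where b: "basis w e3" using basis_extend[OF w] by blast
  have "inj_on (\<lambda>(i, j, u). (i, j, outside w u)) S"
  proof (rule inj_onI)
    fix x y assume xy: "x \<in> S" "y \<in> S" "(\<lambda>(i, j, u). (i, j, outside w u)) x = (\<lambda>(i, j, u). (i, j, outside w u)) y"
    obtain i j u i' j' u' where [simp]: "x = (i, j, u)" "y = (i', j', u')"
      by (metis prod.collapse)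
    show "x = y" using xy vertI[of i j u S u'] vert w by (auto simp: outside_eq_iff[OF w])
  qed
  moreover have "(\<lambda>(i, j, u). (i, j, outside w u)) ` S \<subseteq> {..<p} \<times> {..<p} \<times> {..<2}"
    using box(1) by (auto simp: outside_less)
  moreover have "card S = card ({..<p} \<times> {..<p} \<times> {..<2 :: nat})"
    using S2 by (simp add: card_cartesian_product power2_eq_square)
  ultimately obtain e where e: "S = {e k | k. k \<in> {..<p} \<times> {..<p} \<times> {..<2}}"
    "\<forall>k \<in> {..<p} \<times> {..<p} \<times> {..<2}. (\<lambda>(i, j, u). (i, j, outside w u)) (e k) = k"
    using exists_parametrization[of _ S "{..<p} \<times> {..<p} \<times> {..<2}"] by blast
  define U where "U i j k = snd (snd (e (i, j, k)))" for i j and k :: nat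
  have eU: "e (i, j, k) = (i, j, U i j k)" "outside w (U i j k) = k" if "i < p" "j < p" "k < 2" for i j k
    using e(2) that by (auto simp: U_def prod_eq_iff case_prod_unfold)
  have "S = {e (i, j, k) | i j k. i < p \<and> j < p \<and> k < 2}" unfolding e(1) by auto
  also have "\<dots> = {(i, j, U i j k) | i j k. i < p \<and> j < p \<and> k < 2}"
    by (rule family_cong) (simp add: eU)
  finally have S: "S = {(i, j, U i j k) | i j k. i < p \<and> j < p \<and> k < 2}" .
  have memS: "(i, j, U i j k) \<in> S" if "i < p" "j < p" "k < 2" for i j k using S that by blast
  obtain k where "k < 2" "U 0 0 k = 0" using S zero(1) by auto
  then have Uz: "U 0 0 0 = 0" using eU(2)[OF p0 p0, of k] by simp
  define h where "h i j k = int (outside e3 (U i j k))" for i j k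
  have hz: "h 0 0 0 = 0" by (simp add: h_def Uz)
  have hU: "scl (h i j k) w + scl (int k) e3 = U i j k" if "i < p" "j < p" "k < 2" for i j k
    using klein_coordinates[OF b, of "U i j k"] eU(2)[OF that] by (simp add: h_def)
  show listed
  proof (cases "b = 0")
    case True
    have "S = {comb p w e3 (int n) (h (n mod p) (n div p) k) (int k) | n k. n < p\<^sup>2 \<and> k < 2}"
      unfolding S family_div_mod_times[OF p0]
      by (rule family_cong)
        (simp add: comb_eq_div_mod p0 div_less_iff_less_mult power2_eq_square flip: hU)
    moreover have "C = {comb p w e3 0 (int i) 0 | i. i < 2}"
      using C a True unfolding family_less_2 by (simp add: comb_eq(3)[OF p0])
    ultimately show listed
      by (intro listedI[OF b] pair16[of "\<lambda>n k. h (n mod p) (n div p) k"]) (simp_all add: hz)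
  next
    case False
    then have "near C w" using nearI[OF zero(2), of b w] mem a by simp
    then have nn: "\<not> near S w" using R by blast
    define h0 where "h0 i k = h i 0 k" for i k
    have h0: "h i j k = h0 i k" if "i < p" "j < p" "k < 2" for i j k
    proof -
      have "U i 0 k = U i j k \<or> U i 0 k + U i j k = w"
        using eU(2)[OF that] eU(2)[OF that(1) p0 that(3)] outside_eq_iff[OF w] by metis
      then have "U i 0 k = U i j k"
        using nn nearI[OF memS[OF that(1) p0 that(3)], of j "U i j k"] memS[OF that] by (cases "j = 0") auto
      then show ?thesis by (simp add: h_def h0_def)
    qed
    have "S = {comb p w e3 (int i + int j * int p) (h0 i k) (int k) | i j k. i < p \<and> j < p \<and> k < 2}"
      by (rule trans[OF S], rule family_cong) (simp add: comb_eq h0 flip: hU)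
    then have "S = {comb p w e3 (int i + int k * int p) (h0 i j) (int j) | i j k. i < p \<and> j < 2 \<and> k < p}"
      by auto
    moreover define l where "l i = (if i = 0 then 0 else int b)" for i :: nat
    moreover have "C = {comb p w e3 (l i * int p) (int i) 0 | i. i < 2}"
      using C a bp unfolding family_less_2 l_def by (simp add: comb_eq(2,3)[OF p0])
    ultimately show listed
      by (intro listedI[OF b] pair14[of h0 l]) (simp_all add: hz h0_def)
  qed
qed

end

section \<open>Two factors of order 2p\<close>

text \<open>
  Keys with a cyclic coordinate and a coset of \<open>{0, e}\<close>, as needed for factors of order \<open>2 p\<close>.
\<close>
lemma param_i_outside:
  assumes X: "X \<subseteq> box p" "card X = 2 * p" and e: "e \<noteq> 0"
    and inj: "\<And>i j u j' u'. (i, j, u) \<in> X \<Longrightarrow> (i, j', u') \<in> X \<Longrightarrow> u = u' \<or> u + u' = e \<Longrightarrow>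
      j = j' \<and> u = u'"
  shows "\<exists>J U. X = {(i, J i k, U i k) | i k. i < p \<and> k < 2} \<and>
    (\<forall>i < p. \<forall>k < 2. J i k < p \<and> outside e (U i k) = k)"
proof -
  let ?key = "\<lambda>(i, j, u). (i, outside e u)"
  have "inj_on ?key X"
  proof (rule inj_onI)
    fix x y assume xy: "x \<in> X" "y \<in> X" "?key x = ?key y"
    obtain i j u i' j' u' where [simp]: "x = (i, j, u)" "y = (i', j', u')"
      by (metis prod.collapse)
    show "x = y" using xy inj[of i j u j' u'] by (auto simp: outside_eq_iff[OF e])
  qed
  moreover have "?key ` X \<subseteq> {..<p} \<times> {..<2}"
    using X(1) by (auto simp: outside_less)
  moreover have "card X = card ({..<p} \<times> {..<2 :: nat})"
    using X(2) by (simp add: card_cartesian_product)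
  ultimately obtain f where f: "X = {f k | k. k \<in> {..<p} \<times> {..<2}}"
    "\<forall>k \<in> {..<p} \<times> {..<2}. ?key (f k) = k"
    using exists_parametrization[of _ X "{..<p} \<times> {..<2}"] by blast
  define J U where "J i k = fst (snd (f (i, k)))" and "U i k = snd (snd (f (i, k)))" for i and k :: nat
  have fk: "f (i, k) = (i, J i k, U i k)" "outside e (U i k) = k" if "i < p" "k < 2" for i k
    using f(2) that by (auto simp: J_def U_def prod_eq_iff case_prod_unfold)
  have "X = {f (i, k) | i k. i < p \<and> k < 2}" unfolding f(1) by auto
  also have "\<dots> = {(i, J i k, U i k) | i k. i < p \<and> k < 2}"
    by (rule family_cong) (simp add: fk)
  finally have "X = {(i, J i k, U i k) | i k. i < p \<and> k < 2}" .
  moreover from this have "(i, J i k, U i k) \<in> box p" if "i < p" "k < 2" for i k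
    using X(1) that by blast
  then have "J i k < p" if "i < p" "k < 2" for i k using that by simp
  ultimately show ?thesis using fk(2) by blast
qed

lemma param_j_outside:
  assumes X: "X \<subseteq> box p" "card X = 2 * p" and e: "e \<noteq> 0"
    and inj: "\<And>i j u i' u'. (i, j, u) \<in> X \<Longrightarrow> (i', j, u') \<in> X \<Longrightarrow> u = u' \<or> u + u' = e \<Longrightarrow>
      i = i' \<and> u = u'"
  shows "\<exists>I U. X = {(I j k, j, U j k) | j k. j < p \<and> k < 2} \<and>
    (\<forall>j < p. \<forall>k < 2. I j k < p \<and> outside e (U j k) = k)"
proof -
  let ?sw = "\<lambda>(i, j, u). (j, i, u)"
  let ?Y = "?sw ` X"
  have mem: "(j, i, u) \<in> ?Y \<longleftrightarrow> (i, j, u) \<in> X" for i j u by force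
  have "inj_on ?sw X" by (auto simp: inj_on_def)
  then have "card ?Y = 2 * p" using X(2) by (simp add: card_image)
  moreover have "?Y \<subseteq> box p" using X(1) by auto
  moreover have "i = i' \<and> u = u'"
    if "(j, i, u) \<in> ?Y" "(j, i', u') \<in> ?Y" "u = u' \<or> u + u' = e" for i j u i' u'
    using that inj[of i j u i' u'] unfolding mem by blast
  ultimately obtain I U where I: "?Y = {(j, I j k, U j k) | j k. j < p \<and> k < 2}"
    "\<forall>j < p. \<forall>k < 2. I j k < p \<and> outside e (U j k) = k"
    using param_i_outside[of ?Y p e] e by blast
  have "X = ?sw ` ?Y" by (force simp: image_image)
  also have "\<dots> = {(I j k, j, U j k) | j k. j < p \<and> k < 2}" unfolding I(1) by force
  finally show ?thesis using I(2) by blast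
qed

lemma card_le_4:
  assumes "X \<subseteq> box p" "\<not> near X 0" "\<not> far X 0"
  shows "card X \<le> 4"
proof -
  have "inj_on (\<lambda>(i, j, u). u) X"
  proof (rule inj_onI)
    fix x y assume xy: "x \<in> X" "y \<in> X" "(\<lambda>(i, j, u). u) x = (\<lambda>(i, j, u). u) y"
    obtain i j u i' j' u' where [simp]: "x = (i, j, u)" "y = (i', j', u')"
      by (metis prod.collapse)
    have "i = i'" using xy assms(3) farI[of i j u X i' j' u'] by auto
    moreover from this have "j = j'" using xy assms(2) nearI[of i j u X j' u'] by auto
    ultimately show "x = y" using xy by simp
  qed
  then show ?thesis using card_inj_on_le[of "\<lambda>(i, j, u). u" X UNIV] by simp
qed

definition slice :: "point set \<Rightarrow> klein \<Rightarrow> point set" where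
  "slice X u = {x \<in> X. snd (snd x) = u}"

lemma card_slice_le:
  assumes "X \<subseteq> box p" "\<not> near X 0 \<or> \<not> far X 0"
  shows "card (slice X u) \<le> p"
  using assms(2)
proof
  assume nn: "\<not> near X 0"
  have "inj_on fst (slice X u)"
  proof (rule inj_onI)
    fix x y assume xy: "x \<in> slice X u" "y \<in> slice X u" "fst x = fst y"
    obtain i j j' where [simp]: "x = (i, j, u)" "y = (i, j', u)"
      using xy by (auto simp: slice_def) (metis prod.collapse)
    show "x = y" using xy nn nearI[of i j u X j' u] by (auto simp: slice_def)
  qed
  moreover have "fst ` slice X u \<subseteq> {..<p}" using assms(1) by (auto simp: slice_def)
  ultimately show ?thesis using card_inj_on_le[of fst "slice X u" "{..<p}"] by simp
next
  assume nf: "\<not> far X 0"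
  have "inj_on (\<lambda>x. fst (snd x)) (slice X u)"
  proof (rule inj_onI)
    fix x y assume xy: "x \<in> slice X u" "y \<in> slice X u" "fst (snd x) = fst (snd y)"
    obtain i j i' where [simp]: "x = (i, j, u)" "y = (i', j, u)"
      using xy by (auto simp: slice_def) (metis prod.collapse)
    show "x = y" using xy nf farI[of i j u X i' j u] by (auto simp: slice_def)
  qed
  moreover have "(\<lambda>x. fst (snd x)) ` slice X u \<subseteq> {..<p}" using assms(1) by (auto simp: slice_def)
  ultimately show ?thesis using card_inj_on_le[of _ "slice X u" "{..<p}"] by simp
qed

text \<open>
  The Klein group splits into two cosets of \<open>{0, w}\<close>. In each of them \<open>X\<close> either has points with
  only one Klein component, hence at most \<open>p\<close> points, or at most two points altogether. As \<open>X\<close> has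
  \<open>2 p > p + 2\<close> points, the second case does not occur, and two Klein components remain.
\<close>
lemma confined_to_two_slices:
  assumes X: "X \<subseteq> box p" "card X = 2 * p" "2 < p" "(0, 0, 0) \<in> X" and w: "w \<noteq> 0"
    and slices: "\<not> near X 0 \<or> \<not> far X 0"
    and single: "\<And>i j u i' j' i'' j''. (i, j, u) \<in> X \<Longrightarrow> (i', j', u) \<in> X \<Longrightarrow> (i'', j'', u + w) \<in> X \<Longrightarrow>
      i = i' \<and> j = j'"
  shows "\<exists>e. basis w e \<and> (\<forall>i j u. (i, j, u) \<in> X \<longrightarrow> u = 0 \<or> u = e)"
proof -
  have fin: "finite X" using finite_subset[OF X(1)] by simp
  obtain v where v: "basis w v" using basis_extend[OF w] by blast
  have small: "card (slice X u \<union> slice X (u + w)) \<le> p \<and>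
      (card (slice X u \<union> slice X (u + w)) = p \<longrightarrow> slice X u = {} \<or> slice X (u + w) = {})" for u
  proof (cases "slice X u = {} \<or> slice X (u + w) = {}")
    case True
    then show ?thesis using card_slice_le[OF X(1) slices] by auto
  next
    case False
    then obtain i j i' j' where ij: "(i, j, u) \<in> X" "(i', j', u + w) \<in> X"
      by (auto simp: slice_def)
    have "slice X u \<subseteq> {(i, j, u)}"
      using single[OF ij(1) _ ij(2)] by (auto simp: slice_def)
    moreover have "slice X (u + w) \<subseteq> {(i', j', u + w)}"
      using single[OF ij(2), of _ _ i j] ij(1) by (auto simp: slice_def add.assoc)
    ultimately have "slice X u \<union> slice X (u + w) \<subseteq> {(i, j, u), (i', j', u + w)}" by blast
    then have "card (slice X u \<union> slice X (u + w)) \<le> card {(i, j, u), (i', j', u + w)}"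
      by (intro card_mono) auto
    also have "\<dots> \<le> 2" by (simp add: card_insert_if)
    finally show ?thesis using X(3) by linarith
  qed
  let ?A = "slice X 0 \<union> slice X (0 + w)" and ?B = "slice X v \<union> slice X (v + w)"
  have "X = ?A \<union> ?B"
    using klein_cases[OF v] by (force simp: slice_def add.commute)
  moreover have "?A \<inter> ?B = {}" using v by (auto simp: slice_def basis_def)
  moreover have "finite ?A" "finite ?B" using fin by (auto simp: slice_def)
  ultimately have "card ?A + card ?B = 2 * p" using X(2) card_Un_disjoint by metis
  then have cards: "card ?A = p" "card ?B = p" using small[of 0] small[of v] by linarith+
  have "slice X 0 \<noteq> {}" using X(4) by (auto simp: slice_def)
  then have w0: "slice X w = {}" using small[of 0] cards(1) by auto
  have "slice X v = {} \<or> slice X (v + w) = {}" using small[of v] cards(2) by blast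
  then obtain e where e: "basis w e" "slice X (w + e) = {}"
  proof
    assume "slice X v = {}"
    moreover have "w + (w + v) = v" by simp
    ultimately show thesis using that[OF basis_add(2)[OF v]] by simp
  next
    assume "slice X (v + w) = {}"
    then show thesis using that[OF v] by (simp add: add.commute)
  qed
  have "x \<notin> X \<or> snd (snd x) \<noteq> w" "x \<notin> X \<or> snd (snd x) \<noteq> w + e" for x
    using w0 e(2) unfolding slice_def by blast+
  from this(1)[of "(i, j, w)" for i j] this(2)[of "(i, j, w + e)" for i j]
  have "(i, j, w) \<notin> X" "(i, j, w + e) \<notin> X" for i j by simp_all
  then have "u = 0 \<or> u = e" if "(i, j, u) \<in> X" for i j u
    using that by (cases u rule: klein_cases[OF e(1)]) blast+
  then show ?thesis using e(1) by blast
qed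

context code_pair begin

lemma card_C_2p:
  assumes "card S = 2 * p"
  shows "card C = 2 * p"
  using assms card_mult p0 by (simp add: power2_eq_square)

text \<open>
  All of \<open>C\<close> lies over \<open>i = 0\<close>, so it is large enough to contain 0 as a near type. If \<open>S\<close> also has a near type
  \<open>w\<close>, the previous lemma leaves only one possibility for \<open>C\<close>: the subgroup of order \<open>2 p\<close> generated by
  the element of order \<open>p\<close> and some \<open>e2\<close>. Then \<open>S\<close> is any transversal of its cosets.
\<close>
lemma listed_if_near_S:
  assumes S2p: "card S = 2 * p" and nfar: "\<And>w. \<not> far C w" and near: "near S w"
  shows listed
proof -
  note C2p = card_C_2p[OF S2p]
  note R = repelsD(1-3)[OF SC]
  have i0: "i = 0" if "(i, j, u) \<in> C" for i j u
    using farI[OF zero(2) that] nfar by auto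
  have "near C 0"
    using card_le_4[OF box(2)] nfar C2p p3 by (cases "near C 0") auto
  then have nS0: "\<not> near S 0" using R by blast
  have nC: "\<not> near C w" using R near by blast
  have w: "w \<noteq> 0" using near nS0 by blast
  have "\<exists>e. basis w e \<and> (\<forall>i j u. (i, j, u) \<in> C \<longrightarrow> u = 0 \<or> u = e)"
  proof (rule confined_to_two_slices[OF box(2) C2p p3 zero(2) w])
    show "\<not> near C 0 \<or> \<not> far C 0" using nfar by blast
    fix i j u i' j' i'' j'' assume x: "(i, j, u) \<in> C" "(i', j', u) \<in> C" "(i'', j'', u + w) \<in> C"
    then have "i = 0" "i' = 0" "i'' = 0" using i0 by blast+
    then show "i = i' \<and> j = j'"
      using x nC nearI[of 0 j u C j'' "u + w"] nearI[of 0 j' u C j'' "u + w"]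
      by (cases "j = j''"; cases "j' = j''") auto
  qed
  then obtain e2 where e2: "basis w e2" "\<And>i j u. (i, j, u) \<in> C \<Longrightarrow> u = 0 \<or> u = e2" by blast
  have b: "basis e2 w" using e2(1) basis_swap by blast
  have e2z: "e2 \<noteq> 0" using b by (simp add: basis_def)
  have "C \<subseteq> {0} \<times> {..<p} \<times> {0, e2}"
  proof
    fix x assume x: "x \<in> C"
    obtain i j u where [simp]: "x = (i, j, u)" by (metis prod.collapse)
    show "x \<in> {0} \<times> {..<p} \<times> {0, e2}" using x box(2) i0[of i j u] e2(2)[of i j u] by auto
  qed
  then have C: "C = {0} \<times> {..<p} \<times> {0, e2}"
    by (intro card_subset_eq) (use C2p e2z in \<open>auto simp: card_cartesian_product\<close>)
  have p1: "1 < p" using p3 by simp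
  have "near C e2" using nearI[of 0 0 0 C 1 e2] C p1 by simp
  then have nS: "\<not> near S e2" using R by blast
  have "vert C e2" using vertI[of 0 0 0 C e2] C p1 by simp
  then have vS: "\<not> vert S e2" using R e2z by blast
  have key: "j = j' \<and> u = u'" if "(i, j, u) \<in> S" "(i, j', u') \<in> S" "u = u' \<or> u + u' = e2" for i j u j' u'
    using that nS nS0 vS nearI[of i j u S j' u'] vertI[of i j u S u'] by (cases "j = j'") auto
  have "\<exists>J U. S = {(i, J i k, U i k) | i k. i < p \<and> k < 2} \<and>
      (\<forall>i < p. \<forall>k < 2. J i k < p \<and> outside e2 (U i k) = k)"
    by (rule param_i_outside[OF box(1) S2p e2z]) (rule key)
  then obtain J U where S: "S = {(i, J i k, U i k) | i k. i < p \<and> k < 2}"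
    and JU: "\<And>i k. i < p \<Longrightarrow> k < 2 \<Longrightarrow> J i k < p \<and> outside e2 (U i k) = k" by blast
  obtain k where "k < 2" "J 0 k = 0" "U 0 k = 0" using S zero(1) by auto
  then have z: "J 0 0 = 0" "U 0 0 = 0" using JU[OF p0, of k] by auto
  define a where "a i k = crt p (J i k) (outside w (U i k))" for i k
  have "scl (a i k) e2 + scl (int k) w = U i k" if "i < p" "k < 2" for i k
    using klein_coordinates[OF b, of "U i k"] JU[OF that] by (simp add: a_def crt_simps p)
  moreover have "nat (a i k mod int p) = J i k" if "i < p" "k < 2" for i k
    using JU[OF that] by (simp add: a_def crt_simps)
  ultimately have S': "S = {comb p e2 w (int i + a i k * int p) (a i k) (int k) | i k. i < p \<and> k < 2}"
    by (intro trans[OF S] family_cong) (simp add: comb_eq)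
  have "C = {(0, i, scl (int k) e2) | i k. i < p \<and> k < 2}"
    unfolding C by (force simp: less_2_cases_iff)
  also have "\<dots> = {comb p e2 w (int i * int p) (int k) 0 | i k. i < p \<and> k < 2}"
    by (rule family_cong) (simp add: comb_eq(2)[OF p0])
  finally have C': "C = {comb p e2 w (int i * int p) (int k) 0 | i k. i < p \<and> k < 2}" .
  show listed
    by (rule listedI[OF b], rule pair9[of a, OF _ S' C']) (simp add: a_def z crt_simps)
qed

text \<open>
  Without near types, all points of \<open>S\<close> over the same \<open>i\<close> have the same \<open>j\<close>, and only vertical types are left to
  distinguish cases. There is one by counting. If there is only one, both factors are determined up to
  independent choices; if there are two, \<open>C\<close> can have the third direction only.
\<close>
lemma listed_if_not_near_S:
  assumes S2p: "card S = 2 * p" and nfar: "\<And>w. \<not> far C w" and near: "\<And>w. \<not> near S w"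
  shows listed
proof -
  note C2p = card_C_2p[OF S2p]
  note R = repelsD(1-3)[OF SC]
  have i0: "i = 0" if "(i, j, u) \<in> C" for i j u
    using farI[OF zero(2) that] nfar by auto
  have j: "j = j'" if "(i, j, u) \<in> S" "(i, j', u') \<in> S" for i j u j' u'
    using nearI[OF that] near by blast
  have "\<exists>w. vert S w \<and> w \<noteq> 0"
  proof (rule ccontr)
    assume "\<not> ?thesis"
    then have "inj_on fst S"
      by (intro inj_onI) (metis j klein_add_eq_0_iff prod.collapse vertI)
    moreover have "fst ` S \<subseteq> {..<p}" using box(1) by force
    ultimately have "card S \<le> p" using card_inj_on_le[of fst S "{..<p}"] by simp
    then show False using S2p p0 by simp
  qed
  then obtain w where w: "vert S w" "w \<noteq> 0" by blast
  show listed
  proof (cases "\<exists>w'. vert S w' \<and> basis w w'")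
    case False
    then have only: "v = w" if "vert S v" "v \<noteq> 0" for v
      using that w(2) by (auto simp: basis_def)
    obtain e3 where b: "basis w e3" using basis_extend[OF w(2)] by blast
    then have e3z: "e3 \<noteq> 0" by (simp add: basis_def)
    have keyS: "j = j' \<and> u = u'" if "(i, j, u) \<in> S" "(i, j', u') \<in> S" "u = u' \<or> u + u' = e3" for i j u j' u'
    proof -
      have "j = j'" using j that by blast
      moreover have "u + u' \<noteq> e3"
        using vertI[of i j u S u'] that(1,2) only[of e3] b calculation by (auto simp: basis_def)
      ultimately show ?thesis using that(3) by blast
    qed
    have "\<exists>J U. S = {(i, J i k, U i k) | i k. i < p \<and> k < 2} \<and>
        (\<forall>i < p. \<forall>k < 2. J i k < p \<and> outside e3 (U i k) = k)"
      by (rule param_i_outside[OF box(1) S2p e3z]) (rule keyS)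
    then obtain J U where S: "S = {(i, J i k, U i k) | i k. i < p \<and> k < 2}"
      and JU: "\<And>i k. i < p \<Longrightarrow> k < 2 \<Longrightarrow> J i k < p \<and> outside e3 (U i k) = k" by blast
    obtain k where "k < 2" "J 0 k = 0" "U 0 k = 0" using S zero(1) by auto
    then have z: "J 0 0 = 0" "U 0 0 = 0" using JU[OF p0, of k] by auto
    have "\<not> vert C w" using R w by blast
    then have keyC: "i = i' \<and> u = u'" if "(i, j, u) \<in> C" "(i', j, u') \<in> C" "u = u' \<or> u + u' = w" for i j u i' u'
      using that i0[OF that(1)] i0[OF that(2)] vertI[of i j u C u'] by auto
    have "\<exists>I T. C = {(I j k, j, T j k) | j k. j < p \<and> k < 2} \<and>
        (\<forall>j < p. \<forall>k < 2. I j k < p \<and> outside w (T j k) = k)"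
      by (rule param_j_outside[OF box(2) C2p w(2)]) (rule keyC)
    then obtain I T where C: "C = {(I j k, j, T j k) | j k. j < p \<and> k < 2}"
      and IT: "\<And>j k. j < p \<Longrightarrow> k < 2 \<Longrightarrow> I j k < p \<and> outside w (T j k) = k" by blast
    have I: "I j k = 0" if "j < p" "k < 2" for j k using C that i0 by blast
    obtain k' where "k' < 2" "T 0 k' = 0" using C zero(2) by auto
    then have Tz: "T 0 0 = 0" using IT[OF p0, of k'] by auto
    define a where "a i = crt p (J i 0) (outside w (U i 0))" for i
    have mem: "(i, J i k, U i k) \<in> S" if "i < p" "k < 2" for i k using S that by blast
    have U: "scl (int k) w + scl (a i) e3 = U i k" "nat (a i mod int p) = J i k" if "i < p" "k < 2" for i k
    proof -
      have "J i k = J i 0" using j[OF mem[OF that] mem[OF that(1), of 0]] by simp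
      then show "nat (a i mod int p) = J i k" using JU[OF that] by (simp add: a_def crt_simps)
      have "vert S (U i 0 + U i k)"
        using vertI[of i "J i 0" "U i 0" S "U i k"] mem[OF that] mem[of i 0] that \<open>J i k = J i 0\<close> by auto
      then have "outside w (U i 0) = outside w (U i k)"
        using only[of "U i 0 + U i k"] by (auto simp: outside_eq_iff[OF w(2)])
      then show "scl (int k) w + scl (a i) e3 = U i k"
        using klein_coordinates[OF b, of "U i k"] JU[OF that] by (simp add: a_def crt_simps p)
    qed
    have S': "S = {comb p w e3 (int i + a i * int p) (int k) (a i) | i k. i < p \<and> k < 2}"
      by (rule trans[OF S], rule family_cong) (simp add: comb_eq U)
    have "scl (int (outside e3 (T j k))) w + scl (int k) e3 = T j k" if "j < p" "k < 2" for j k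
      using klein_coordinates[OF b, of "T j k"] IT[OF that] by simp
    then have C': "C = {comb p w e3 (int i * int p) (int (outside e3 (T i k))) (int k) | i k. i < p \<and> k < 2}"
      by (intro trans[OF C] family_cong) (simp add: comb_eq(2)[OF p0] I)
    show listed
      by (intro listedI[OF b] pair5[of a "\<lambda>i k. int (outside e3 (T i k))"] S' C')
        (simp_all add: a_def z Tz crt_simps)
  next
    case True
    then obtain w' where w': "vert S w'" "basis w w'" by blast
    define e2 where "e2 = w + w'"
    have b: "basis e2 w" using basis_add(1)[of w' w] w'(2) basis_swap by (auto simp: e2_def add.commute)
    have e2z: "e2 \<noteq> 0" using b by (simp add: basis_def)
    have "w' \<noteq> 0" using w'(2) by (simp add: basis_def)
    then have vC: "v = e2" if "vert C v" "v \<noteq> 0" for v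
      using R(3)[of v] w w'(1) that by (cases v rule: klein_cases[OF w'(2)]) (auto simp: e2_def)
    have keyC: "i = i' \<and> u = u'" if "(i, j, u) \<in> C" "(i', j, u') \<in> C" "u = u' \<or> u + u' = w" for i j u i' u'
      using that i0[OF that(1)] i0[OF that(2)] vertI[of i j u C u'] vC[of w] b by (auto simp: basis_def)
    have "\<exists>I T. C = {(I j k, j, T j k) | j k. j < p \<and> k < 2} \<and>
        (\<forall>j < p. \<forall>k < 2. I j k < p \<and> outside w (T j k) = k)"
      by (rule param_j_outside[OF box(2) C2p w(2)]) (rule keyC)
    then obtain I T where C: "C = {(I j k, j, T j k) | j k. j < p \<and> k < 2}"
      and IT: "\<And>j k. j < p \<Longrightarrow> k < 2 \<Longrightarrow> I j k < p \<and> outside w (T j k) = k" by blast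
    have I: "I j k = 0" if "j < p" "k < 2" for j k using C that i0 by blast
    have memC: "(0, j, T j k) \<in> C" if "j < p" "k < 2" for j k using C that I by force
    obtain k' where "k' < 2" "T 0 k' = 0" using C zero(2) by auto
    then have Tz: "T 0 0 = 0" using IT[OF p0, of k'] by auto
    have "vert C e2"
    proof -
      have "T 0 1 \<noteq> T 0 0" using IT[OF p0, of 0] IT[OF p0, of 1] by auto
      moreover have "vert C (T 0 0 + T 0 1)" using vertI[OF memC[OF p0, of 0] memC[OF p0, of 1]] by simp
      ultimately show ?thesis using vC[of "T 0 0 + T 0 1"] by auto
    qed
    then have vS: "\<not> vert S e2" using R e2z by blast
    have keyS: "j = j' \<and> u = u'" if "(i, j, u) \<in> S" "(i, j', u') \<in> S" "u = u' \<or> u + u' = e2" for i j u j' u'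
      using that j[OF that(1,2)] vertI[of i j u S u'] vS by auto
    have "\<exists>J U. S = {(i, J i k, U i k) | i k. i < p \<and> k < 2} \<and>
        (\<forall>i < p. \<forall>k < 2. J i k < p \<and> outside e2 (U i k) = k)"
      by (rule param_i_outside[OF box(1) S2p e2z]) (rule keyS)
    then obtain J U where S: "S = {(i, J i k, U i k) | i k. i < p \<and> k < 2}"
      and JU: "\<And>i k. i < p \<Longrightarrow> k < 2 \<Longrightarrow> J i k < p \<and> outside e2 (U i k) = k" by blast
    obtain k where "k < 2" "J 0 k = 0" "U 0 k = 0" using S zero(1) by auto
    then have z: "J 0 0 = 0" "U 0 0 = 0" using JU[OF p0, of k] by auto
    have mem: "(i, J i k, U i k) \<in> S" if "i < p" "k < 2" for i k using S that by blast
    define J0 where "J0 i = J i 0" for i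
    have J: "J i k = J0 i" if "i < p" "k < 2" for i k
      using j[OF mem[OF that] mem[OF that(1), of 0]] by (simp add: J0_def)
    have J0: "J0 i < p" if "i < p" for i using JU[OF that, of 0] by (simp add: J0_def)
    define l where "l i = int (outside e2 (T i 0))" for i
    have "scl (int (outside w (U i k))) e2 + scl (int k) w = U i k" if "i < p" "k < 2" for i k
      using klein_coordinates[OF b, of "U i k"] JU[OF that] by simp
    then have S': "S = {comb p e2 w (int i + int (J0 i) * int p) (int (outside w (U i k))) (int k) | i k. i < p \<and> k < 2}"
      by (intro trans[OF S] family_cong) (simp add: comb_eq J J0)
    have "scl (int k) e2 + scl (l j) w = T j k" if "j < p" "k < 2" for j k
    proof -
      have "vert C (T j 0 + T j k)" using vertI[OF memC[OF that(1), of 0] memC[OF that]] by simp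
      then have "outside e2 (T j 0) = outside e2 (T j k)"
        using vC[of "T j 0 + T j k"] by (auto simp: outside_eq_iff[OF e2z])
      then show ?thesis using klein_coordinates[OF b, of "T j k"] IT[OF that] by (simp add: l_def)
    qed
    then have C': "C = {comb p e2 w (int i * int p) (int k) (l i) | i k. i < p \<and> k < 2}"
      by (intro trans[OF C] family_cong) (simp add: comb_eq(2)[OF p0] I)
    show listed
      by (intro listedI[OF b] pair7[of "\<lambda>i. int (J0 i)" "\<lambda>i k. int (outside w (U i k))" l] S' C')
        (simp_all add: J0_def z l_def Tz)
  qed
qed

lemma not_confined:
  assumes "\<And>i j u. (i, j, u) \<in> S \<Longrightarrow> u = 0 \<or> u = v"
  shows False
  using spread_klein[of v] assms by blast

text \<open>
  Both factors now have far types, and they have to share out the four Klein elements. Only one distribution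
  survives: \<open>C\<close> has the far types 0 and \<open>e2\<close>, so that it is the sum of a transversal of the subgroup of
  order \<open>p\<close> and \<open>{0, e2}\<close>, while \<open>S\<close> consists of points in two cosets of the subgroup generated by this
  subgroup of order \<open>p\<close> and \<open>e2\<close>. All other distributions confine \<open>S\<close> to a subgroup of index 2 or
  make one factor too small.
\<close>
lemma listed_if_far_C:
  assumes S2p: "card S = 2 * p" and far: "far C v"
  shows listed
proof -
  note C2p = card_C_2p[OF S2p]
  note R = repelsD(1-3)[OF SC]
  have four: "\<not> near X 0 \<Longrightarrow> \<not> far X 0 \<Longrightarrow> X \<subseteq> box p \<Longrightarrow> card X \<noteq> 2 * p" for X
    using card_le_4[of X p] p3 by auto
  \<comment> \<open>otherwise \<open>C\<close> has 0 as a near type and some \<open>v \<noteq> 0\<close> as a far one;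
    their absence from \<open>S\<close> confines \<open>S\<close>\<close>
  have farC0: "far C 0"
  proof (rule ccontr)
    assume n: "\<not> far C 0"
    then have "near C 0" using four box(2) C2p by blast
    then have nS: "\<not> near S 0" using R by blast
    have "v \<noteq> 0" using n far by blast
    have fS: "\<not> far S v" using R far by blast
    have "\<exists>e. basis v e \<and> (\<forall>i j u. (i, j, u) \<in> S \<longrightarrow> u = 0 \<or> u = e)"
    proof (rule confined_to_two_slices[OF box(1) S2p p3 zero(1) \<open>v \<noteq> 0\<close>])
      show "\<not> near S 0 \<or> \<not> far S 0" using nS by blast
      fix i j u i' j' i'' j'' assume x: "(i, j, u) \<in> S" "(i', j', u) \<in> S" "(i'', j'', u + v) \<in> S"
      have "i = i''" "i' = i''"
        using fS farI[OF x(1,3)] farI[OF x(2,3)] by auto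
      then show "i = i' \<and> j = j'"
        using x nS nearI[of i j u S j' u] by auto
    qed
    then show False using not_confined by blast
  qed
  then have fS0: "\<not> far S 0" using R by blast
  then have nS0: "near S 0" using four box(1) S2p by blast
  then have nC0: "\<not> near C 0" using R by blast
  obtain i1 j1 w where x1: "(i1, j1, w) \<in> S" "i1 \<noteq> 0" using spread by blast
  then have w: "far S w" using farI[OF zero(1) x1(1)] by simp
  then have wz: "w \<noteq> 0" using fS0 by blast
  \<comment> \<open>with a single far type, \<open>S\<close> would be confined to \<open>{0, w}\<close>\<close>
  have "\<exists>w'. far S w' \<and> w' \<noteq> w"
  proof (rule ccontr)
    assume "\<not> ?thesis"
    then have only: "u = w" if "far S u" for u using that by blast
    have "u = 0 \<or> u = w" if "(i, j, u) \<in> S" for i j u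
    proof (cases "i = 0")
      case True
      then have "u + w = w" using farI[OF that x1(1)] x1(2) only by blast
      then show ?thesis by simp
    next
      case False
      then show ?thesis using farI[OF zero(1) that] only by simp
    qed
    then show False using not_confined by blast
  qed
  then obtain w' where w': "far S w'" "w' \<noteq> w" by blast
  then have bw: "basis w w'" using wz fS0 by (auto simp: basis_def)
  define e2 where "e2 = w + w'"
  have b: "basis e2 w" using basis_add(1)[of w' w] bw basis_swap by (auto simp: e2_def add.commute)
  have e2z: "e2 \<noteq> 0" using b by (simp add: basis_def)
  have fC: "u = 0 \<or> u = e2" if "far C u" for u
    using that R(1) w w'(1) by (cases u rule: klein_cases[OF bw]) (auto simp: e2_def)
  obtain i0 j0 i0' j0' u0 where x0: "(i0, j0, u0) \<in> C" "(i0', j0', u0) \<in> C" "i0 \<noteq> i0'"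
    using farC0 unfolding far_def by auto
  have diff: "u0 + u = 0 \<or> u0 + u = e2" if "(i, j, u) \<in> C" for i j u
    using fC[of "u0 + u"] farI[OF x0(1) that] farI[OF x0(2) that] x0(3) by (cases "i = i0") auto
  have Ce2: "u = 0 \<or> u = e2" if "(i, j, u) \<in> C" for i j u
    using diff[OF that] diff[OF zero(2)] by (auto simp: klein_add_eq_iff)
  \<comment> \<open>\<open>C\<close> has all \<open>2 p\<close> possible pairs of \<open>i\<close> and Klein
    component, in particular \<open>(1, e2)\<close>\<close>
  have "\<not> near C e2 \<and> far C e2"
  proof -
    have inj: "inj_on (\<lambda>(i, j, u). (i, u)) C"
    proof (rule inj_onI)
      fix x y assume xy: "x \<in> C" "y \<in> C" "(\<lambda>(i, j, u). (i, u)) x = (\<lambda>(i, j, u). (i, u)) y"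
      obtain i j u i' j' u' where [simp]: "x = (i, j, u)" "y = (i', j', u')"
        by (metis prod.collapse)
      have "j = j'" using xy nC0 nearI[of i j u C j' u'] by auto
      then show "x = y" using xy by simp
    qed
    have "(\<lambda>(i, j, u). (i, u)) ` C \<subseteq> {..<p} \<times> {0, e2}" using box(2) Ce2 by auto
    then have im: "(\<lambda>(i, j, u). (i, u)) ` C = {..<p} \<times> {0, e2}"
      by (rule card_subset_eq[rotated])
        (use C2p e2z card_image[OF inj] in \<open>auto simp: card_cartesian_product\<close>)
    have "(1, e2) \<in> (\<lambda>(i, j, u). (i, u)) ` C" unfolding im using p3 by simp
    then obtain j where "(1, j, e2) \<in> C" by auto
    then have f: "far C e2" using farI[OF zero(2)] by force
    then have fS: "\<not> far S e2" using R by blast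
    have "\<not> near C e2"
    proof
      assume "near C e2"
      then have nS: "\<not> near S e2" using R by blast
      have "\<exists>e. basis e2 e \<and> (\<forall>i j u. (i, j, u) \<in> S \<longrightarrow> u = 0 \<or> u = e)"
      proof (rule confined_to_two_slices[OF box(1) S2p p3 zero(1) e2z])
        show "\<not> near S 0 \<or> \<not> far S 0" using fS0 by blast
        fix i j u i' j' i'' j'' assume x: "(i, j, u) \<in> S" "(i', j', u) \<in> S" "(i'', j'', u + e2) \<in> S"
        have "i = i''" "i' = i''"
          using fS farI[OF x(1,3)] farI[OF x(2,3)] by auto
        moreover from this have "j = j''" "j' = j''"
          using x nS nearI[of i j u S j'' "u + e2"] nearI[of i' j' u S j'' "u + e2"] by auto
        ultimately show "i = i' \<and> j = j'" by simp
      qed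
      then show False using not_confined by blast
    qed
    then show ?thesis using f by blast
  qed
  then have nC: "\<not> near C e2" and fS: "\<not> far S e2" using R by blast+
  have j: "j = j'" if "(i, j, u) \<in> C" "(i, j', u') \<in> C" for i j u j' u'
    using nearI[OF that] Ce2[OF that(1)] Ce2[OF that(2)] nC nC0 by (cases "j = j'") auto
  have keyC: "j = j' \<and> u = u'" if "(i, j, u) \<in> C" "(i, j', u') \<in> C" "u = u' \<or> u + u' = w" for i j u j' u'
    using that j[OF that(1,2)] Ce2[OF that(1)] Ce2[OF that(2)] b by (auto simp: basis_def)
  have "\<exists>J U. C = {(i, J i k, U i k) | i k. i < p \<and> k < 2} \<and>
      (\<forall>i < p. \<forall>k < 2. J i k < p \<and> outside w (U i k) = k)"
    by (rule param_i_outside[OF box(2) C2p wz]) (rule keyC)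
  then obtain J U where C: "C = {(i, J i k, U i k) | i k. i < p \<and> k < 2}"
    and JU: "\<And>i k. i < p \<Longrightarrow> k < 2 \<Longrightarrow> J i k < p \<and> outside w (U i k) = k" by blast
  have memC: "(i, J i k, U i k) \<in> C" if "i < p" "k < 2" for i k using C that by blast
  obtain k where "k < 2" "J 0 k = 0" "U 0 k = 0" using C zero(2) by auto
  then have z: "J 0 0 = 0" "U 0 0 = 0" using JU[OF p0, of k] by auto
  have U: "U i k = scl (int k) e2" if "i < p" "k < 2" for i k
    using Ce2[OF memC[OF that]] JU[OF that] b that(2) by (auto simp: outside_def basis_def)
  define J0 where "J0 i = J i 0" for i
  have J: "J i k = J0 i" if "i < p" "k < 2" for i k
    using j[OF memC[OF that] memC[OF that(1), of 0]] by (simp add: J0_def)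
  have J0: "J0 i < p" if "i < p" for i using JU[OF that, of 0] by (simp add: J0_def)
  have C': "C = {comb p e2 w (int i + int (J0 i) * int p) (int k) 0 | i k. i < p \<and> k < 2}"
    by (rule trans[OF C], rule family_cong) (simp add: comb_eq J J0 U)
  have "(0, 0, e2) \<in> C" using memC[OF p0, of 1] U[OF p0, of 1] J[OF p0, of 1] z by (simp add: J0_def)
  then have "vert C e2" using vertI[OF zero(2)] by force
  then have vS: "\<not> vert S e2" using R e2z by blast
  have i: "i = i'" if "(i, j, u) \<in> S" "(i', j', u') \<in> S" "u = u' \<or> u + u' = e2" for i j u i' j' u'
    using that(3) farI[OF that(1,2)] fS fS0 by (cases "i = i'") auto
  have keyS: "i = i' \<and> u = u'" if "(i, j, u) \<in> S" "(i', j, u') \<in> S" "u = u' \<or> u + u' = e2" for i j u i' u'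
    using that i[OF that] vertI[of i j u S u'] vS by auto
  have "\<exists>I T. S = {(I j k, j, T j k) | j k. j < p \<and> k < 2} \<and>
      (\<forall>j < p. \<forall>k < 2. I j k < p \<and> outside e2 (T j k) = k)"
    by (rule param_j_outside[OF box(1) S2p e2z]) (rule keyS)
  then obtain I T where S: "S = {(I j k, j, T j k) | j k. j < p \<and> k < 2}"
    and IT: "\<And>j k. j < p \<Longrightarrow> k < 2 \<Longrightarrow> I j k < p \<and> outside e2 (T j k) = k" by blast
  have memS: "(I j k, j, T j k) \<in> S" if "j < p" "k < 2" for j k using S that by blast
  obtain k where "k < 2" "I 0 k = 0" "T 0 k = 0" using S zero(1) by auto
  then have Tz: "I 0 0 = 0" "T 0 0 = 0" using IT[OF p0, of k] by auto
  define I0 where "I0 k = I 0 k" for k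
  have I: "I j k = I0 k" if "j < p" "k < 2" for j k
  proof -
    have "T j k = T 0 k \<or> T j k + T 0 k = e2"
      using IT[OF that] IT[OF p0 that(2)] outside_eq_iff[OF e2z] by metis
    then show ?thesis using i[OF memS[OF that] memS[OF p0 that(2)]] by (simp add: I0_def)
  qed
  have I0: "I0 k < p" if "k < 2" for k using IT[OF p0 that] by (simp add: I0_def)
  have "scl (int (outside w (T j k))) e2 + scl (int k) w = T j k" if "j < p" "k < 2" for j k
    using klein_coordinates[OF b, of "T j k"] IT[OF that] by simp
  then have "S = {comb p e2 w (int (I0 k) + int j * int p) (int (outside w (T j k))) (int k) | j k. j < p \<and> k < 2}"
    by (intro trans[OF S] family_cong) (simp add: comb_eq I I0)
  then have S': "S = {comb p e2 w (int (I0 i) + int j * int p) (int (outside w (T j i))) (int i) | i j. i < 2 \<and> j < p}"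
    by blast
  show listed
    by (intro listedI[OF b] pair8[of "\<lambda>i. int (I0 i)" "\<lambda>i j. int (outside w (T j i))" "\<lambda>i. int (J0 i)"] S' C')
      (simp_all add: I0_def J0_def z Tz)
qed

lemma listed_if_card_S_eq_2p:
  assumes "card S = 2 * p"
  shows listed
  using listed_if_near_S[OF assms] listed_if_not_near_S[OF assms] listed_if_far_C[OF assms] by blast

text \<open>
  The order of \<open>S\<close> divides \<open>4 p\<^sup>2\<close>. The divisors 1 and 2 are too small for a generating set that contains 0,
  and \<open>4 p\<^sup>2\<close> is excluded by assumption.
\<close>
lemma pair_is_listed: listed
proof -
  have "card S dvd 4 * p\<^sup>2" using card_mult by (metis dvd_triv_left)
  then obtain x y where xy: "card S = x * y" "x dvd 4" "y dvd p\<^sup>2" using division_decomp by blast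
  have "x \<le> 4" "0 < x" using xy(2) dvd_imp_le[of x 4] dvd_pos_nat[of 4 x] by simp_all
  moreover have "x \<noteq> 3" using xy(2) by (intro notI) simp
  ultimately have x: "x = 1 \<or> x = 2 \<or> x = 4" by auto
  obtain k where "k \<le> 2" "y = p ^ k" using xy(3) p(1) by (auto simp: divides_primepow_nat)
  then have y: "y = 1 \<or> y = p \<or> y = p\<^sup>2" by (auto simp: le_Suc_eq numeral_2_eq_2)
  have "card S \<noteq> 1"
  proof
    assume "card S = 1"
    then have "S = {(0, 0, 0)}" using zero(1) by (metis card_1_singletonE singletonD)
    then show False using spread by simp
  qed
  moreover have "card S \<noteq> 2"
  proof
    assume "card S = 2"
    obtain i j u where u: "(i, j, u) \<in> S" "u \<noteq> 0" using spread_klein by blast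
    obtain i' j' u' where u': "(i', j', u') \<in> S" "u' \<noteq> 0" "u' \<noteq> u" using spread_klein by blast
    have "card {(0, 0, 0), (i, j, u), (i', j', u')} \<le> card S"
      using zero(1) u u' finite_subset[OF box(1)] by (intro card_mono) auto
    then show False using u u' \<open>card S = 2\<close> by simp
  qed
  moreover have "card S = 4 * p\<^sup>2 \<Longrightarrow> False" using card_mult card_C p0 by simp
  moreover have "card S = 2 * p\<^sup>2 \<Longrightarrow> card C = 2" "card S = 4 * p \<Longrightarrow> card C = p"
    "card S = p\<^sup>2 \<Longrightarrow> card C = 4"
    using card_mult p0 by (simp_all add: power2_eq_square)
  ultimately consider "card S = 4" | "card C = 4" | "card S = p" | "card C = p" | "card C = 2" | "card S = 2 * p"
    using x y xy(1) by auto
  then show listed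
    using listed_if_card_S_eq_4 listed_if_card_C_eq_4 listed_if_card_S_eq_p listed_if_card_C_eq_p_near
      listed_if_card_C_eq_p_far listed_if_card_C_eq_2 listed_if_card_S_eq_2p
    by (cases; blast)
qed

end

section \<open>From the group to coordinates\<close>

abbreviation code_group :: "nat \<Rightarrow> (int \<times> int \<times> int) monoid" where
  "code_group p \<equiv> integer_mod_group (p\<^sup>2) \<times>\<times> integer_mod_group 2 \<times>\<times> integer_mod_group 2"

lemma comm_group_DirProd:
  assumes "comm_group G" "comm_group H"
  shows "comm_group (G \<times>\<times> H)"
proof -
  interpret G: comm_group G by fact
  interpret H: comm_group H by fact
  show ?thesis
    by (rule group.group_comm_groupI[OF DirProd_group[OF G.is_group H.is_group]])
      (auto simp: G.m_comm H.m_comm)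
qed

lemma comm_group_code_group: "comm_group (code_group p)"
  by (intro comm_group_DirProd abelian_integer_mod_group)

lemma order_code_group: "0 < p \<Longrightarrow> order (code_group p) = 4 * p\<^sup>2"
  by (simp add: order_def carrier_integer_mod_group card_cartesian_product nat_power_eq)

lemma mult_code_group:
  "(x, y, z) \<otimes>\<^bsub>code_group p\<^esub> (x', y', z') =
     ((x + x') mod int (p\<^sup>2), (y + y') mod 2, (z + z') mod 2)"
  by simp

lemma inv_code_group:
  assumes "(x, y, z) \<in> carrier (code_group p)"
  shows "inv\<^bsub>code_group p\<^esub> (x, y, z) = ((- x) mod int (p\<^sup>2), (- y) mod 2, (- z) mod 2)"
  using assms by (simp add: DirProd_group)

lemma nat_pow_code_group:
  "(x, y, z) [^]\<^bsub>code_group p\<^esub> (n :: nat) = ((int n * x) mod int (p\<^sup>2), (int n * y) mod 2, (int n * z) mod 2)"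
proof (induction n)
  case (Suc n)
  then show ?case
    by (simp add: nat_pow_Suc algebra_simps mod_simps)
qed simp

lemma nat_pow_mult_code_group:
  "(x, y, z) [^]\<^bsub>code_group p\<^esub> (n :: nat) \<otimes>\<^bsub>code_group p\<^esub> (x', y', z') =
     ((int n * x + x') mod int (p\<^sup>2), (int n * y + y') mod 2, (int n * z + z') mod 2)"
  by (simp only: nat_pow_code_group mult_code_group mod_add_left_eq)

lemma int_pow_code_group:
  assumes "(x, y, z) \<in> carrier (code_group p)"
  shows "(x, y, z) [^]\<^bsub>code_group p\<^esub> (n :: int) = ((n * x) mod int (p\<^sup>2), (n * y) mod 2, (n * z) mod 2)"
proof -
  interpret comm_group "code_group p" by (rule comm_group_code_group)
  show ?thesis
  proof (cases "0 \<le> n")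
    case True
    then show ?thesis using nat_pow_code_group[of p x y z "nat n"]
      by (metis int_nat_eq int_pow_int)
  next
    case False
    define m where "m = nat (- n)"
    have n: "n = - int m" using False by (simp add: m_def)
    have "(x, y, z) [^]\<^bsub>code_group p\<^esub> n = inv\<^bsub>code_group p\<^esub> ((x, y, z) [^]\<^bsub>code_group p\<^esub> m)"
      unfolding n using int_pow_neg_int[OF assms] by simp
    also have "\<dots> = ((n * x) mod int (p\<^sup>2), (n * y) mod 2, (n * z) mod 2)"
      using inv_code_group[OF nat_pow_closed[OF assms, of m, unfolded nat_pow_code_group]]
      by (simp only: nat_pow_code_group) (simp add: n mod_simps)
    finally show ?thesis .
  qed
qed

lemma int_comb_code_group:
  assumes "1 < p" "(0, y2, z2) \<in> carrier (code_group p)" "(0, y3, z3) \<in> carrier (code_group p)"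
  shows "int_comb (code_group p) (1, 0, 0) (0, y2, z2) (0, y3, z3) a b c =
    (a mod int (p\<^sup>2), (b * y2 + c * y3) mod 2, (b * z2 + c * z3) mod 2)"
proof -
  have *: "(1, 0, 0) [^]\<^bsub>code_group p\<^esub> a = (a mod int (p\<^sup>2), 0, 0)"
  proof -
    have "1 < int (p\<^sup>2)" using assms(1) by (simp add: one_less_power)
    then have "(1, 0, 0) \<in> carrier (code_group p)" by (simp add: carrier_integer_mod_group)
    from int_pow_code_group[OF this] show ?thesis by simp
  qed
  show ?thesis
    unfolding int_comb_def *
    by (simp only: int_pow_code_group[OF assms(2)] int_pow_code_group[OF assms(3)] mult_code_group)
      (simp add: mod_simps)
qed

definition coord :: "nat \<Rightarrow> int \<times> int \<times> int \<Rightarrow> point" where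
  "coord p g = (nat (fst g mod int p), nat (fst g div int p mod int p), Kl (odd (fst (snd g))) (odd (snd (snd g))))"

definition emb :: "nat \<Rightarrow> point \<Rightarrow> int \<times> int \<times> int" where
  "emb p x = (int (fst x) + int (fst (snd x)) * int p,
     (case snd (snd x) of Kl a b \<Rightarrow> (of_bool a, of_bool b)))"

lemma emb_coord:
  assumes "0 < p" "g \<in> carrier (code_group p)"
  shows "emb p (coord p g) = g"
proof -
  obtain x y z where g: "g = (x, y, z)" by (metis prod.collapse)
  have x: "0 \<le> x" "x < int (p\<^sup>2)" and yz: "y = 0 \<or> y = 1" "z = 0 \<or> z = 1"
    using assms by (auto simp: carrier_integer_mod_group g)
  obtain n where n: "x = int n" using x(1) nonneg_int_cases by blast
  then have "n < p\<^sup>2" using x(2) by (simp only: of_nat_less_iff)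
  then have "n div p < p" using less_mult_imp_div_less[of n p p] by (simp add: power2_eq_square)
  then have "int (nat (x mod int p)) + int (nat (x div int p mod int p)) * int p = x"
    by (simp add: n flip: zdiv_int zmod_int of_nat_mult of_nat_add)
  then show ?thesis using yz by (auto simp: emb_def coord_def g)
qed

lemma emb_carrier:
  assumes "x \<in> box p"
  shows "emb p x \<in> carrier (code_group p)"
proof -
  obtain i j a b where x: "x = (i, j, Kl a b)" by (metis klein.exhaust prod.collapse)
  have ij: "i < p" "j < p" using assms x by auto
  have "i + j * p < p + j * p" using ij by simp
  also have "\<dots> \<le> p\<^sup>2" using ij mult_le_mono1[of "Suc j" p p] by (simp add: power2_eq_square)
  finally have "int (i + j * p) < int (p\<^sup>2)" by (simp only: of_nat_less_iff)
  then show ?thesis using ij by (simp add: carrier_integer_mod_group emb_def x)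
qed

lemma coord_emb:
  assumes "x \<in> box p"
  shows "coord p (emb p x) = x"
proof -
  obtain i j u where x: "x = (i, j, u)" by (metis prod.collapse)
  obtain a b where u: "u = Kl a b" by (cases u)
  have "(int i + int j * int p) mod int p = int i" "(int i + int j * int p) div int p = int j"
    using assms x by auto
  then show ?thesis using assms by (simp add: coord_def emb_def x u)
qed

lemma coord_box: "0 < p \<Longrightarrow> coord p g \<in> box p"
  by (auto simp: coord_def nat_less_iff)

lemma inj_coord: "0 < p \<Longrightarrow> inj_on (coord p) (carrier (code_group p))"
  by (rule inj_on_inverseI[where g = "emb p"]) (rule emb_coord)

lemma emb_mem:
  assumes "0 < p" "A \<subseteq> carrier (code_group p)" "x \<in> coord p ` A"
  shows "emb p x \<in> A"
  using assms emb_coord by auto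

lemma emb_coord_image:
  assumes "0 < p" "A \<subseteq> carrier (code_group p)"
  shows "emb p ` coord p ` A = A"
proof -
  have "emb p (coord p g) = g" if "g \<in> A" for g using emb_coord assms that by blast
  then show ?thesis by (simp add: image_image)
qed

text \<open>
  Since \<open>p\<^sup>2\<close> is odd, the parity of the multiplier is free: one may add \<open>p\<^sup>2\<close> to it.
\<close>
lemma exists_multiplier:
  fixes p :: nat and t t' :: int
  assumes p: "prime p" "odd p" and t: "\<not> int p dvd t"
  shows "\<exists>k :: nat. 0 < k \<and> (odd k \<longleftrightarrow> parity) \<and> [int k * t = t'] (mod int (p\<^sup>2))"
proof -
  have "coprime t (int p)" using prime_imp_coprime[of "int p" t] p(1) t by (simp add: coprime_commute)
  then have "coprime t (int (p\<^sup>2))" by simp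
  then obtain x where x: "[t * x = 1] (mod int (p\<^sup>2))" using cong_solve_coprime_int by blast
  have p2: "0 < int (p\<^sup>2)" using p(1) prime_gt_0_nat by simp
  define k where "k = nat ((x * t') mod int (p\<^sup>2))"
  have "int k = (x * t') mod int (p\<^sup>2)" using p2 by (simp add: k_def)
  then have "[int k * t = x * t' * t] (mod int (p\<^sup>2))" by (simp add: cong_def mod_simps)
  moreover have "[(t * x) * t' = 1 * t'] (mod int (p\<^sup>2))" using x by (rule cong_mult) simp
  ultimately have k: "[int k * t = t'] (mod int (p\<^sup>2))" by (simp add: cong_def mult_ac)
  have shift: "[int (k + m * p\<^sup>2) * t = t'] (mod int (p\<^sup>2))" for m
  proof -
    have "int (k + m * p\<^sup>2) * t = int k * t + (int m * t) * int (p\<^sup>2)" by (simp add: algebra_simps)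
    then show ?thesis using k unfolding cong_def by simp
  qed
  have "odd (p\<^sup>2)" using p(2) by simp
  then have "odd (k + 1 * p\<^sup>2) \<noteq> odd (k + 2 * p\<^sup>2)" by simp
  moreover have "0 < k + 1 * p\<^sup>2" "0 < k + 2 * p\<^sup>2" using p2 by auto
  ultimately show ?thesis using shift[of 1] shift[of 2] by blast
qed

definition pos :: "nat \<Rightarrow> nat \<Rightarrow> nat \<Rightarrow> int" where
  "pos p i j = int i + int j * int p"

text \<open>
  In the Klein part an odd multiplier acts as the identity and an even one as 0.
\<close>
lemma multiplier_coord:
  assumes p: "prime p" "odd p" and t: "tiling (code_group p) A B"
    and k: "0 < k" "coprime k (card A)"
    and mem: "(i, j, u) \<in> coord p ` A" "(i', j', u') \<in> coord p ` A"
      "(m, n, v) \<in> coord p ` B" "(m', n', v') \<in> coord p ` B"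
    and eq: "[int k * (pos p i j - pos p i' j') = pos p m n - pos p m' n'] (mod int (p\<^sup>2))"
      "if odd k then u + u' = v + v' else v = v'"
  shows "(i, j, u) = (i', j', u')" "(m, n, v) = (m', n', v')"
proof -
  interpret comm_group "code_group p" by (rule comm_group_code_group)
  have p0: "0 < p" using p(1) prime_gt_0_nat by simp
  have sub: "A \<subseteq> carrier (code_group p)" "B \<subseteq> carrier (code_group p)" using t by (auto simp: tiling_def)
  have box: "(i, j, u) \<in> box p" "(i', j', u') \<in> box p" "(m, n, v) \<in> box p" "(m', n', v') \<in> box p"
    using mem coord_box[OF p0] by (metis imageE)+
  have "finite (carrier (code_group p))" using p0 by (simp add: carrier_integer_mod_group)
  note * = tiling_multiplier[OF t this k emb_mem[OF p0 sub(1) mem(1)] emb_mem[OF p0 sub(1) mem(2)]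
      emb_mem[OF p0 sub(2) mem(4)] emb_mem[OF p0 sub(2) mem(3)]]
  obtain a b where kl1: "u = Kl a b" by (cases u)
  obtain a' b' where kl2: "u' = Kl a' b'" by (cases u')
  obtain c d where kl3: "v = Kl c d" by (cases v)
  obtain c' d' where kl4: "v' = Kl c' d'" by (cases v')
  note kl = kl1 kl2 kl3 kl4
  have "[int k * pos p i j + pos p m' n' = int k * pos p i' j' + pos p m n] (mod int (p\<^sup>2))"
    using cong_add[OF eq(1) cong_refl[of "int k * pos p i' j' + pos p m' n'"]] by (simp add: algebra_simps)
  then have e1: "(int k * pos p i j + pos p m' n') mod int (p\<^sup>2) = (int k * pos p i' j' + pos p m n) mod int (p\<^sup>2)"
    unfolding cong_def .
  have mod2: "x mod 2 = y mod 2" if "even x = even y" for x y :: int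
    using that by (simp add: mod2_eq_if)
  have e2: "(int k * of_bool a + of_bool c') mod 2 = (int k * of_bool a' + of_bool c :: int) mod 2"
    by (rule mod2) (use eq(2) in \<open>auto simp: kl split: if_splits\<close>)
  have e3: "(int k * of_bool b + of_bool d') mod 2 = (int k * of_bool b' + of_bool d :: int) mod 2"
    by (rule mod2) (use eq(2) in \<open>auto simp: kl split: if_splits\<close>)
  have "emb p (i, j, u) [^]\<^bsub>code_group p\<^esub> k \<otimes>\<^bsub>code_group p\<^esub> emb p (m', n', v') =
      emb p (i', j', u') [^]\<^bsub>code_group p\<^esub> k \<otimes>\<^bsub>code_group p\<^esub> emb p (m, n, v)"
    by (simp only: emb_def kl fst_conv snd_conv klein.case nat_pow_mult_code_group pos_def[symmetric] e1 e2 e3)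
  note E = *[OF this]
  show "(i, j, u) = (i', j', u')"
    using arg_cong[OF E(1), of "coord p"] by (simp only: coord_emb[OF box(1)] coord_emb[OF box(2)])
  show "(m, n, v) = (m', n', v')"
    using arg_cong[OF E(2), of "coord p"] by (simp only: coord_emb[OF box(3)] coord_emb[OF box(4)])
qed

lemma not_dvd_diff: "i < p \<Longrightarrow> i' < p \<Longrightarrow> i \<noteq> i' \<Longrightarrow> \<not> int p dvd (int i - int i' + x * int p)"
proof -
  assume i: "i < p" "i' < p" "i \<noteq> i'"
  show ?thesis
  proof
    assume "int p dvd (int i - int i' + x * int p)"
    then have "int p dvd (int i - int i')" by (simp add: dvd_add_left_iff)
    moreover have "\<bar>int i - int i'\<bar> < int p" using i by linarith
    ultimately show False using i zdvd_imp_le[of "int p" "\<bar>int i - int i'\<bar>"] by auto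
  qed
qed

text \<open>
  For two differences of the same type choose a multiplier \<open>k\<close> that carries the cyclic component of the first to that
  of the second. It is prime to \<open>p\<close>, because both components are units or units times \<open>p\<close>, and can be
  taken odd or, if \<open>card A\<close> is odd, even. If \<open>card A\<close> divides 4, every odd \<open>k\<close> is
  allowed, and \<open>k = p\<^sup>2\<close> kills the cyclic component.
\<close>
lemma repels_coord:
  assumes p: "prime p" "odd p" and t: "tiling (code_group p) A B" and nonempty: "B \<noteq> {}"
  shows "repels (coord p ` A) (coord p ` B)"
proof -
  interpret comm_group "code_group p" by (rule comm_group_code_group)
  have p0: "0 < p" using p(1) prime_gt_0_nat by simp
  have p1: "1 < p" using p(1) prime_gt_1_nat by simp
  have sub: "A \<subseteq> carrier (code_group p)" using t by (auto simp: tiling_def)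
  have cardA: "card (coord p ` A) = card A"
    using inj_on_subset[OF inj_coord[OF p0] sub] by (rule card_image)
  have dvd: "card A dvd 4 * p\<^sup>2" using card_tiling[OF t] order_code_group[OF p0] by (metis dvd_triv_left)
  have boxA: "i < p" "j < p" if "(i, j, u) \<in> coord p ` A" for i j u
    using that coord_box[OF p0] by (metis imageE mem_Sigma_iff lessThan_iff)+
  have boxB: "i < p" "j < p" if "(i, j, u) \<in> coord p ` B" for i j u
    using that coord_box[OF p0] by (metis imageE mem_Sigma_iff lessThan_iff)+
  note mult = multiplier_coord[OF p t]
  have cop: "coprime k p" if "\<not> int p dvd s'" "[int k * s = s'] (mod int (p\<^sup>2))" for k s s'
  proof -
    have "\<not> p dvd k"
    proof
      assume "p dvd k"
      then have "int p dvd int k * s" by simp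
      moreover have "[int k * s = s'] (mod int p)" using that(2) by (rule cong_dvd_modulus) simp
      ultimately show False using that(1) cong_dvd_iff by blast
    qed
    then show ?thesis using p(1) by (metis coprime_commute prime_imp_coprime)
  qed
  have cop_odd: "coprime k (card A)" if "odd k" "coprime k p" for k
  proof -
    have "coprime k 4" using that(1) by (metis coprime_power_right_iff coprime_right_2_iff_odd numeral_Bit0_eq_double power2_eq_square)
    then have "coprime k (4 * p\<^sup>2)" using that(2) by simp
    then show ?thesis using dvd by (metis coprime_divisors dvd_refl)
  qed
  have cop_even: "coprime k (card A)" if "odd (card A)" "coprime k p" for k
  proof -
    have "coprime (card A) 4" using that(1) by (metis coprime_power_right_iff coprime_right_2_iff_odd numeral_Bit0_eq_double power2_eq_square)
    then have "card A dvd p\<^sup>2" using dvd by (simp add: coprime_dvd_mult_right_iff)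
    moreover have "coprime k (p\<^sup>2)" using that(2) by simp
    ultimately show ?thesis by (metis coprime_divisors dvd_refl)
  qed
  have cop_four: "coprime k (card A)" if "card A dvd 4" "odd k" for k
  proof -
    have "coprime k 4" using that(2) by (metis coprime_power_right_iff coprime_right_2_iff_odd numeral_Bit0_eq_double power2_eq_square)
    then show ?thesis using that(1) by (metis coprime_divisors dvd_refl)
  qed
  have posd: "pos p i j - pos p i' j' = int i - int i' + (int j - int j') * int p" for i j i' j'
    by (simp add: pos_def algebra_simps)
  have far_mult: "\<exists>k. 0 < k \<and> (odd k \<longleftrightarrow> parity) \<and> [int k * (pos p i j - pos p i' j') = x] (mod int (p\<^sup>2))"
    if "(i, j, u) \<in> coord p ` A" "(i', j', u') \<in> coord p ` A" "i \<noteq> i'" for i j u i' j' u' x parity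
    unfolding posd
    by (rule exists_multiplier[OF p not_dvd_diff]) (use that boxA in blast)+
  have near_mult: "\<exists>k. 0 < k \<and> (odd k \<longleftrightarrow> parity) \<and> coprime k p \<and>
      [int k * (pos p i j - pos p i j') = pos p m n - pos p m n'] (mod int (p\<^sup>2))"
    if "(i, j, u) \<in> coord p ` A" "(i, j', u') \<in> coord p ` A" "j \<noteq> j'"
      "(m, n, v) \<in> coord p ` B" "(m, n', v') \<in> coord p ` B" "n \<noteq> n'" for i j u j' u' m n v n' v' parity
  proof -
    have nd: "\<not> int p dvd (int j - int j')" "\<not> int p dvd (int n - int n')"
      using not_dvd_diff[of j p j' 0] not_dvd_diff[of n p n' 0] that boxA boxB by auto
    obtain k where k: "0 < k" "odd k \<longleftrightarrow> parity" "[int k * (int j - int j') = int n - int n'] (mod int (p\<^sup>2))"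
      using exists_multiplier[OF p nd(1)] by blast
    have "[int k * (int j - int j') * int p = (int n - int n') * int p] (mod int (p\<^sup>2))"
      using k(3) by (rule cong_scalar_right)
    then show ?thesis using k cop[OF nd(2) k(3)] unfolding posd by (auto simp: mult.assoc)
  qed
  have p2: "odd (p\<^sup>2)" "0 < p\<^sup>2" using p(2) p0 by simp_all
  have p2z: "[int (p\<^sup>2) * x = 0] (mod int (p\<^sup>2))" for x by (simp add: cong_def)
  obtain m0 n0 v0 where b0: "(m0, n0, v0) \<in> coord p ` B"
    using nonempty by (metis ex_in_conv image_eqI prod.collapse)
  show ?thesis
    unfolding repels_def cardA
  proof (intro conjI allI impI)
    fix w assume "far (coord p ` A) w"
    then obtain i j u i' j' u' where a: "(i, j, u) \<in> coord p ` A" "(i', j', u') \<in> coord p ` A"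
      "i \<noteq> i'" "u + u' = w" unfolding far_def by blast
    show "\<not> far (coord p ` B) w"
    proof
      assume "far (coord p ` B) w"
      then obtain m n v m' n' v' where b: "(m, n, v) \<in> coord p ` B" "(m', n', v') \<in> coord p ` B"
        "m \<noteq> m'" "v + v' = w" unfolding far_def by blast
      have nd: "\<not> int p dvd (pos p m n - pos p m' n')"
        unfolding posd by (rule not_dvd_diff) (use b boxB in blast)+
      obtain k where k: "0 < k" "odd k \<longleftrightarrow> True" "[int k * (pos p i j - pos p i' j') = pos p m n - pos p m' n'] (mod int (p\<^sup>2))"
        using far_mult[OF a(1-3)] by blast
      have "coprime k (card A)" using cop_odd cop[OF nd k(3)] k(2) by blast
      from mult(1)[OF k(1) this a(1,2) b(1,2) k(3)] show False using a b k(2) by simp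
    qed
    show "\<not> far (coord p ` B) 0" if oddA: "odd (card A)"
    proof
      assume "far (coord p ` B) 0"
      then obtain m n v m' n' where b: "(m, n, v) \<in> coord p ` B" "(m', n', v) \<in> coord p ` B"
        "m \<noteq> m'" unfolding far_def klein_add_eq_0_iff by blast
      have nd: "\<not> int p dvd (pos p m n - pos p m' n')"
        unfolding posd by (rule not_dvd_diff) (use b boxB in blast)+
      obtain k where k: "0 < k" "odd k \<longleftrightarrow> False" "[int k * (pos p i j - pos p i' j') = pos p m n - pos p m' n'] (mod int (p\<^sup>2))"
        using far_mult[OF a(1-3)] by blast
      have "coprime k (card A)" using cop_even[OF oddA] cop[OF nd k(3)] by blast
      from mult(1)[OF k(1) this a(1,2) b(1,2) k(3)] show False using a b k(2) by simp
    qed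
    assume four: "card A dvd 4"
    show "w \<noteq> 0"
    proof
      assume "w = 0"
      then have "u = u'" using a by simp
      with mult(1)[OF p2(2) cop_four[OF four p2(1)] a(1,2) b0 b0] show False
        using p2z[of "pos p i j - pos p i' j'"] p2 a by simp
    qed
    show "\<not> near (coord p ` B) w"
    proof
      assume "near (coord p ` B) w"
      then obtain m n v n' v' where b: "(m, n, v) \<in> coord p ` B" "(m, n', v') \<in> coord p ` B"
        "v + v' = w" unfolding near_def by blast
      obtain k where k: "0 < k" "odd k \<longleftrightarrow> True" "[int k * (pos p i j - pos p i' j') = pos p m n - pos p m n'] (mod int (p\<^sup>2))"
        using far_mult[OF a(1-3)] by blast
      from mult(1)[OF k(1) cop_four[OF four] a(1,2) b(1,2) k(3)] show False using a b k(2) by simp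
    qed
    show "\<not> vert (coord p ` B) w"
    proof
      assume "vert (coord p ` B) w"
      then obtain m n v v' where b: "(m, n, v) \<in> coord p ` B" "(m, n, v') \<in> coord p ` B"
        "v + v' = w" unfolding vert_def by blast
      with mult(1)[OF p2(2) cop_four[OF four p2(1)] a(1,2) b(1,2)] show False
        using p2z[of "pos p i j - pos p i' j'"] p2 a by simp
    qed
  next
    fix w assume "near (coord p ` A) w"
    then obtain i j u j' u' where a: "(i, j, u) \<in> coord p ` A" "(i, j', u') \<in> coord p ` A"
      "j \<noteq> j'" "u + u' = w" unfolding near_def by blast
    show "\<not> near (coord p ` B) w"
    proof
      assume "near (coord p ` B) w"
      then obtain m n v n' v' where b: "(m, n, v) \<in> coord p ` B" "(m, n', v') \<in> coord p ` B"
        "n \<noteq> n'" "v + v' = w" unfolding near_def by blast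
      obtain k where k: "0 < k" "odd k \<longleftrightarrow> True" "coprime k p"
        "[int k * (pos p i j - pos p i j') = pos p m n - pos p m n'] (mod int (p\<^sup>2))"
        using near_mult[OF a(1-3) b(1-3)] by blast
      from mult(1)[OF k(1) cop_odd a(1,2) b(1,2) k(4)] show False using a b k(2,3) by simp
    qed
    show "\<not> near (coord p ` B) 0" if oddA: "odd (card A)"
    proof
      assume "near (coord p ` B) 0"
      then obtain m n v n' where b: "(m, n, v) \<in> coord p ` B" "(m, n', v) \<in> coord p ` B"
        "n \<noteq> n'" unfolding near_def klein_add_eq_0_iff by blast
      obtain k where k: "0 < k" "odd k \<longleftrightarrow> False" "coprime k p"
        "[int k * (pos p i j - pos p i j') = pos p m n - pos p m n'] (mod int (p\<^sup>2))"
        using near_mult[OF a(1-3) b(1-3)] by blast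
      from mult(1)[OF k(1) cop_even[OF oddA k(3)] a(1,2) b(1,2) k(4)] show False using a b k(2) by simp
    qed
    assume four: "card A dvd 4"
    show "w \<noteq> 0"
    proof
      assume "w = 0"
      then have "u = u'" using a by simp
      with mult(1)[OF p2(2) cop_four[OF four p2(1)] a(1,2) b0 b0] show False
        using p2z[of "pos p i j - pos p i j'"] p2 a by simp
    qed
    show "\<not> vert (coord p ` B) w"
    proof
      assume "vert (coord p ` B) w"
      then obtain m n v v' where b: "(m, n, v) \<in> coord p ` B" "(m, n, v') \<in> coord p ` B"
        "v + v' = w" unfolding vert_def by blast
      with mult(1)[OF p2(2) cop_four[OF four p2(1)] a(1,2) b(1,2)] show False
        using p2z[of "pos p i j - pos p i j'"] p2 a by simp
    qed
  next
    fix w assume "vert (coord p ` A) w"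
    then obtain i j u u' where a: "(i, j, u) \<in> coord p ` A" "(i, j, u') \<in> coord p ` A"
      "u + u' = w" unfolding vert_def by blast
    show "w = 0" if vB: "vert (coord p ` B) w"
    proof -
      obtain m n v v' where b: "(m, n, v) \<in> coord p ` B" "(m, n, v') \<in> coord p ` B"
        "v + v' = w" using vB unfolding vert_def by blast
      have "coprime 1 (card A)" by simp
      from mult(1)[OF _ this a(1,2) b(1,2)] show "w = 0" using a b by simp
    qed
    show "w = 0" if oddA: "odd (card A)"
    proof -
      have "coprime 2 p" using p(2) by simp
      from mult(1)[OF _ cop_even[OF oddA this] a(1,2) b0 b0] show "w = 0" using a by simp
    qed
  qed
qed

section \<open>Perfect codes\<close>

lemma image_family:
  "h ` {f1 i | i. P1 i} = {h (f1 i) | i. P1 i}"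
  "h ` {f2 i j | i j. P2 i j} = {h (f2 i j) | i j. P2 i j}"
  "h ` {f3 i j k | i j k. P3 i j k} = {h (f3 i j k) | i j k. P3 i j k}"
  by blast+

lemma listed_pair_image:
  assumes "listed_pair p E S C"
  shows "listed_pair p (\<lambda>a b c. h (E a b c)) (h ` S) (h ` C)"
  using assms
proof cases
  case (pair1 \<alpha> \<beta>)
  show ?thesis
    by (rule listed_pair.pair1[of \<alpha> \<beta>]) (simp_all add: pair1 image_family)
next
  case (pair2 \<alpha> \<beta> l')
  show ?thesis
    by (rule listed_pair.pair2[of \<alpha> \<beta> l']) (simp_all add: pair2 image_family)
next
  case (pair3 \<alpha> \<alpha>' l)
  show ?thesis
    by (rule listed_pair.pair3[of \<alpha> \<alpha>' l]) (simp_all add: pair3 image_family)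
next
  case (pair4 \<alpha> \<beta>)
  show ?thesis
    by (rule listed_pair.pair4[of \<alpha> \<beta>]) (simp_all add: pair4 image_family)
next
  case (pair5 \<alpha> l')
  show ?thesis
    by (rule listed_pair.pair5[of \<alpha> l']) (simp_all add: pair5 image_family)
next
  case (pair6 \<alpha> \<alpha>' l)
  show ?thesis
    by (rule listed_pair.pair6[of \<alpha> \<alpha>' l]) (simp_all add: pair6 image_family)
next
  case (pair7 \<alpha> \<alpha>' l)
  show ?thesis
    by (rule listed_pair.pair7[of \<alpha> \<alpha>' l]) (simp_all add: pair7 image_family)
next
  case (pair8 \<alpha> \<alpha>' l)
  show ?thesis
    by (rule listed_pair.pair8[of \<alpha> \<alpha>' l]) (simp_all add: pair8 image_family)
next
  case (pair9 \<alpha>')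
  show ?thesis
    by (rule listed_pair.pair9[of \<alpha>']) (simp_all add: pair9 image_family)
next
  case (pair10 \<alpha> l)
  show ?thesis
    by (rule listed_pair.pair10[of \<alpha> l]) (simp_all add: pair10 image_family)
next
  case (pair11 \<alpha> \<alpha>' l)
  show ?thesis
    by (rule listed_pair.pair11[of \<alpha> \<alpha>' l]) (simp_all add: pair11 image_family)
next
  case (pair12 \<alpha>')
  show ?thesis
    by (rule listed_pair.pair12[of \<alpha>']) (simp_all add: pair12 image_family)
next
  case (pair13 \<alpha> l)
  show ?thesis
    by (rule listed_pair.pair13[of \<alpha> l]) (simp_all add: pair13 image_family)
next
  case (pair14 \<alpha>' l)
  show ?thesis
    by (rule listed_pair.pair14[of \<alpha>' l]) (simp_all add: pair14 image_family)
next
  case (pair15 \<alpha> l)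
  show ?thesis
    by (rule listed_pair.pair15[of \<alpha> l]) (simp_all add: pair15 image_family)
next
  case (pair16 \<alpha>')
  show ?thesis
    by (rule listed_pair.pair16[of \<alpha>']) (simp_all add: pair16 image_family)
next
  case (pair17 \<alpha>' l)
  show ?thesis
    by (rule listed_pair.pair17[of \<alpha>' l]) (simp_all add: pair17 image_family)
next
  case (pair18 \<alpha>' l)
  show ?thesis
    by (rule listed_pair.pair18[of \<alpha>' l]) (simp_all add: pair18 image_family)
next
  case (pair19 \<alpha> l)
  show ?thesis
    by (rule listed_pair.pair19[of \<alpha> l]) (simp_all add: pair19 image_family)
next
  case (pair20 \<alpha> l \<mu>)
  show ?thesis
    by (rule listed_pair.pair20[of \<alpha> l \<mu>]) (simp_all add: pair20 image_family)
next
  case (pair21 \<alpha>'')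
  show ?thesis
    by (rule listed_pair.pair21[of \<alpha>'']) (simp_all add: pair21 image_family)
qed

lemma emb_comb:
  assumes p: "1 < p"
  shows "emb p (comb p e2 e3 a b c) =
    int_comb (code_group p) (1, 0, 0) (emb p (0, 0, e2)) (emb p (0, 0, e3)) a b c"
proof -
  obtain x y where e2: "e2 = Kl x y" by (cases e2)
  obtain x' y' where e3: "e3 = Kl x' y'" by (cases e3)
  have 1: "int (nat (a mod int p)) + int (nat (a div int p mod int p)) * int p = a mod int (p\<^sup>2)"
    using p zmod_zmult2_eq[of "int p" a "int p"] by (simp add: power2_eq_square algebra_simps)
  have 2: "scl b (Kl x y) + scl c (Kl x' y') =
      Kl (odd (b * of_bool x + c * of_bool x')) (odd (b * of_bool y + c * of_bool y'))"
    by (cases x; cases y; cases x'; cases y'; cases "even b"; cases "even c")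
      (simp_all add: scl_def zero_klein_def)
  have 3: "of_bool (odd n) = n mod 2" for n :: int
    by (simp add: mod2_eq_if)
  have 4: "emb p (0, 0, Kl v w) = (0, of_bool v, of_bool w)" for v w by (simp add: emb_def)
  have mem: "(0, of_bool v, of_bool w) \<in> carrier (code_group p)" for v w
    using p by (simp add: carrier_integer_mod_group)
  show ?thesis
    unfolding e2 e3 4 int_comb_code_group[OF p mem mem]
    by (simp only: emb_def comb_def fst_conv snd_conv 1 2 klein.case 3)
qed

context
  fixes p :: nat
  assumes p1: "1 < p"
begin

interpretation comm_group "code_group p" by (rule comm_group_code_group)

lemma subgroup_code_group:
  assumes "\<And>x y z. P (x, y, z) \<Longrightarrow> P ((- x) mod int (p\<^sup>2), (- y) mod 2, (- z) mod 2)"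
    and "\<And>x y z x' y' z'. P (x, y, z) \<Longrightarrow> P (x', y', z') \<Longrightarrow>
      P ((x + x') mod int (p\<^sup>2), (y + y') mod 2, (z + z') mod 2)"
    and "P (0, 0, 0)"
  shows "subgroup {g \<in> carrier (code_group p). P g} (code_group p)"
proof (rule subgroupI)
  show "{g \<in> carrier (code_group p). P g} \<noteq> {}"
  proof -
    have "(0, 0, 0) \<in> carrier (code_group p)" by simp
    then show ?thesis using assms(3) by blast
  qed
next
  fix g assume g: "g \<in> {g \<in> carrier (code_group p). P g}"
  obtain x y z where [simp]: "g = (x, y, z)" by (metis prod.collapse)
  have "(x, y, z) \<in> carrier (code_group p)" "P (x, y, z)" using g by auto
  then show "inv\<^bsub>code_group p\<^esub> g \<in> {g \<in> carrier (code_group p). P g}"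
    using inv_closed[of g] assms(1) inv_code_group[of x y z p] by simp
next
  fix g h assume g: "g \<in> {g \<in> carrier (code_group p). P g}" and h: "h \<in> {g \<in> carrier (code_group p). P g}"
  obtain x y z x' y' z' where [simp]: "g = (x, y, z)" "h = (x', y', z')" by (metis prod.collapse)
  have "P (x, y, z)" "P (x', y', z')" using g h by auto
  then show "g \<otimes>\<^bsub>code_group p\<^esub> h \<in> {g \<in> carrier (code_group p). P g}"
    using m_closed[of g h] g h assms(2) by simp
qed auto

text \<open>
  Otherwise \<open>A\<close> would lie in the subgroup of the elements whose cyclic component is divisible by \<open>p\<close>.
\<close>
lemma coord_spread:
  assumes gen: "generate (code_group p) A = carrier (code_group p)" and A: "A \<subseteq> carrier (code_group p)"
  shows "\<exists>i j u. (i, j, u) \<in> coord p ` A \<and> i \<noteq> 0"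
proof (rule ccontr)
  assume "\<not> ?thesis"
  then have z: "fst (coord p g) = 0" if "g \<in> A" for g
    using that by (metis image_eqI prod.collapse)
  let ?H = "{g \<in> carrier (code_group p). int p dvd fst g}"
  have "A \<subseteq> ?H"
  proof
    fix g assume "g \<in> A"
    moreover from this have "fst g mod int p = 0"
    proof -
      have "0 \<le> fst g mod int p" using p1 by simp
      moreover have "nat (fst g mod int p) = 0" using z[OF \<open>g \<in> A\<close>] by (simp add: coord_def)
      ultimately show ?thesis by simp
    qed
    ultimately show "g \<in> ?H" using A by auto
  qed
  moreover have "subgroup ?H (code_group p)"
    by (rule subgroup_code_group) (auto simp: dvd_mod_iff)
  ultimately have "carrier (code_group p) \<subseteq> ?H" using generate_subgroup_incl gen by blast
  moreover have "(1, 0, 0) \<in> carrier (code_group p)"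
    using p1 by (simp add: carrier_integer_mod_group one_less_power)
  ultimately have "int p dvd 1" by fastforce
  then show False using p1 by simp
qed

text \<open>
  Otherwise \<open>A\<close> would lie in the preimage of the subgroup \<open>{0, v}\<close> of the Klein group.
\<close>
lemma coord_spread_klein:
  assumes gen: "generate (code_group p) A = carrier (code_group p)" and A: "A \<subseteq> carrier (code_group p)"
  shows "\<exists>i j u. (i, j, u) \<in> coord p ` A \<and> u \<noteq> 0 \<and> u \<noteq> v"
proof (rule ccontr)
  assume "\<not> ?thesis"
  then have z: "snd (snd (coord p g)) = 0 \<or> snd (snd (coord p g)) = v" if "g \<in> A" for g
    using that by (metis image_eqI prod.collapse)
  define ku where "ku g = (case g of (x :: int, y :: int, z :: int) \<Rightarrow> Kl (odd y) (odd z))" for g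
  have ku: "snd (snd (coord p g)) = ku g" for g by (simp add: coord_def ku_def case_prod_unfold)
  let ?H = "{g \<in> carrier (code_group p). ku g = 0 \<or> ku g = v}"
  have "A \<subseteq> ?H" using A z ku by auto
  moreover have "subgroup ?H (code_group p)"
  proof (rule subgroup_code_group)
    fix x y z x' y' z' assume "ku (x, y, z) = 0 \<or> ku (x, y, z) = v" "ku (x', y', z') = 0 \<or> ku (x', y', z') = v"
    moreover have "ku ((x + x') mod int (p\<^sup>2), (y + y') mod 2, (z + z') mod 2) = ku (x, y, z) + ku (x', y', z')"
      by (auto simp: ku_def)
    ultimately show "ku ((x + x') mod int (p\<^sup>2), (y + y') mod 2, (z + z') mod 2) = 0 \<or>
        ku ((x + x') mod int (p\<^sup>2), (y + y') mod 2, (z + z') mod 2) = v" by auto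
  qed (auto simp: ku_def zero_klein_def)
  ultimately have H: "carrier (code_group p) \<subseteq> ?H" using generate_subgroup_incl gen by blast
  obtain w where w: "w \<noteq> 0" "w \<noteq> v"
  proof (cases "v = 0")
    case True
    then show thesis using that[of "Kl True False"] by (simp add: zero_klein_def)
  next
    case False
    then show thesis using basis_extend[of v] that by (auto simp: basis_def)
  qed
  have "(0, 0, w) \<in> box p" using p1 by simp
  then have "coord p (emb p (0, 0, w)) = (0, 0, w)" "emb p (0, 0, w) \<in> carrier (code_group p)"
    by (rule coord_emb, rule emb_carrier)
  then have "ku (emb p (0, 0, w)) = w" "emb p (0, 0, w) \<in> ?H" using ku[of "emb p (0, 0, w)"] H by (simp, blast)
  then show False using w by simp
qed

lemma emb_add: "emb p (0, 0, u) \<otimes>\<^bsub>code_group p\<^esub> emb p (0, 0, v) = emb p (0, 0, u + v)"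
  by (cases u; cases v) (auto simp: emb_def)

lemma generate_emb_basis:
  assumes b: "basis e2 e3"
  shows "generate (code_group p) {emb p (0, 0, e2), emb p (0, 0, e3)} =
    {0} \<times> carrier (integer_mod_group 2) \<times> carrier (integer_mod_group 2)"
proof
  have mem: "emb p (0, 0, u) \<in> carrier (code_group p)" for u using emb_carrier[of "(0, 0, u)" p] p1 by simp
  have fst: "fst (emb p (0, 0, u)) = 0" for u by (simp add: emb_def)
  have "subgroup {g \<in> carrier (code_group p). fst g = 0} (code_group p)"
    by (rule subgroup_code_group) auto
  then have "generate (code_group p) {emb p (0, 0, e2), emb p (0, 0, e3)} \<subseteq> {g \<in> carrier (code_group p). fst g = 0}"
    using mem fst by (intro generate_subgroup_incl) auto
  then show "generate (code_group p) {emb p (0, 0, e2), emb p (0, 0, e3)} \<subseteq>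
    {0} \<times> carrier (integer_mod_group 2) \<times> carrier (integer_mod_group 2)" by auto
  show "{0} \<times> carrier (integer_mod_group 2) \<times> carrier (integer_mod_group 2) \<subseteq>
      generate (code_group p) {emb p (0, 0, e2), emb p (0, 0, e3)}" (is "_ \<subseteq> ?gen")
  proof
    fix g :: "int \<times> int \<times> int"
    assume g: "g \<in> {0} \<times> carrier (integer_mod_group 2) \<times> carrier (integer_mod_group 2)"
    then have "g \<in> carrier (code_group p)" "fst g = 0" by auto
    then have "emb p (0, 0, snd (snd (coord p g))) = g"
      using emb_coord[of p g] p1 by (simp add: coord_def)
    moreover have "emb p (0, 0, u) \<in> ?gen" for u
    proof (cases u rule: klein_cases[OF b])
      case 1
      have "emb p (0, 0, 0) = \<one>\<^bsub>code_group p\<^esub>" by (simp add: emb_def zero_klein_def)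
      then show ?thesis using 1 generate.one by metis
    next
      case 4
      have "emb p (0, 0, e2) \<otimes>\<^bsub>code_group p\<^esub> emb p (0, 0, e3) \<in> ?gen"
        by (intro generate.eng generate.incl) auto
      then show ?thesis using 4 by (simp only: emb_add)
    qed (auto intro: generate.incl)
    ultimately show "g \<in> ?gen" by metis
  qed
qed

text \<open>
  The elements \<open>e2\<close> and \<open>e3\<close> are only known to generate the part of exponent 2; this makes \<open>E\<close> surjective,
  so that solving the congruences of \<open>listed_pair_covers\<close> covers the group.
\<close>
lemma tiling_if_listed_pair:
  assumes e: "e2 \<in> carrier (code_group p)" "e3 \<in> carrier (code_group p)"
    and gen: "generate (code_group p) {e2, e3} = {0} \<times> carrier (integer_mod_group 2) \<times> carrier (integer_mod_group 2)"
    and listed: "listed_pair p (int_comb (code_group p) (1, 0, 0) e2 e3) A B"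
    and AB: "A \<subseteq> carrier (code_group p)" "B \<subseteq> carrier (code_group p)"
  shows "tiling (code_group p) A B"
proof -
  define E where "E = int_comb (code_group p) (1, 0, 0) e2 e3"
  have "e2 \<in> {0} \<times> carrier (integer_mod_group 2) \<times> carrier (integer_mod_group 2)"
    "e3 \<in> {0} \<times> carrier (integer_mod_group 2) \<times> carrier (integer_mod_group 2)"
    using gen generate.incl[of _ "{e2, e3}" "code_group p"] by auto
  then obtain y2 z2 y3 z3 where e23: "e2 = (0, y2, z2)" "e3 = (0, y3, z3)" by auto
  have E: "E a b c = (a mod int (p\<^sup>2), (b * y2 + c * y3) mod 2, (b * z2 + c * z3) mod 2)" for a b c
    unfolding E_def e23 by (rule int_comb_code_group) (use p1 e e23 in simp_all)
  have add: "E a b c \<otimes>\<^bsub>code_group p\<^esub> E a' b' c' = E (a + a') (b + b') (c + c')" for a b c a' b' c'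
    unfolding E mult_code_group mod_add_eq by (simp add: algebra_simps)
  have cong: "E a b c = E a' b' c'"
    if "[a = a'] (mod int (p\<^sup>2))" "[b = b'] (mod 2)" "[c = c'] (mod 2)" for a b c a' b' c'
  proof -
    have "[b * y2 + c * y3 = b' * y2 + c' * y3] (mod 2)" "[b * z2 + c * z3 = b' * z2 + c' * z3] (mod 2)"
      by (intro cong_add cong_scalar_right that)+
    then show ?thesis using that(1) unfolding E cong_def by simp
  qed
  let ?H = "{g \<in> carrier (code_group p). \<exists>b c. g = E 0 b c}"
  have "subgroup ?H (code_group p)"
  proof (rule subgroup_code_group)
    fix x y z assume "\<exists>b c. (x, y, z) = E 0 b c"
    then obtain b c where "(x, y, z) = E 0 b c" by blast
    then have "((- x) mod int (p\<^sup>2), (- y) mod 2, (- z) mod 2) = E 0 (- b) (- c)"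
      unfolding E by (auto simp: mod_simps)
    then show "\<exists>b c. ((- x) mod int (p\<^sup>2), (- y) mod 2, (- z) mod 2) = E 0 b c" by blast
  next
    fix x y z x' y' z' assume "\<exists>b c. (x, y, z) = E 0 b c" "\<exists>b c. (x', y', z') = E 0 b c"
    then obtain b c b' c' where "(x, y, z) = E 0 b c" "(x', y', z') = E 0 b' c'" by blast
    then have "((x + x') mod int (p\<^sup>2), (y + y') mod 2, (z + z') mod 2) = E 0 (b + b') (c + c')"
      using add[of 0 b c 0 b' c'] mult_code_group by (metis add_0)
    then show "\<exists>b c. ((x + x') mod int (p\<^sup>2), (y + y') mod 2, (z + z') mod 2) = E 0 b c" by blast
  next
    show "\<exists>b c. (0, 0, 0) = E 0 b c" by (intro exI[of _ 0]) (simp add: E)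
  qed
  moreover have "e2 = E 0 1 0" "e3 = E 0 0 1"
    using e unfolding E e23 by (auto simp: carrier_integer_mod_group)
  ultimately have sub: "generate (code_group p) {e2, e3} \<subseteq> ?H"
    using e by (intro generate_subgroup_incl) auto
  have surj0: "\<exists>b c. (0, y, z) = E 0 b c" if "(x, y, z) \<in> carrier (code_group p)" for x y z
  proof -
    have "(0, y, z) \<in> {0} \<times> carrier (integer_mod_group 2) \<times> carrier (integer_mod_group 2)"
      using that by simp
    then have "(0, y, z) \<in> ?H" using sub unfolding gen by (rule subsetD[rotated])
    then show ?thesis by blast
  qed
  have surj: "\<exists>a b c. g = E a b c" if gG: "g \<in> carrier (code_group p)" for g
  proof -
    obtain x y z where g: "g = (x, y, z)" by (metis prod.collapse)
    obtain b c where "(0, y, z) = E 0 b c" using surj0 gG g by blast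
    moreover have "x mod int (p\<^sup>2) = x" using gG p1 by (simp add: g carrier_integer_mod_group)
    ultimately have "g = E x b c" unfolding g E by simp
    then show ?thesis by blast
  qed
  note card = listed_pair_card[OF listed]
  show ?thesis
  proof (rule tilingI_card[OF card(1,2) AB])
    show "card A * card B \<le> order (code_group p)" using card(3) order_code_group[of p] p1 by simp
    fix g assume "g \<in> carrier (code_group p)"
    then obtain x y z where g: "g = E x y z" using surj by blast
    obtain a b c a' b' c' where "E a b c \<in> A" "E a' b' c' \<in> B"
      "[a + a' = x] (mod int (p\<^sup>2))" "[b + b' = y] (mod 2)" "[c + c' = z] (mod 2)"
      using listed_pair_covers[OF listed, of x y z] p1 unfolding E_def[symmetric] by auto
    moreover from this have "g = E a b c \<otimes>\<^bsub>code_group p\<^esub> E a' b' c'"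
      unfolding g add by (intro cong) (simp_all add: cong_sym)
    ultimately show "\<exists>a \<in> A. \<exists>b \<in> B. g = a \<otimes>\<^bsub>code_group p\<^esub> b" by blast
  qed
qed

lemma listed_pair_if_tiling:
  assumes p: "prime p" "odd p" and t: "tiling (code_group p) A B"
    and one: "\<one>\<^bsub>code_group p\<^esub> \<in> A" "\<one>\<^bsub>code_group p\<^esub> \<in> B" and A: "A \<noteq> carrier (code_group p)"
    and gen: "generate (code_group p) A = carrier (code_group p)"
  shows "\<exists>e2 \<in> carrier (code_group p). \<exists>e3 \<in> carrier (code_group p).
    generate (code_group p) {e2, e3} = {0} \<times> carrier (integer_mod_group 2) \<times> carrier (integer_mod_group 2) \<and>
    listed_pair p (int_comb (code_group p) (1, 0, 0) e2 e3) A B"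
proof -
  have p0: "0 < p" using p1 by simp
  have sub: "A \<subseteq> carrier (code_group p)" "B \<subseteq> carrier (code_group p)" using t by (auto simp: tiling_def)
  have fin: "finite (carrier (code_group p))" using p0 by (simp add: carrier_integer_mod_group)
  have card: "card (coord p ` X) = card X" if "X \<subseteq> carrier (code_group p)" for X
    using inj_on_subset[OF inj_coord[OF p0] that] by (rule card_image)
  have AB: "card A * card B = 4 * p\<^sup>2" using card_tiling[OF t] order_code_group[OF p0] by simp
  have c1: "coord p \<one>\<^bsub>code_group p\<^esub> = (0, 0, 0)" by (simp add: coord_def zero_klein_def)
  have "code_pair p (coord p ` A) (coord p ` B)"
  proof
    show "prime p" "odd p" by fact+
    show "coord p ` A \<subseteq> box p" "coord p ` B \<subseteq> box p" using coord_box[OF p0] by blast+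
    show "(0, 0, 0) \<in> coord p ` A" "(0, 0, 0) \<in> coord p ` B" using one c1 by (metis imageI)+
    show "card (coord p ` A) * card (coord p ` B) = 4 * p\<^sup>2" using AB by (simp only: card sub)
    show "card (coord p ` B) \<noteq> 1"
    proof
      assume "card (coord p ` B) = 1"
      then have "card A = order (code_group p)" using AB order_code_group[OF p0] by (simp only: card sub)
      then have "A = carrier (code_group p)" using card_subset_eq[OF fin sub(1)] by (simp add: order_def)
      then show False using A by blast
    qed
    show "\<exists>i j u. (i, j, u) \<in> coord p ` A \<and> i \<noteq> 0" by (rule coord_spread[OF gen sub(1)])
    show "\<exists>i j u. (i, j, u) \<in> coord p ` A \<and> u \<noteq> 0 \<and> u \<noteq> v" for v by (rule coord_spread_klein[OF gen sub(1)])
    show "repels (coord p ` A) (coord p ` B)" using repels_coord[OF p t] one by blast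
    show "repels (coord p ` B) (coord p ` A)" using repels_coord[OF p] t tiling_commute one by blast
  qed
  then obtain e2 e3 where b: "basis e2 e3" and l: "listed_pair p (comb p e2 e3) (coord p ` A) (coord p ` B)"
    using code_pair.pair_is_listed[of p] code_pair.listed_def by blast
  have "listed_pair p (int_comb (code_group p) (1, 0, 0) (emb p (0, 0, e2)) (emb p (0, 0, e3))) A B"
    using listed_pair_image[OF l, of "emb p"] by (simp only: emb_comb[OF p1] emb_coord_image[OF p0] sub)
  moreover have "emb p (0, 0, u) \<in> carrier (code_group p)" for u using emb_carrier[of "(0, 0, u)" p] p0 by simp
  ultimately show ?thesis using generate_emb_basis[OF b] by blast
qed

end

text \<open>
  The closed neighbourhood of \<open>c\<close> is the translate of \<open>S\<^sub>0\<close> by \<open>c\<close>. Disjointness of the translates is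
  injectivity of the sum map, and their union is its image.
\<close>
lemma (in comm_group) perfect_code_iff_tiling:
  assumes "S \<subseteq> carrier G" "S\<^sub>0 = S \<union> {\<one>}" "C \<subseteq> carrier G"
  shows "perfect_code (with_proj (cayley_digraph G S)) C \<longleftrightarrow> tiling G S\<^sub>0 C"
proof -
  have sub: "S\<^sub>0 \<subseteq> carrier G" using assms by auto
  have nbhd: "closed_out_nbhd (with_proj (cayley_digraph G S)) c = (\<lambda>s. s \<otimes> c) ` S\<^sub>0" if c: "c \<in> C" for c
  proof -
    have cG: "c \<in> carrier G" using c assms by blast
    have "v \<in> (\<lambda>s. s \<otimes> c) ` S\<^sub>0" if "v \<in> carrier G" "v \<otimes> inv c \<in> S" for v
    proof -
      have "v = (v \<otimes> inv c) \<otimes> c" using that cG by (simp add: m_assoc)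
      then show ?thesis using that assms(2) by blast
    qed
    moreover have "(s \<otimes> c) \<otimes> inv c = s" if "s \<in> carrier G" for s
      using that cG by (simp add: m_assoc)
    ultimately show ?thesis
      using cG assms(1,2) by (auto simp: closed_out_nbhd_def cayley_digraph_def subset_iff)
  qed
  have inj: "inj_on (\<lambda>(s, c). s \<otimes> c) (S\<^sub>0 \<times> C) \<longleftrightarrow>
      disjoint_family_on (closed_out_nbhd (with_proj (cayley_digraph G S))) C"
  proof
    assume inj: "inj_on (\<lambda>(s, c). s \<otimes> c) (S\<^sub>0 \<times> C)"
    have "(\<lambda>s. s \<otimes> c) ` S\<^sub>0 \<inter> (\<lambda>s. s \<otimes> c') ` S\<^sub>0 = {}" if "c \<in> C" "c' \<in> C" "c \<noteq> c'" for c c'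
    proof (rule ccontr)
      assume "\<not> ?thesis"
      then obtain s s' where "s \<in> S\<^sub>0" "s' \<in> S\<^sub>0" "s \<otimes> c = s' \<otimes> c'" by blast
      then show False using inj_onD[OF inj, of "(s, c)" "(s', c')"] that by simp
    qed
    then show "disjoint_family_on (closed_out_nbhd (with_proj (cayley_digraph G S))) C"
      unfolding disjoint_family_on_def by (simp add: nbhd)
  next
    assume d: "disjoint_family_on (closed_out_nbhd (with_proj (cayley_digraph G S))) C"
    show "inj_on (\<lambda>(s, c). s \<otimes> c) (S\<^sub>0 \<times> C)"
    proof (rule inj_onI, clarify)
      fix s c s' c' assume x: "s \<in> S\<^sub>0" "c \<in> C" "s' \<in> S\<^sub>0" "c' \<in> C" "s \<otimes> c = s' \<otimes> c'"
      then have "s \<otimes> c \<in> (\<lambda>s. s \<otimes> c) ` S\<^sub>0 \<inter> (\<lambda>s. s \<otimes> c') ` S\<^sub>0" by blast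
      then have "c = c'" using d x nbhd unfolding disjoint_family_on_def by blast
      then show "s = s' \<and> c = c'" using x sub assms(3) by (metis right_cancel subsetD)
    qed
  qed
  have "(\<lambda>(s, c). s \<otimes> c) ` (S\<^sub>0 \<times> C) = (\<Union>c \<in> C. (\<lambda>s. s \<otimes> c) ` S\<^sub>0)" by force
  then have "(\<lambda>(s, c). s \<otimes> c) ` (S\<^sub>0 \<times> C) =
      (\<Union>c \<in> C. closed_out_nbhd (with_proj (cayley_digraph G S)) c)" using nbhd by simp
  then show ?thesis
    using inj assms sub by (auto simp: perfect_code_def tiling_def bij_betw_def cayley_digraph_def)
qed

lemma exI7: "P a b c d e f g \<Longrightarrow> \<exists>a b c d e f g. P a b c d e f g"
  by blast

theorem theorem5p7:
  fixes p :: nat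
    and G :: "(int \<times> int \<times> int) monoid"
    and e\<^sub>1 :: "int \<times> int \<times> int"
    and S S\<^sub>0 C :: "(int \<times> int \<times> int) set"
  assumes p: "prime p" "odd p"
    and G: "G = integer_mod_group (p ^ 2) \<times>\<times> integer_mod_group 2 \<times>\<times> integer_mod_group 2"
    and S: "S \<subset> carrier G - {\<one>\<^bsub>G\<^esub>}" "generate G S = carrier G"
    and S\<^sub>0: "S\<^sub>0 = S \<union> {\<one>\<^bsub>G\<^esub>}"
    and C: "\<one>\<^bsub>G\<^esub> \<in> C" "C \<subseteq> carrier G"
    and e\<^sub>1: "e\<^sub>1 = (1, 0, 0)"
  shows "perfect_code (with_proj (cayley_digraph G S)) C \<longleftrightarrow>
    (\<exists>e\<^sub>2 \<in> carrier G. \<exists>e\<^sub>3 \<in> carrier G.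
      generate G {e\<^sub>2, e\<^sub>3} = {0} \<times> carrier (integer_mod_group 2) \<times> carrier (integer_mod_group 2) \<and>
      (\<exists>(\<alpha> :: nat \<Rightarrow> int) (\<alpha>' :: nat \<Rightarrow> nat \<Rightarrow> int) (\<alpha>'' :: nat \<Rightarrow> nat \<Rightarrow> nat \<Rightarrow> int)
         (\<beta> :: nat \<Rightarrow> int) (l :: nat \<Rightarrow> int) (l' :: nat \<Rightarrow> nat \<Rightarrow> int) (\<mu> :: nat \<Rightarrow> int).
        \<alpha> 0 = 0 \<and> \<alpha>' 0 0 = 0 \<and> \<alpha>'' 0 0 0 = 0 \<and> \<beta> 0 = 0 \<and> l 0 = 0 \<and> l' 0 0 = 0 \<and> \<mu> 0 = 0 \<and>
        (let E = int_comb G e\<^sub>1 e\<^sub>2 e\<^sub>3 in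
          (S\<^sub>0 = {E (int i + \<alpha> i * int p) (\<alpha> i) (\<beta> i) | i. i < p} \<and>
           C = {E (int i * int p) (int j) (int k) | i j k. i < p \<and> j < 2 \<and> k < 2}) \<or>
          (S\<^sub>0 = {E (int i + int j * int p) (\<alpha> i) (\<beta> i) | i j. i < p \<and> j < p} \<and>
           C = {E (l' i j * int p) (int i) (int j) | i j. i < 2 \<and> j < 2}) \<or>
          (S\<^sub>0 = {E (int i + int j * int p) (\<alpha>' i j) (\<alpha> i) | i j. i < p \<and> j < p} \<and>
           C = {E (l i * int p) (int j) (int i) | i j. i < 2 \<and> j < 2}) \<or>
          (S\<^sub>0 = {E (int i) (\<alpha> i) (\<beta> i) | i. i < p ^ 2} \<and>
           C = {E 0 (int i) (int j) | i j. i < 2 \<and> j < 2}) \<or>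
          (S\<^sub>0 = {E (int i + \<alpha> i * int p) (int j) (\<alpha> i) | i j. i < p \<and> j < 2} \<and>
           C = {E (int i * int p) (l' i j) (int j) | i j. i < p \<and> j < 2}) \<or>
          (S\<^sub>0 = {E (int i + \<alpha>' i j * int p) (int j) (\<alpha> i) | i j. i < p \<and> j < 2} \<and>
           C = {E (int j * int p) (l i) (int i) | i j. i < 2 \<and> j < p}) \<or>
          (S\<^sub>0 = {E (int i + \<alpha> i * int p) (\<alpha>' i j) (int j) | i j. i < p \<and> j < 2} \<and>
           C = {E (int i * int p) (int j) (l i) | i j. i < p \<and> j < 2}) \<or>
          (S\<^sub>0 = {E (\<alpha> i + int j * int p) (\<alpha>' i j) (int i) | i j. i < 2 \<and> j < p} \<and>
           C = {E (int i + l i * int p) (int j) 0 | i j. i < p \<and> j < 2}) \<or>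
          (S\<^sub>0 = {E (int i + \<alpha>' i j * int p) (\<alpha>' i j) (int j) | i j. i < p \<and> j < 2} \<and>
           C = {E (int i * int p) (int j) 0 | i j. i < p \<and> j < 2}) \<or>
          (S\<^sub>0 = {E (\<alpha> i) (int j) (int i) | i j. i < 2 \<and> j < 2} \<and>
           C = {E (int i) (l i) 0 | i. i < p ^ 2}) \<or>
          (S\<^sub>0 = {E (\<alpha> i + \<alpha>' i j * int p) (int j) (int i) | i j. i < 2 \<and> j < 2} \<and>
           C = {E (int i + int j * int p) (l i) 0 | i j. i < p \<and> j < p}) \<or>
          (S\<^sub>0 = {E (\<alpha>' i j) (int i) (int j) | i j. i < 2 \<and> j < 2} \<and>
           C = {E (int i) 0 0 | i. i < p ^ 2}) \<or>
          (S\<^sub>0 = {E (int i) (int j) (\<alpha> i) | i j. i < p ^ 2 \<and> j < 2} \<and>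
           C = {E 0 (l i) (int i) | i. i < 2}) \<or>
          (S\<^sub>0 = {E (int i + int k * int p) (\<alpha>' i j) (int j) | i j k. i < p \<and> j < 2 \<and> k < p} \<and>
           C = {E (l i * int p) (int i) 0 | i. i < 2}) \<or>
          (S\<^sub>0 = {E (int i + int j * int p) (int k) (\<alpha> i) | i j k. i < p \<and> j < p \<and> k < 2} \<and>
           C = {E (l i * int p) (l i) (int i) | i. i < 2}) \<or>
          (S\<^sub>0 = {E (int i) (\<alpha>' i j) (int j) | i j. i < p ^ 2 \<and> j < 2} \<and>
           C = {E 0 (int i) 0 | i. i < 2}) \<or>
          (S\<^sub>0 = {E (int i + \<alpha>' i j * int p) (int k) (int j) | i j k. i < p \<and> j < 2 \<and> k < 2} \<and>
           C = {E (int i * int p) (l i) 0 | i. i < p}) \<or>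
          (S\<^sub>0 = {E (\<alpha>' i j + int k * int p) (int i) (int j) | i j k. i < 2 \<and> j < 2 \<and> k < p} \<and>
           C = {E (int i + l i * int p) 0 0 | i. i < p}) \<or>
          (S\<^sub>0 = {E (\<alpha> i + int j * int p) (int k) (int i) | i j k. i < 2 \<and> j < p \<and> k < 2} \<and>
           C = {E (int i + l i * int p) (l i) 0 | i. i < p}) \<or>
          (S\<^sub>0 = {E (int i + \<alpha> i * int p) (int j) (int k) | i j k. i < p \<and> j < 2 \<and> k < 2} \<and>
           C = {E (int i * int p) (l i) (\<mu> i) | i. i < p}) \<or>
          (S\<^sub>0 = {E (int i + \<alpha>'' i j k * int p) (int j) (int k) | i j k. i < p \<and> j < 2 \<and> k < 2} \<and>
           C = {E (int i * int p) 0 0 | i. i < p}))))"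
    (is "_ \<longleftrightarrow> (\<exists>e2 \<in> carrier G. \<exists>e3 \<in> carrier G. ?P e2 e3 \<and> ?Q e2 e3)")
proof -
  have p1: "1 < p" using p(1) prime_gt_1_nat by blast
  interpret comm_group G unfolding G by (rule comm_group_code_group)
  have sub: "S \<subseteq> carrier G" using S(1) by blast
  have "generate G S \<subseteq> generate G S\<^sub>0" using mono_generate[of S S\<^sub>0] S\<^sub>0 by blast
  moreover have "generate G S\<^sub>0 \<subseteq> carrier G" using generate_incl[of S\<^sub>0] sub S\<^sub>0 by auto
  ultimately have gen0: "generate G S\<^sub>0 = carrier G" using S(2) by blast
  have S0: "S\<^sub>0 \<subseteq> carrier G" "\<one>\<^bsub>G\<^esub> \<in> S\<^sub>0" "S\<^sub>0 \<noteq> carrier G" using S(1) sub S\<^sub>0 by auto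
  have tiling: "perfect_code (with_proj (cayley_digraph G S)) C \<longleftrightarrow> tiling G S\<^sub>0 C"
    by (rule perfect_code_iff_tiling[OF sub S\<^sub>0 C(2)])
  have main: "tiling G S\<^sub>0 C \<longleftrightarrow> (\<exists>e\<^sub>2 \<in> carrier G. \<exists>e\<^sub>3 \<in> carrier G.
      generate G {e\<^sub>2, e\<^sub>3} = {0} \<times> carrier (integer_mod_group 2) \<times> carrier (integer_mod_group 2) \<and>
      listed_pair p (int_comb G e\<^sub>1 e\<^sub>2 e\<^sub>3) S\<^sub>0 C)"
    using listed_pair_if_tiling[OF p1 p, of S\<^sub>0 C] tiling_if_listed_pair[OF p1, of _ _ S\<^sub>0 C] S0 C gen0
    unfolding e\<^sub>1 G by blast
  show ?thesis
    unfolding tiling main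
  proof (intro bex_cong refl conj_cong)
    fix e\<^sub>2 e\<^sub>3
    show "listed_pair p (int_comb G e\<^sub>1 e\<^sub>2 e\<^sub>3) S\<^sub>0 C \<longleftrightarrow> ?Q e\<^sub>2 e\<^sub>3"
    proof
      assume "listed_pair p (int_comb G e\<^sub>1 e\<^sub>2 e\<^sub>3) S\<^sub>0 C"
      then show "?Q e\<^sub>2 e\<^sub>3"
      proof cases
      case (pair1 \<alpha> \<beta>)
      show ?thesis
        unfolding Let_def
        by (rule exI7[of _ \<alpha> "\<lambda>_ _. 0" "\<lambda>_ _ _. 0" \<beta> "\<lambda>_. 0" "\<lambda>_ _. 0" "\<lambda>_. 0"],
          intro conjI, (simp only: pair1(1-2); fail)+,
          (rule conjI[OF pair1(3,4)] | (rule disjI1, rule conjI[OF pair1(3,4)]) | rule disjI2)+)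
    next
      case (pair2 \<alpha> \<beta> l')
      show ?thesis
        unfolding Let_def
        by (rule exI7[of _ \<alpha> "\<lambda>_ _. 0" "\<lambda>_ _ _. 0" \<beta> "\<lambda>_. 0" "l'" "\<lambda>_. 0"],
          intro conjI, (simp only: pair2(1-3); fail)+,
          (rule conjI[OF pair2(4,5)] | (rule disjI1, rule conjI[OF pair2(4,5)]) | rule disjI2)+)
    next
      case (pair3 \<alpha> \<alpha>' l)
      show ?thesis
        unfolding Let_def
        by (rule exI7[of _ \<alpha> "\<alpha>'" "\<lambda>_ _ _. 0" "\<lambda>_. 0" l "\<lambda>_ _. 0" "\<lambda>_. 0"],
          intro conjI, (simp only: pair3(1-3); fail)+,
          (rule conjI[OF pair3(4,5)] | (rule disjI1, rule conjI[OF pair3(4,5)]) | rule disjI2)+)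
    next
      case (pair4 \<alpha> \<beta>)
      show ?thesis
        unfolding Let_def
        by (rule exI7[of _ \<alpha> "\<lambda>_ _. 0" "\<lambda>_ _ _. 0" \<beta> "\<lambda>_. 0" "\<lambda>_ _. 0" "\<lambda>_. 0"],
          intro conjI, (simp only: pair4(1-2); fail)+,
          (rule conjI[OF pair4(3,4)] | (rule disjI1, rule conjI[OF pair4(3,4)]) | rule disjI2)+)
    next
      case (pair5 \<alpha> l')
      show ?thesis
        unfolding Let_def
        by (rule exI7[of _ \<alpha> "\<lambda>_ _. 0" "\<lambda>_ _ _. 0" "\<lambda>_. 0" "\<lambda>_. 0" "l'" "\<lambda>_. 0"],
          intro conjI, (simp only: pair5(1-2); fail)+,
          (rule conjI[OF pair5(3,4)] | (rule disjI1, rule conjI[OF pair5(3,4)]) | rule disjI2)+)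
    next
      case (pair6 \<alpha> \<alpha>' l)
      show ?thesis
        unfolding Let_def
        by (rule exI7[of _ \<alpha> "\<alpha>'" "\<lambda>_ _ _. 0" "\<lambda>_. 0" l "\<lambda>_ _. 0" "\<lambda>_. 0"],
          intro conjI, (simp only: pair6(1-3); fail)+,
          (rule conjI[OF pair6(4,5)] | (rule disjI1, rule conjI[OF pair6(4,5)]) | rule disjI2)+)
    next
      case (pair7 \<alpha> \<alpha>' l)
      show ?thesis
        unfolding Let_def
        by (rule exI7[of _ \<alpha> "\<alpha>'" "\<lambda>_ _ _. 0" "\<lambda>_. 0" l "\<lambda>_ _. 0" "\<lambda>_. 0"],
          intro conjI, (simp only: pair7(1-3); fail)+,
          (rule conjI[OF pair7(4,5)] | (rule disjI1, rule conjI[OF pair7(4,5)]) | rule disjI2)+)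
    next
      case (pair8 \<alpha> \<alpha>' l)
      show ?thesis
        unfolding Let_def
        by (rule exI7[of _ \<alpha> "\<alpha>'" "\<lambda>_ _ _. 0" "\<lambda>_. 0" l "\<lambda>_ _. 0" "\<lambda>_. 0"],
          intro conjI, (simp only: pair8(1-3); fail)+,
          (rule conjI[OF pair8(4,5)] | (rule disjI1, rule conjI[OF pair8(4,5)]) | rule disjI2)+)
    next
      case (pair9 \<alpha>')
      show ?thesis
        unfolding Let_def
        by (rule exI7[of _ "\<lambda>_. 0" "\<alpha>'" "\<lambda>_ _ _. 0" "\<lambda>_. 0" "\<lambda>_. 0" "\<lambda>_ _. 0" "\<lambda>_. 0"],
          intro conjI, (simp only: pair9(1-1); fail)+,
          (rule conjI[OF pair9(2,3)] | (rule disjI1, rule conjI[OF pair9(2,3)]) | rule disjI2)+)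
    next
      case (pair10 \<alpha> l)
      show ?thesis
        unfolding Let_def
        by (rule exI7[of _ \<alpha> "\<lambda>_ _. 0" "\<lambda>_ _ _. 0" "\<lambda>_. 0" l "\<lambda>_ _. 0" "\<lambda>_. 0"],
          intro conjI, (simp only: pair10(1-2); fail)+,
          (rule conjI[OF pair10(3,4)] | (rule disjI1, rule conjI[OF pair10(3,4)]) | rule disjI2)+)
    next
      case (pair11 \<alpha> \<alpha>' l)
      show ?thesis
        unfolding Let_def
        by (rule exI7[of _ \<alpha> "\<alpha>'" "\<lambda>_ _ _. 0" "\<lambda>_. 0" l "\<lambda>_ _. 0" "\<lambda>_. 0"],
          intro conjI, (simp only: pair11(1-3); fail)+,
          (rule conjI[OF pair11(4,5)] | (rule disjI1, rule conjI[OF pair11(4,5)]) | rule disjI2)+)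
    next
      case (pair12 \<alpha>')
      show ?thesis
        unfolding Let_def
        by (rule exI7[of _ "\<lambda>_. 0" "\<alpha>'" "\<lambda>_ _ _. 0" "\<lambda>_. 0" "\<lambda>_. 0" "\<lambda>_ _. 0" "\<lambda>_. 0"],
          intro conjI, (simp only: pair12(1-1); fail)+,
          (rule conjI[OF pair12(2,3)] | (rule disjI1, rule conjI[OF pair12(2,3)]) | rule disjI2)+)
    next
      case (pair13 \<alpha> l)
      show ?thesis
        unfolding Let_def
        by (rule exI7[of _ \<alpha> "\<lambda>_ _. 0" "\<lambda>_ _ _. 0" "\<lambda>_. 0" l "\<lambda>_ _. 0" "\<lambda>_. 0"],
          intro conjI, (simp only: pair13(1-2); fail)+,
          (rule conjI[OF pair13(3,4)] | (rule disjI1, rule conjI[OF pair13(3,4)]) | rule disjI2)+)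
    next
      case (pair14 \<alpha>' l)
      show ?thesis
        unfolding Let_def
        by (rule exI7[of _ "\<lambda>_. 0" "\<alpha>'" "\<lambda>_ _ _. 0" "\<lambda>_. 0" l "\<lambda>_ _. 0" "\<lambda>_. 0"],
          intro conjI, (simp only: pair14(1-2); fail)+,
          (rule conjI[OF pair14(3,4)] | (rule disjI1, rule conjI[OF pair14(3,4)]) | rule disjI2)+)
    next
      case (pair15 \<alpha> l)
      show ?thesis
        unfolding Let_def
        by (rule exI7[of _ \<alpha> "\<lambda>_ _. 0" "\<lambda>_ _ _. 0" "\<lambda>_. 0" l "\<lambda>_ _. 0" "\<lambda>_. 0"],
          intro conjI, (simp only: pair15(1-2); fail)+,
          (rule conjI[OF pair15(3,4)] | (rule disjI1, rule conjI[OF pair15(3,4)]) | rule disjI2)+)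
    next
      case (pair16 \<alpha>')
      show ?thesis
        unfolding Let_def
        by (rule exI7[of _ "\<lambda>_. 0" "\<alpha>'" "\<lambda>_ _ _. 0" "\<lambda>_. 0" "\<lambda>_. 0" "\<lambda>_ _. 0" "\<lambda>_. 0"],
          intro conjI, (simp only: pair16(1-1); fail)+,
          (rule conjI[OF pair16(2,3)] | (rule disjI1, rule conjI[OF pair16(2,3)]) | rule disjI2)+)
    next
      case (pair17 \<alpha>' l)
      show ?thesis
        unfolding Let_def
        by (rule exI7[of _ "\<lambda>_. 0" "\<alpha>'" "\<lambda>_ _ _. 0" "\<lambda>_. 0" l "\<lambda>_ _. 0" "\<lambda>_. 0"],
          intro conjI, (simp only: pair17(1-2); fail)+,
          (rule conjI[OF pair17(3,4)] | (rule disjI1, rule conjI[OF pair17(3,4)]) | rule disjI2)+)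
    next
      case (pair18 \<alpha>' l)
      show ?thesis
        unfolding Let_def
        by (rule exI7[of _ "\<lambda>_. 0" "\<alpha>'" "\<lambda>_ _ _. 0" "\<lambda>_. 0" l "\<lambda>_ _. 0" "\<lambda>_. 0"],
          intro conjI, (simp only: pair18(1-2); fail)+,
          (rule conjI[OF pair18(3,4)] | (rule disjI1, rule conjI[OF pair18(3,4)]) | rule disjI2)+)
    next
      case (pair19 \<alpha> l)
      show ?thesis
        unfolding Let_def
        by (rule exI7[of _ \<alpha> "\<lambda>_ _. 0" "\<lambda>_ _ _. 0" "\<lambda>_. 0" l "\<lambda>_ _. 0" "\<lambda>_. 0"],
          intro conjI, (simp only: pair19(1-2); fail)+,
          (rule conjI[OF pair19(3,4)] | (rule disjI1, rule conjI[OF pair19(3,4)]) | rule disjI2)+)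
    next
      case (pair20 \<alpha> l \<mu>)
      show ?thesis
        unfolding Let_def
        by (rule exI7[of _ \<alpha> "\<lambda>_ _. 0" "\<lambda>_ _ _. 0" "\<lambda>_. 0" l "\<lambda>_ _. 0" \<mu>],
          intro conjI, (simp only: pair20(1-3); fail)+,
          (rule conjI[OF pair20(4,5)] | (rule disjI1, rule conjI[OF pair20(4,5)]) | rule disjI2)+)
    next
      case (pair21 \<alpha>'')
      show ?thesis
        unfolding Let_def
        by (rule exI7[of _ "\<lambda>_. 0" "\<lambda>_ _. 0" "\<alpha>''" "\<lambda>_. 0" "\<lambda>_. 0" "\<lambda>_ _. 0" "\<lambda>_. 0"],
          intro conjI, (simp only: pair21(1-1); fail)+,
          (rule conjI[OF pair21(2,3)] | (rule disjI1, rule conjI[OF pair21(2,3)]) | rule disjI2)+)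
      qed
    next
      assume "?Q e\<^sub>2 e\<^sub>3"
      then show "listed_pair p (int_comb G e\<^sub>1 e\<^sub>2 e\<^sub>3) S\<^sub>0 C"
        unfolding Let_def by (elim exE conjE disjE) (rule listed_pair.intros; assumption)+
    qed
  qed
qed

end
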